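(* Let $\lambda\in\{1,-1\}$, let $\omega>0$ and $\tau=2\pi/\omega$, and let $\{g_{0N}^B(t)\}_{N\ge1}$, $\{g_{1N}^B(t)\}_{N\ge1}$ be $\tau$-periodic functions with Fourier series $$g_{0N}^B(t)=\sum_{n=-\infty}^{\infty}a_{N,n}e^{in\omega t},\qquad g_{1N}^B(t)=\sum_{n=-\infty}^{\infty}c_{N,n}e^{in\omega t},\qquad N\ge1.$$ Suppose $\{q_N(x,t)\}_{N\ge1}$ is a perturbative solution of the NLS equation $iq_t+q_{xx}-2\lambda|q|^2q=0$ in the quarter plane (see context) such that for every $N\ge1$: (a) $q_N(0,\cdot)-g_{0N}^B\in\mathcal S(\mathbb R_+)$; (b) $q_{Nx}(0,t)-g_{1N}^B(t)=O(t^{-3/2})$ as $t\to\infty$; (c) the set $\{q_N(\cdot,t)\,:\,t\ge0\}$ is bounded in $L^1(\mathbb R_+)$. Introduce the formal power series in a real parameter $\epsilon$: $a_n=\sum_{N\ge1}a_{N,n}\epsilon^N$, $\bar a_n=\sum_{N\ge1}\overline{a_{N,n}}\epsilon^N$, $c_n=\sum_{N\ge1}c_{N,n}\epsilon^N$, $\bar c_n=\sum_{N\ge1}\overline{c_{N,n}}\epsilon^N$, $d_n(k)=\sum_{N\ge1}d_{N,n}(k)\epsilon^N$, and for a formal series $X$ let $\{X\}_N$ denote its coefficient of $\epsilon^N$. Let $D_1^0=\{k\in\mathbb C:\operatorname{Re}k>0,\ \operatorname{Im}k>0\}$ and let $k_1(n)$ be the unique root of $4k^2+n\omega=0$ in $\partial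 D_1^0$, i.e. $k_1(n)=\tfrac{i\sqrt{n\omega}}{2}$ for $n\ge0$ and $k_1(n)=\tfrac{\sqrt{-n\omega}}{2}$ for $n<0$. Then the coefficients $c_{N,n}$ are determined explicitly from the $a_{N,n}$ as follows: for all $N\ge1$ and $n\in\mathbb Z$, $$c_{N,n}=\Big\{\Big(-2i\lambda k\sum_{l,m}\bar a_l\,d_m(k)\,d_{n+l-m}(k)-\lambda\sum_{l,m}\bar c_l\,d_m(k)\,d_{n+l-m}(k)+2\lambda\sum_{l,m}\bar a_l\,a_m\,d_{n+l-m}(k)+2ik\,a_n\Big)\Big|_{k=k_1(n)}\Big\}_N,$$ where the functions $d_{N,n}(k)$, $k\in\partial D_1^0$, satisfy $$d_{N,n}(k)=\frac{1}{4ik^2+in\omega}\Big\{-2\lambda k\sum_{l,m}\bar a_l\,d_m(k)\,d_{n+l-m}(k)+i\lambda\sum_{l,m}\bar c_l\,d_m(k)\,d_{n+l-m}(k)-2i\lambda\sum_{l,m}\bar a_l\,a_m\,d_{n+l-m}(k)+2k\,a_n+i\,c_n\Big\}_N,$$ all sums running over $l,m\in\mathbb Z$. (Since the nonlinear sums contribute at order $\epsilon^N$ only through coefficients of order $<N$, these relations determine $c_{N,n}$ and then $d_{N,n}(k)$ recursively in $N$; in particular $c_{1,n}=2ik_1(n)a_{1,n}$ and $d_{1,n}(k)=a_{1,n}/(2i(k+k_1(n)))$.)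
   Context: $\mathcal S(\mathbb R_+)$ denotes the Schwartz space on $[0,\infty)$. A perturbative solution of the NLS equation $iq_t+q_{xx}-2\lambda|q|^2q=0$ ($\lambda=\pm1$) in the quarter plane is a sequence of smooth functions $\{q_N(x,t)\}_{N\ge1}$ defined for $x>0,t>0$ such that: (i) the formal series $q=\epsilon q_1+\epsilon^2q_2+\epsilon^3q_3+\cdots$ (with $\epsilon$ real, $\bar q=\sum_N\bar q_N\epsilon^N$) satisfies the equation order by order, i.e. for every $N\ge1$, $iq_{Nt}+q_{Nxx}-2\lambda\{|q|^2q\}_N=0$ in $\{x>0,t>0\}$, where $\{\cdot\}_N$ is the coefficient of $\epsilon^N$ (e.g. $iq_{1t}+q_{1xx}=0$, $iq_{2t}+q_{2xx}=0$, $iq_{3t}+q_{3xx}-2\lambda|q_1|^2q_1=0$, $iq_{4t}+q_{4xx}-2\lambda(q_1^2\bar q_2+2q_1q_2\bar q_1)=0$); (ii) for each $N$, $q_N$ and all its partial derivatives extend continuously to $\{x\ge0,t\ge0\}$; (iii) for each $N$, $q_N(\cdot,0)\in\mathcal S(\mathbb R_+)$.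
   Formalization: The relation for d_{N,n}(k) is stated on ∂D_1^0 without the points k_1(m), where it reads 0/0, and evaluation at k=k_1(n) is the limit along the rest of ∂D_1^0; convergence of the sums and the N=1 formulas are not stated separately. *)

theory Defs
  imports "HOL-Analysis.Analysis" "HOL-Library.Landau_Symbols"
begin

text \<open>Coefficient of eps^N in a product of three formal power series
  X = sum_{i>=1} X_i eps^i etc. (all series start at order 1).\<close>
definition coef3 :: "(nat \<Rightarrow> complex) \<Rightarrow> (nat \<Rightarrow> complex) \<Rightarrow> (nat \<Rightarrow> complex) \<Rightarrow> nat \<Rightarrow> complex" where
  "coef3 X Y Z N =
     (\<Sum>(i,j,p)\<in>{(i,j,p). 1 \<le> i \<and> 1 \<le> j \<and> 1 \<le> p \<and> i + j + p = N}. X i * Y j * Z p)"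

text \<open>Coefficient of eps^N of sum_{l,m in Z} X_l Y_m Z_{n+l-m}, where
  X_l = sum_N X N l eps^N, etc.\<close>
definition tri :: "(nat \<Rightarrow> int \<Rightarrow> complex) \<Rightarrow> (nat \<Rightarrow> int \<Rightarrow> complex) \<Rightarrow> (nat \<Rightarrow> int \<Rightarrow> complex)
                   \<Rightarrow> int \<Rightarrow> nat \<Rightarrow> complex" where
  "tri X Y Z n N =
     infsum (\<lambda>(l,m). coef3 (\<lambda>i. X i l) (\<lambda>j. Y j m) (\<lambda>p. Z p (n + l - m)) N) (UNIV :: (int \<times> int) set)"

definition schwartz_Rplus :: "(real \<Rightarrow> complex) \<Rightarrow> bool" where
  "schwartz_Rplus f \<longleftrightarrow>
     (\<exists>F :: nat \<Rightarrow> real \<Rightarrow> complex.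
        (\<forall>x\<ge>0. F 0 x = f x) \<and>
        (\<forall>j. \<forall>x\<ge>0. (F j has_vector_derivative F (Suc j) x) (at x within {0..})) \<and>
        (\<forall>j k. \<exists>C. \<forall>x\<ge>0. norm (of_real (x ^ k) * F j x) \<le> C))"

text \<open>D i j is the partial derivative d_x^i d_t^j of the function D 0 0 in the open quarter plane
  {x>0,t>0}; all D i j are continuous on the closed quarter plane {x>=0,t>=0}.
  (Existence and continuity of all partials means D 0 0 is C^infinity in the open quarter plane,
  and D i j is the continuous extension of its partial derivatives.)\<close>
definition smooth_qp :: "(nat \<Rightarrow> nat \<Rightarrow> real \<Rightarrow> real \<Rightarrow> complex) \<Rightarrow> bool" where
  "smooth_qp D \<longleftrightarrow>
     (\<forall>i j. continuous_on {p :: real \<times> real. 0 \<le> fst p \<and> 0 \<le> snd p} (\<lambda>p. D i j (fst p) (snd p))) \<and>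
     (\<forall>i j x t. 0 < x \<longrightarrow> 0 < t \<longrightarrow>
        ((\<lambda>y. D i j y t) has_vector_derivative D (Suc i) j x t) (at x) \<and>
        ((\<lambda>s. D i j x s) has_vector_derivative D i (Suc j) x t) (at t))"

text \<open>Perturbative solution of i q_t + q_xx - 2 lam |q|^2 q = 0 in the quarter plane.
  Q N i j x t = d_x^i d_t^j q_N (x,t) (continuously extended to the closed quarter plane).\<close>
definition pert_sol :: "real \<Rightarrow> (nat \<Rightarrow> nat \<Rightarrow> nat \<Rightarrow> real \<Rightarrow> real \<Rightarrow> complex) \<Rightarrow> bool" where
  "pert_sol lam Q \<longleftrightarrow>
     (\<forall>N\<ge>1. smooth_qp (Q N)) \<and>
     (\<forall>N\<ge>1. \<forall>x t. 0 < x \<longrightarrow> 0 < t \<longrightarrow>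
        \<i> * Q N 0 1 x t + Q N 2 0 x t
          - 2 * of_real lam * coef3 (\<lambda>j. Q j 0 0 x t) (\<lambda>j. cnj (Q j 0 0 x t)) (\<lambda>j. Q j 0 0 x t) N = 0) \<and>
     (\<forall>N\<ge>1. schwartz_Rplus (\<lambda>x. Q N 0 0 x 0))"

text \<open>Open first quadrant D_1^0 and the root k_1(n) of 4k^2 + n omega = 0 on its boundary.\<close>
definition D10 :: "complex set" where
  "D10 = {k. 0 < Re k \<and> 0 < Im k}"

definition k1 :: "real \<Rightarrow> int \<Rightarrow> complex" where
  "k1 \<omega> n = (if 0 \<le> n then \<i> * of_real (sqrt (of_int n * \<omega>)) / 2
              else of_real (sqrt (- of_int n * \<omega>)) / 2)"

definition fourier_coeff :: "real \<Rightarrow> (real \<Rightarrow> complex) \<Rightarrow> int \<Rightarrow> complex" where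
  "fourier_coeff \<omega> g n =
     (LINT t:{0..2 * pi / \<omega>}|lborel. g t * exp (- \<i> * of_int n * of_real \<omega> * of_real t)) / of_real (2 * pi / \<omega>)"

end

theory Submission
  imports Defs "HOL-Computational_Algebra.Formal_Power_Series"
begin

text \<open>Let \<open>r\<close> be the quotient of the two components of the eigenfunction of the Lax pair that decays as
  \<open>x \<rightarrow> \<infinity>\<close>, expanded in powers of \<open>\<epsilon>\<close>. It solves a Riccati equation in \<open>x\<close>, and the \<open>L\<^sup>1\<close> bounds on the
  \<open>q\<^sub>N\<close> bound its coefficients \<open>r\<^sub>N(x,t,k)\<close> uniformly in \<open>x\<close>, \<open>t\<close> and \<open>Im k > 0\<close>. It also solves a Riccati
  equation in \<open>t\<close>; this uses compatibility and local bounds on \<open>\<partial>\<^sub>x q\<^sub>N\<close>, which an energy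
  estimate for Steklov averages supplies. At \<open>x = 0\<close> and for \<open>k\<close> in the open
  quadrant the homogeneous solutions grow in time, so the bounded \<open>r\<^sub>N(0,t,k)\<close> approaches the unique periodic solution
  \<open>P\<^sub>N(t,k)\<close> of the equation with periodic data, which is therefore bounded uniformly in \<open>k\<close>, up to
  the boundary of the quadrant. The \<open>d\<^sub>N\<^sub>,\<^sub>n(k)\<close> are the Fourier coefficients of \<open>P\<^sub>N\<close>. The recursion for them
  is the Fourier transform of the equation in \<open>t\<close>, and the formula for \<open>c\<^sub>N\<^sub>,\<^sub>n\<close> says that
  \<open>(4ik\<^sup>2 + in\<omega>) d\<^sub>N\<^sub>,\<^sub>n(k)\<close> tends to \<open>0\<close> as \<open>k \<rightarrow> k\<^sub>1(n)\<close>, which follows from boundedness.\<close>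

section \<open>Functions on the closed quarter plane\<close>

text \<open>For t > 0 and large x the hypotheses control q_N only in L^1 and say nothing of its
  derivatives. That suffices for the equation in x, where every inhomogeneous term has a factor from
  q, but the equation in t contains q_x and needs control of it as x grows. An energy identity would
  give this if its boundary terms at infinity vanished. Steklov averages satisfy the bounds needed
  for that with constants of order 1/h; these drop out of the final estimate, so h can tend to 0. In
  the quadrant, Im k > 0 selects the solution bounded in x, and Re(4ik^2) = -8 Re k Im k < 0 the one
  bounded in t. On the boundary the second selection fails, so bounds there are limits from inside.
  The formula for the periodic solution has the denominator exp(4ik^2 tau) - 1, which vanishes on
  the boundary exactly at the points k_1(m); all are removed at once because every d_m enters the
  sums, and the value at k_1(n) becomes a limit. The data are not on equal footing: g_0N is C^1 with
  absolutely summable coefficients, while g_1N is only known to be continuous.\<close>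

definition qcont :: "(real \<Rightarrow> real \<Rightarrow> 'a::topological_space) \<Rightarrow> bool" where
  "qcont f \<longleftrightarrow> continuous_on ({0..} \<times> {0..}) (\<lambda>(x, t). f x t)"

lemma qcont_compose:
  assumes "qcont f" "continuous_on S g" "continuous_on S h"
    and "\<And>s. s \<in> S \<Longrightarrow> 0 \<le> g s \<and> 0 \<le> h s"
  shows "continuous_on S (\<lambda>s. f (g s) (h s))"
proof -
  have "continuous_on S (\<lambda>s. (\<lambda>(x, t). f x t) (g s, h s))"
    by (rule continuous_on_compose2[OF assms(1)[unfolded qcont_def]])
       (use assms in \<open>auto intro!: continuous_intros\<close>)
  then show ?thesis by simp
qed

lemma qcont_x: "qcont f \<Longrightarrow> 0 \<le> t \<Longrightarrow> continuous_on {0..} (\<lambda>x. f x t)"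
  by (rule qcont_compose) (auto intro: continuous_intros)

lemma qcont_t: "qcont f \<Longrightarrow> 0 \<le> x \<Longrightarrow> continuous_on {0..} (\<lambda>t. f x t)"
  by (rule qcont_compose) (auto intro: continuous_intros)

lemma qcont_x_Icc: "qcont f \<Longrightarrow> 0 \<le> t \<Longrightarrow> 0 \<le> a \<Longrightarrow> continuous_on {a..b} (\<lambda>x. f x t)"
  by (rule qcont_compose) (auto intro: continuous_intros)

lemma qcont_t_Icc: "qcont f \<Longrightarrow> 0 \<le> x \<Longrightarrow> 0 \<le> a \<Longrightarrow> continuous_on {a..b} (\<lambda>t. f x t)"
  by (rule qcont_compose) (auto intro: continuous_intros)

lemma qcontI: "continuous_on ({0..} \<times> {0..}) (\<lambda>p. f (fst p) (snd p)) \<Longrightarrow> qcont f"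
  by (simp add: qcont_def case_prod_beta)

lemma qcontD: "qcont f \<Longrightarrow> continuous_on ({0..} \<times> {0..}) (\<lambda>p. f (fst p) (snd p))"
  by (simp add: qcont_def case_prod_beta)

lemma qcont_swap: "qcont f \<Longrightarrow> qcont (\<lambda>t x. f x t)"
  by (rule qcontI, rule qcont_compose) (auto intro!: continuous_intros)

lemma qcont_bounded:
  fixes f :: "real \<Rightarrow> real \<Rightarrow> complex"
  assumes "qcont f"
  obtains B where "0 \<le> B" "\<And>x t. 0 \<le> x \<Longrightarrow> x \<le> X \<Longrightarrow> 0 \<le> t \<Longrightarrow> t \<le> T \<Longrightarrow> cmod (f x t) \<le> B"
proof -
  have "compact ((\<lambda>p. f (fst p) (snd p)) ` ({0..X} \<times> {0..T}))"
    by (rule compact_continuous_image)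
       (auto intro!: qcont_compose[OF assms] continuous_intros compact_Times)
  then have "bounded ((\<lambda>p. f (fst p) (snd p)) ` ({0..X} \<times> {0..T}))"
    by (rule compact_imp_bounded)
  then obtain B where B: "B > 0" "\<forall>y\<in>(\<lambda>p. f (fst p) (snd p)) ` ({0..X} \<times> {0..T}). cmod y \<le> B"
    unfolding bounded_pos by blast
  then show ?thesis using that[of B] by force
qed

lemma at_within_halfline: "(x::real) < b \<Longrightarrow> at x within {a..} = at x within {a..b}"
  by (rule at_within_nhd[where S="{..<b}"]) auto

lemma has_vector_derivative_integral_halfline:
  fixes f :: "real \<Rightarrow> 'a::banach"
  assumes "continuous_on {a..} f" "a \<le> x"
  shows "((\<lambda>u. integral {a..u} f) has_vector_derivative f x) (at x within {a..})"
proof -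
  have "((\<lambda>u. integral {a..u} f) has_vector_derivative f x) (at x within {a..x+1})"
    by (rule integral_has_vector_derivative) (use assms in \<open>auto intro: continuous_on_subset\<close>)
  then show ?thesis by (simp add: at_within_halfline[of x "x+1" a])
qed

text \<open>Derivatives are given at interior points only. For t > 0 the fundamental theorem asks
  for no more, and its integrated form passes to t = 0 by continuity in t. Then f is, on every
  horizontal line, the integral of a continuous function, hence differentiable up to x = 0.\<close>

lemma has_vector_derivative_atLeast_boundary:
  fixes f f' :: "real \<Rightarrow> real \<Rightarrow> complex"
  assumes f: "qcont f" and f': "qcont f'"
    and d: "\<And>x t. 0 < x \<Longrightarrow> 0 < t \<Longrightarrow> ((\<lambda>y. f y t) has_vector_derivative f' x t) (at x)"
    and x: "0 \<le> x" and t: "0 \<le> t"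
  shows "((\<lambda>y. f y t) has_vector_derivative f' x t) (at x within {0..})"
proof -
  have pos: "f x s - f 0 s - integral {0..x} (\<lambda>y. f' y s) = 0" if "0 \<le> x" "0 < s" for x s
  proof -
    have "((\<lambda>y. f' y s) has_integral (f x s - f 0 s)) {0..x}"
      by (rule fundamental_theorem_of_calculus_interior)
         (use that d in \<open>auto intro!: qcont_x_Icc[OF f]\<close>)
    then show ?thesis by (simp add: integral_unique)
  qed
  have all: "f x s - f 0 s - integral {0..x} (\<lambda>y. f' y s) = 0" if x: "0 \<le> x" and "0 \<le> s" for x s
  proof (rule continuous_constant_on_closure[where S="{0<..}" and a=0 and x=s
        and f="\<lambda>s. f x s - f 0 s - integral {0..x} (\<lambda>y. f' y s)"])
    have "continuous_on ({0..} \<times> cbox 0 x) (\<lambda>(s, y). f' y s)"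
      unfolding case_prod_beta by (rule qcont_compose[OF f']) (auto intro!: continuous_intros)
    from integral_continuous_on_param[OF this]
    have "continuous_on {0..} (\<lambda>s. integral {0..x} (\<lambda>y. f' y s))" by simp
    then show "continuous_on (closure {0::real<..}) (\<lambda>s. f x s - f 0 s - integral {0..x} (\<lambda>y. f' y s))"
      by (simp, intro continuous_intros qcont_t[OF f]) (use x in auto)
    show "s \<in> closure {0::real<..}" using that by simp
    show "f x u - f 0 u - integral {0..x} (\<lambda>y. f' y u) = 0" if "u \<in> {0<..}" for u
      by (rule pos[OF x]) (use that in simp)
  qed
  have "((\<lambda>u. f 0 t + integral {0..u} (\<lambda>y. f' y t)) has_vector_derivative 0 + f' x t) (at x within {0..})"
    by (intro has_vector_derivative_add has_vector_derivative_const
        has_vector_derivative_integral_halfline[OF qcont_x[OF f' t] x])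
  then have "((\<lambda>u. f 0 t + integral {0..u} (\<lambda>y. f' y t)) has_vector_derivative f' x t) (at x within {0..})"
    by simp
  then show ?thesis
  proof (rule has_vector_derivative_transform[rotated -1])
    show "f y t = f 0 t + integral {0..y} (\<lambda>y. f' y t)" if "y \<in> {0..}" for y
      using all[of y t] that t by (simp only: atLeast_iff diff_diff_eq right_minus_eq)
  qed (use x in simp)
qed

lemma smooth_qp_qcont: "smooth_qp D \<Longrightarrow> qcont (D i j)"
proof -
  assume "smooth_qp D"
  then have "continuous_on {p :: real \<times> real. 0 \<le> fst p \<and> 0 \<le> snd p} (\<lambda>p. D i j (fst p) (snd p))"
    by (simp add: smooth_qp_def)
  moreover have "{p :: real \<times> real. 0 \<le> fst p \<and> 0 \<le> snd p} = {0..} \<times> {0..}" by auto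
  ultimately show ?thesis by (intro qcontI) simp
qed

lemma smooth_qp_dx:
  assumes "smooth_qp D" "0 \<le> x" "0 \<le> t"
  shows "((\<lambda>y. D i j y t) has_vector_derivative D (Suc i) j x t) (at x within {0..})"
  by (rule has_vector_derivative_atLeast_boundary)
     (use assms in \<open>auto simp: smooth_qp_def intro: smooth_qp_qcont\<close>)

lemma smooth_qp_dt:
  assumes "smooth_qp D" "0 \<le> x" "0 \<le> t"
  shows "((\<lambda>s. D i j x s) has_vector_derivative D i (Suc j) x t) (at t within {0..})"
  by (rule has_vector_derivative_atLeast_boundary[where f="\<lambda>t x. D i j x t" and f'="\<lambda>t x. D i (Suc j) x t"])
     (use assms in \<open>auto simp: smooth_qp_def intro!: qcont_swap[OF smooth_qp_qcont]\<close>)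

lemma qcont_eqI:
  fixes f g :: "real \<Rightarrow> real \<Rightarrow> complex"
  assumes "qcont f" "qcont g" "\<And>x t. 0 < x \<Longrightarrow> 0 < t \<Longrightarrow> f x t = g x t" "0 \<le> x" "0 \<le> t"
  shows "f x t = g x t"
proof -
  have "(\<lambda>p. f (fst p) (snd p) - g (fst p) (snd p)) (x,t) = 0"
  proof (rule continuous_constant_on_closure[where S="{0<..} \<times> {0<..}"])
    show "continuous_on (closure ({0<..} \<times> {0<..})) (\<lambda>p. f (fst p) (snd p) - g (fst p) (snd p))"
      by (simp add: closure_Times) (intro continuous_intros qcontD assms)
  qed (use assms in \<open>auto simp: closure_Times\<close>)
  then show ?thesis by simp
qed

lemma qcont_const [intro]: "qcont (\<lambda>x t. c)"
  by (simp add: qcont_def case_prod_beta)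

lemma qcont_add:
  fixes f g :: "real \<Rightarrow> real \<Rightarrow> complex"
  shows "qcont f \<Longrightarrow> qcont g \<Longrightarrow> qcont (\<lambda>x t. f x t + g x t)"
  by (simp add: qcont_def case_prod_beta continuous_on_add)

lemma qcont_diff:
  fixes f g :: "real \<Rightarrow> real \<Rightarrow> complex"
  shows "qcont f \<Longrightarrow> qcont g \<Longrightarrow> qcont (\<lambda>x t. f x t - g x t)"
  by (simp add: qcont_def case_prod_beta continuous_on_diff)

lemma qcont_mult:
  fixes f g :: "real \<Rightarrow> real \<Rightarrow> complex"
  shows "qcont f \<Longrightarrow> qcont g \<Longrightarrow> qcont (\<lambda>x t. f x t * g x t)"
  by (simp add: qcont_def case_prod_beta continuous_on_mult)

lemma qcont_cnj:
  fixes f :: "real \<Rightarrow> real \<Rightarrow> complex"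
  shows "qcont f \<Longrightarrow> qcont (\<lambda>x t. cnj (f x t))"
  by (simp add: qcont_def case_prod_beta continuous_on_cnj)

lemma qcont_sum:
  fixes f :: "'b \<Rightarrow> real \<Rightarrow> real \<Rightarrow> complex"
  shows "(\<And>i. i \<in> I \<Longrightarrow> qcont (f i)) \<Longrightarrow> qcont (\<lambda>x t. \<Sum>i\<in>I. f i x t)"
  by (simp add: qcont_def case_prod_beta continuous_on_sum)

section \<open>Energy estimate for the inhomogeneous Schroedinger equation\<close>

text \<open>The equation i u_t + u_xx = f, solved for u_t and valid up to the boundary. The
  derivatives are separate arguments so that Steklov averaging can act on all five functions at
  once.\<close>

definition schro ::
  "(real \<Rightarrow> real \<Rightarrow> complex) \<Rightarrow> (real \<Rightarrow> real \<Rightarrow> complex) \<Rightarrow> (real \<Rightarrow> real \<Rightarrow> complex)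
   \<Rightarrow> (real \<Rightarrow> real \<Rightarrow> complex) \<Rightarrow> (real \<Rightarrow> real \<Rightarrow> complex) \<Rightarrow> bool" where
  "schro u ux uxx ut f \<longleftrightarrow> qcont u \<and> qcont ux \<and> qcont uxx \<and> qcont ut \<and> qcont f \<and>
     (\<forall>x\<ge>0. \<forall>t\<ge>0.
        ((\<lambda>y. u y t) has_vector_derivative ux x t) (at x within {0..}) \<and>
        ((\<lambda>y. ux y t) has_vector_derivative uxx x t) (at x within {0..}) \<and>
        ((\<lambda>s. u x s) has_vector_derivative ut x t) (at t within {0..}) \<and>
        ut x t = \<i> * uxx x t - \<i> * f x t)"

lemma schroD:
  assumes "schro u ux uxx ut f" "0 \<le> x" "0 \<le> t"
  shows "((\<lambda>y. u y t) has_vector_derivative ux x t) (at x within {0..})"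
    "((\<lambda>y. ux y t) has_vector_derivative uxx x t) (at x within {0..})"
    "((\<lambda>s. u x s) has_vector_derivative ut x t) (at t within {0..})"
    "ut x t = \<i> * uxx x t - \<i> * f x t"
proof -
  have "((\<lambda>y. u y t) has_vector_derivative ux x t) (at x within {0..}) \<and>
    ((\<lambda>y. ux y t) has_vector_derivative uxx x t) (at x within {0..}) \<and>
    ((\<lambda>s. u x s) has_vector_derivative ut x t) (at t within {0..}) \<and>
    ut x t = \<i> * uxx x t - \<i> * f x t"
    using assms(1)[unfolded schro_def, THEN conjunct2, THEN conjunct2, THEN conjunct2, THEN conjunct2,
        THEN conjunct2, rule_format, OF assms(2,3)] .
  then show "((\<lambda>y. u y t) has_vector_derivative ux x t) (at x within {0..})"
    "((\<lambda>y. ux y t) has_vector_derivative uxx x t) (at x within {0..})"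
    "((\<lambda>s. u x s) has_vector_derivative ut x t) (at t within {0..})"
    "ut x t = \<i> * uxx x t - \<i> * f x t"
    by blast+
qed

lemma qcont_norm_sq:
  fixes f :: "real \<Rightarrow> real \<Rightarrow> complex"
  shows "qcont f \<Longrightarrow> qcont (\<lambda>x t. (cmod (f x t))\<^sup>2)"
  by (simp add: qcont_def case_prod_beta continuous_on_power continuous_on_norm)

lemma sq_norm_integrable:
  fixes f :: "real \<Rightarrow> real \<Rightarrow> complex"
  assumes "qcont f" "0 \<le> t" "0 \<le> a"
  shows "(\<lambda>x. (cmod (f x t))\<^sup>2) integrable_on {a..b}"
  by (rule integrable_continuous_real[OF qcont_x_Icc[OF qcont_norm_sq[OF assms(1)] assms(2,3)]])

lemma gronwall_linear:
  fixes \<phi> \<phi>' :: "real \<Rightarrow> real"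
  assumes d: "\<And>t. 0 \<le> t \<Longrightarrow> t \<le> T \<Longrightarrow> (\<phi> has_vector_derivative \<phi>' t) (at t within {0..})"
    and le: "\<And>t. 0 \<le> t \<Longrightarrow> t \<le> T \<Longrightarrow> \<phi>' t \<le> \<phi> t + K"
    and t: "0 \<le> t" "t \<le> T"
  shows "\<phi> t + K \<le> exp t * (\<phi> 0 + K)"
proof -
  have D: "((\<lambda>s. exp (- s) * (\<phi> s + K)) has_vector_derivative
      (exp (- s) * (\<phi>' s + 0) + (- exp (- s)) * (\<phi> s + K))) (at s within {0..})"
    if "0 \<le> s" "s \<le> T" for s
  proof (rule has_vector_derivative_mult)
    show "((\<lambda>s. exp (- s)) has_vector_derivative - exp (- s)) (at s within {0..})"
      unfolding has_real_derivative_iff_has_vector_derivative[symmetric]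
      by (auto intro!: derivative_eq_intros)
  qed (intro has_vector_derivative_add d that has_vector_derivative_const)
  have "exp (- t) * (\<phi> t + K) \<le> exp (- 0) * (\<phi> 0 + K)"
  proof (rule DERIV_nonpos_imp_decreasing_open[where f="\<lambda>s. exp (- s) * (\<phi> s + K)"])
    show "0 \<le> t" by fact
    show "\<exists>y. ((\<lambda>s. exp (- s) * (\<phi> s + K)) has_real_derivative y) (at x) \<and> y \<le> 0" if "0 < x" "x < t" for x
    proof (intro exI conjI)
      show "((\<lambda>s. exp (- s) * (\<phi> s + K)) has_real_derivative
         (exp (- x) * (\<phi>' x + 0) + (- exp (- x)) * (\<phi> x + K))) (at x)"
        unfolding has_real_derivative_iff_has_vector_derivative
        using D[of x] at_within_interior[of x "{0..}"] that t by simp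
      have "exp (- x) * (\<phi>' x - (\<phi> x + K)) \<le> 0"
        using le[of x] that t by (intro mult_nonneg_nonpos) auto
      then show "exp (- x) * (\<phi>' x + 0) + (- exp (- x)) * (\<phi> x + K) \<le> 0"
        by (simp add: algebra_simps)
    qed
    have "continuous_on {0..t} \<phi>"
    proof (rule continuous_on_vector_derivative)
      show "(\<phi> has_vector_derivative \<phi>' x) (at x within {0..t})" if "x \<in> {0..t}" for x
        by (rule has_vector_derivative_within_subset[OF d]) (use that t in auto)
    qed
    then show "continuous_on {0..t} (\<lambda>s. exp (- s) * (\<phi> s + K))"
      by (intro continuous_intros)
  qed
  then have "exp t * (exp (- t) * (\<phi> t + K)) \<le> exp t * (exp (- 0) * (\<phi> 0 + K))"
    by (rule mult_left_mono) simp
  then show ?thesis by (simp only: mult.assoc[symmetric] exp_minus_inverse) simp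
qed

text \<open>The cutoff \<open>1 - x/R\<close> makes the boundary term at \<open>x = R\<close> vanish and costs only
  the term \<open>M\<^sup>2/R\<close>, which disappears as \<open>R\<close> grows; hence the estimate is independent of \<open>M\<close>.\<close>
lemma energy_cutoff:
  assumes S: "schro u ux uxx ut f" and R: "R > 0"
    and M: "\<And>x t. 0 \<le> x \<Longrightarrow> 0 \<le> t \<Longrightarrow> t \<le> T \<Longrightarrow> cmod (u x t) \<le> M"
           "\<And>R t. 0 \<le> R \<Longrightarrow> 0 \<le> t \<Longrightarrow> t \<le> T \<Longrightarrow> integral {0..R} (\<lambda>x. cmod (ux x t)) \<le> M"
    and b: "\<And>t. 0 \<le> t \<Longrightarrow> t \<le> T \<Longrightarrow> cmod (u 0 t) \<le> b" "\<And>t. 0 \<le> t \<Longrightarrow> t \<le> T \<Longrightarrow> cmod (ux 0 t) \<le> b"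
    and F: "\<And>R t. 0 \<le> R \<Longrightarrow> 0 \<le> t \<Longrightarrow> t \<le> T \<Longrightarrow> integral {0..R} (\<lambda>x. (cmod (f x t))\<^sup>2) \<le> F"
    and t: "0 \<le> t" "t \<le> T"
  shows "integral {0..R} (\<lambda>x. (1 - x/R) * (cmod (u x t))\<^sup>2) + (2*b\<^sup>2 + F + 2 * M\<^sup>2/R)
      \<le> exp t * (integral {0..R} (\<lambda>x. (1 - x/R) * (cmod (u x 0))\<^sup>2) + (2*b\<^sup>2 + F + 2 * M\<^sup>2/R))"
proof (rule gronwall_linear[where T=T])
  have q: "qcont u" "qcont ux" "qcont uxx" "qcont ut" "qcont f"
    using S by (auto simp: schro_def)
  let ?\<chi> = "\<lambda>x. 1 - x/R"
  let ?\<phi>' = "\<lambda>t. integral {0..R} (\<lambda>x. ?\<chi> x * (2 * (u x t \<bullet> ut x t)))"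
  show "((\<lambda>t. integral {0..R} (\<lambda>x. ?\<chi> x * (cmod (u x t))\<^sup>2)) has_vector_derivative ?\<phi>' t) (at t within {0..})"
    if t: "0 \<le> t" for t
  proof -
    have "((\<lambda>t. integral (cbox 0 R) (\<lambda>x. ?\<chi> x * (cmod (u x t))\<^sup>2)) has_vector_derivative
       integral (cbox 0 R) (\<lambda>x. ?\<chi> x * (2 * (u x t \<bullet> ut x t)))) (at t within {0..})"
    proof (rule leibniz_rule_vector_derivative)
      fix s x :: real assume s: "s \<in> {0..}" and x: "x \<in> cbox 0 R"
      have "((\<lambda>s. u x s) has_vector_derivative ut x s) (at s within {0..})"
        by (rule schroD(3)[OF S]) (use s x in auto)
      from bounded_bilinear.has_vector_derivative[OF bounded_bilinear_inner this this]
      have "((\<lambda>s. (cmod (u x s))\<^sup>2) has_vector_derivative 2 * (u x s \<bullet> ut x s)) (at s within {0..})"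
        by (simp add: power2_norm_eq_inner inner_commute)
      then show "((\<lambda>s. ?\<chi> x * (cmod (u x s))\<^sup>2) has_vector_derivative ?\<chi> x * (2 * (u x s \<bullet> ut x s))) (at s within {0..})"
        by (rule has_vector_derivative_mult_right)
    next
      fix s :: real assume "s \<in> {0..}"
      then show "(\<lambda>x. ?\<chi> x * (cmod (u x s))\<^sup>2) integrable_on cbox 0 R"
        unfolding cbox_interval
        by (intro integrable_continuous_real continuous_intros qcont_x_Icc[OF q(1)]) (use R in auto)
    next
      show "continuous_on ({0..} \<times> cbox 0 R) (\<lambda>(s, x). ?\<chi> x * (2 * (u x s \<bullet> ut x s)))"
        unfolding case_prod_beta
        by (intro continuous_intros qcont_compose[OF q(1)] qcont_compose[OF q(4)]) (use R in auto)
    qed (use t in auto)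
    then show ?thesis by simp
  qed
  show "?\<phi>' t \<le> integral {0..R} (\<lambda>x. ?\<chi> x * (cmod (u x t))\<^sup>2) + (2*b\<^sup>2 + F + 2 * M\<^sup>2/R)"
    if t: "0 \<le> t" "t \<le> T" for t
  proof -
    note c = q[THEN qcont_x_Icc, of t 0 R, OF t(1) order.refl]
    have cI: "continuous_on {0..R} (\<lambda>x. ?\<chi> x)" using R by (auto intro!: continuous_intros)
    \<comment> \<open>This is the flux of the energy times the cutoff. The term
      \<open>ux x t \<bullet> (\<i> * ux x t)\<close> in its derivative is 0, because multiplication
      by i is a rotation by a right angle.\<close>
    have D: "((\<lambda>x. ?\<chi> x * (u x t \<bullet> (\<i> * ux x t))) has_vector_derivative
        (?\<chi> x * (u x t \<bullet> (\<i> * uxx x t) + ux x t \<bullet> (\<i> * ux x t)) + (- 1/R) * (u x t \<bullet> (\<i> * ux x t))))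
        (at x within {0..R})" if x: "x \<in> {0..R}" for x
    proof (rule has_vector_derivative_mult)
      show "((\<lambda>x. ?\<chi> x) has_vector_derivative - 1/R) (at x within {0..R})"
        unfolding has_real_derivative_iff_has_vector_derivative[symmetric]
        using R by (auto intro!: derivative_eq_intros)
      have "((\<lambda>y. u y t) has_vector_derivative ux x t) (at x within {0..R})"
        and u': "((\<lambda>y. ux y t) has_vector_derivative uxx x t) (at x within {0..R})"
        by (rule has_vector_derivative_within_subset[OF schroD(1)[OF S]],
            use t x in simp_all)
           (rule has_vector_derivative_within_subset[OF schroD(2)[OF S]], use t x in simp_all)
      then show "((\<lambda>x. u x t \<bullet> (\<i> * ux x t)) has_vector_derivative
          u x t \<bullet> (\<i> * uxx x t) + ux x t \<bullet> (\<i> * ux x t)) (at x within {0..R})"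
        by (intro bounded_bilinear.has_vector_derivative[OF bounded_bilinear_inner]
             has_vector_derivative_mult_right)
    qed
    have *: "((\<lambda>x. ?\<chi> x * (u x t \<bullet> (\<i> * uxx x t) + ux x t \<bullet> (\<i> * ux x t)) + (- 1/R) * (u x t \<bullet> (\<i> * ux x t)))
       has_integral (?\<chi> R * (u R t \<bullet> (\<i> * ux R t)) - ?\<chi> 0 * (u 0 t \<bullet> (\<i> * ux 0 t)))) {0..R}"
      by (rule fundamental_theorem_of_calculus) (use R D in auto)
    \<comment> \<open>At x = R the cutoff vanishes, so only the boundary term at x = 0
      survives.\<close>
    have I1: "((\<lambda>x. ?\<chi> x * (u x t \<bullet> (\<i> * uxx x t)) + (- 1/R) * (u x t \<bullet> (\<i> * ux x t)))
       has_integral (- (u 0 t \<bullet> (\<i> * ux 0 t)))) {0..R}"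
    proof -
      have "ux x t \<bullet> (\<i> * ux x t) = 0" for x by (simp add: inner_complex_def)
      moreover have "1 - R/R = 0" using R by simp
      ultimately show ?thesis
        using * by (simp only: add_0_right mult_zero_left div_0 diff_zero mult_1 diff_0)
    qed
    have I2: "(\<lambda>x. u x t \<bullet> (\<i> * ux x t)) integrable_on {0..R}"
      by (intro integrable_continuous_real continuous_intros c)
    have "integral {0..R} (\<lambda>x. ?\<chi> x * (u x t \<bullet> (\<i> * uxx x t)))
       = - (u 0 t \<bullet> (\<i> * ux 0 t)) + (1/R) * integral {0..R} (\<lambda>x. u x t \<bullet> (\<i> * ux x t))"
    proof (rule integral_unique)
      have "((\<lambda>x. (1/R) * (u x t \<bullet> (\<i> * ux x t))) has_integral (1/R) * integral {0..R} (\<lambda>x. u x t \<bullet> (\<i> * ux x t))) {0..R}"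
        by (intro has_integral_mult_right integrable_integral I2)
      from has_integral_add[OF I1 this]
      show "((\<lambda>x. ?\<chi> x * (u x t \<bullet> (\<i> * uxx x t))) has_integral
         - (u 0 t \<bullet> (\<i> * ux 0 t)) + (1/R) * integral {0..R} (\<lambda>x. u x t \<bullet> (\<i> * ux x t))) {0..R}"
        by simp
    qed
    moreover have "- (u 0 t \<bullet> (\<i> * ux 0 t)) \<le> b\<^sup>2"
    proof -
      have "\<bar>u 0 t \<bullet> (\<i> * ux 0 t)\<bar> \<le> cmod (u 0 t) * cmod (ux 0 t)"
        using Cauchy_Schwarz_ineq2[of "u 0 t" "\<i> * ux 0 t"] by (simp add: norm_mult)
      also have "\<dots> \<le> b * b"
        by (rule mult_mono[OF b(1)[OF t] b(2)[OF t] order_trans[OF norm_ge_zero b(1)[OF t]] norm_ge_zero])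
      finally show ?thesis by (simp add: power2_eq_square)
    qed
    moreover have "(1/R) * integral {0..R} (\<lambda>x. u x t \<bullet> (\<i> * ux x t)) \<le> M\<^sup>2/R"
    proof -
      have "integral {0..R} (\<lambda>x. u x t \<bullet> (\<i> * ux x t)) \<le> integral {0..R} (\<lambda>x. M * cmod (ux x t))"
      proof (rule integral_le[OF I2])
        show "(\<lambda>x. M * cmod (ux x t)) integrable_on {0..R}"
          by (intro integrable_continuous_real continuous_intros c)
        fix x assume "x \<in> {0..R}"
        have "u x t \<bullet> (\<i> * ux x t) \<le> cmod (u x t) * cmod (ux x t)"
          using Cauchy_Schwarz_ineq2[of "u x t" "\<i> * ux x t"] by (simp add: norm_mult)
        also have "\<dots> \<le> M * cmod (ux x t)" using M(1)[of x t] \<open>x \<in> {0..R}\<close> t by (intro mult_right_mono) auto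
        finally show "u x t \<bullet> (\<i> * ux x t) \<le> M * cmod (ux x t)" .
      qed
      also have "\<dots> = M * integral {0..R} (\<lambda>x. cmod (ux x t))" by simp
      also have "\<dots> \<le> M * M"
        by (rule mult_left_mono[OF M(2)]) (use R t order_trans[OF norm_ge_zero M(1)[of 0 t]] in auto)
      finally have "integral {0..R} (\<lambda>x. u x t \<bullet> (\<i> * ux x t)) / R \<le> M * M / R"
        using R by (intro divide_right_mono) auto
      then show ?thesis by (simp add: power2_eq_square)
    qed
    moreover have "?\<phi>' t = 2 * integral {0..R} (\<lambda>x. ?\<chi> x * (u x t \<bullet> (\<i> * uxx x t)))
         - integral {0..R} (\<lambda>x. ?\<chi> x * (2 * (u x t \<bullet> (\<i> * f x t))))"
    proof -
      have "?\<phi>' t = integral {0..R} (\<lambda>x. 2 * (?\<chi> x * (u x t \<bullet> (\<i> * uxx x t)))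
          - ?\<chi> x * (2 * (u x t \<bullet> (\<i> * f x t))))"
      proof (rule integral_cong)
        fix x assume "x \<in> {0..R}"
        then have "ut x t = \<i> * uxx x t - \<i> * f x t" using schroD(4)[OF S, of x t] t by simp
        then show "?\<chi> x * (2 * (u x t \<bullet> ut x t)) = 2 * (?\<chi> x * (u x t \<bullet> (\<i> * uxx x t)))
          - ?\<chi> x * (2 * (u x t \<bullet> (\<i> * f x t)))"
          by (simp only: inner_diff_right) (simp add: algebra_simps)
      qed
      also have "\<dots> = integral {0..R} (\<lambda>x. 2 * (?\<chi> x * (u x t \<bullet> (\<i> * uxx x t))))
         - integral {0..R} (\<lambda>x. ?\<chi> x * (2 * (u x t \<bullet> (\<i> * f x t))))"
        by (intro integral_diff integrable_continuous_real continuous_intros c cI)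
      also have "integral {0..R} (\<lambda>x. 2 * (?\<chi> x * (u x t \<bullet> (\<i> * uxx x t))))
         = 2 * integral {0..R} (\<lambda>x. ?\<chi> x * (u x t \<bullet> (\<i> * uxx x t)))"
        by (rule integral_mult_right)
      finally show ?thesis .
    qed
    \<comment> \<open>The weight is kept on the square of u, so that Gronwall applies to the
      weighted energy, and is replaced by its bound 1 on the square of f.\<close>
    moreover have "- integral {0..R} (\<lambda>x. ?\<chi> x * (2 * (u x t \<bullet> (\<i> * f x t))))
       \<le> integral {0..R} (\<lambda>x. ?\<chi> x * (cmod (u x t))\<^sup>2) + F"
    proof -
      have "integral {0..R} (\<lambda>x. - (?\<chi> x * (2 * (u x t \<bullet> (\<i> * f x t)))))
        \<le> integral {0..R} (\<lambda>x. ?\<chi> x * (cmod (u x t))\<^sup>2 + (cmod (f x t))\<^sup>2)"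
      proof (rule integral_le)
        show "(\<lambda>x. - (?\<chi> x * (2 * (u x t \<bullet> (\<i> * f x t))))) integrable_on {0..R}"
          by (intro integrable_continuous_real continuous_on_minus continuous_on_mult continuous_on_const
              continuous_on_inner c cI)
        show "(\<lambda>x. ?\<chi> x * (cmod (u x t))\<^sup>2 + (cmod (f x t))\<^sup>2) integrable_on {0..R}"
          by (intro integrable_continuous_real continuous_on_add continuous_on_mult continuous_on_power
              continuous_on_norm c cI)
        fix x assume x: "x \<in> {0..R}"
        have "0 \<le> x / R" "x / R \<le> 1" using x R by simp_all
        then have \<chi>: "0 \<le> ?\<chi> x" "?\<chi> x \<le> 1" by linarith+
        have "- (2 * (u x t \<bullet> (\<i> * f x t))) \<le> 2 * (cmod (u x t) * cmod (f x t))"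
        proof -
          have "\<bar>u x t \<bullet> (\<i> * f x t)\<bar> \<le> cmod (u x t) * cmod (f x t)"
            using Cauchy_Schwarz_ineq2[of "u x t" "\<i> * f x t"] by (simp add: norm_mult)
          then have "- (u x t \<bullet> (\<i> * f x t)) \<le> cmod (u x t) * cmod (f x t)" by (rule abs_le_D2)
          then show ?thesis by (simp only: mult_minus_right[symmetric] mult_le_cancel_left_pos zero_less_numeral)
        qed
        also have "\<dots> \<le> (cmod (u x t))\<^sup>2 + (cmod (f x t))\<^sup>2"
          using sum_squares_bound[of "cmod (u x t)" "cmod (f x t)"] by simp
        finally have le: "- (2 * (u x t \<bullet> (\<i> * f x t))) \<le> (cmod (u x t))\<^sup>2 + (cmod (f x t))\<^sup>2" .
        have "?\<chi> x * (- (2 * (u x t \<bullet> (\<i> * f x t)))) \<le> ?\<chi> x * ((cmod (u x t))\<^sup>2 + (cmod (f x t))\<^sup>2)"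
          using \<chi>(1) by (rule mult_left_mono[OF le])
        also have "\<dots> \<le> ?\<chi> x * (cmod (u x t))\<^sup>2 + (cmod (f x t))\<^sup>2"
          using mult_right_mono[OF \<chi>(2), of "(cmod (f x t))\<^sup>2"] by (simp only: distrib_left) simp
        finally show "- (?\<chi> x * (2 * (u x t \<bullet> (\<i> * f x t)))) \<le> ?\<chi> x * (cmod (u x t))\<^sup>2 + (cmod (f x t))\<^sup>2"
          by (simp only: mult_minus_right)
      qed
      also have "\<dots> = integral {0..R} (\<lambda>x. ?\<chi> x * (cmod (u x t))\<^sup>2) + integral {0..R} (\<lambda>x. (cmod (f x t))\<^sup>2)"
        by (intro integral_add integrable_continuous_real continuous_intros c cI)
      also have "integral {0..R} (\<lambda>x. (cmod (f x t))\<^sup>2) \<le> F" using F R t by simp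
      finally show ?thesis by (simp only: integral_neg)
    qed
    ultimately show ?thesis by linarith
  qed
qed (use t in auto)

text \<open>On \<open>{0..R0}\<close> the cutoff is at least \<open>1 - R0/R\<close>, so letting R
  tend to infinity removes both the weight and the term with M. The conclusion is free of M, so any
  finite M serves, however large.\<close>

lemma energy_estimate:
  assumes S: "schro u ux uxx ut f"
    and M: "\<And>x t. 0 \<le> x \<Longrightarrow> 0 \<le> t \<Longrightarrow> t \<le> T \<Longrightarrow> cmod (u x t) \<le> M"
           "\<And>R t. 0 \<le> R \<Longrightarrow> 0 \<le> t \<Longrightarrow> t \<le> T \<Longrightarrow> integral {0..R} (\<lambda>x. cmod (ux x t)) \<le> M"
    and b: "\<And>t. 0 \<le> t \<Longrightarrow> t \<le> T \<Longrightarrow> cmod (u 0 t) \<le> b" "\<And>t. 0 \<le> t \<Longrightarrow> t \<le> T \<Longrightarrow> cmod (ux 0 t) \<le> b"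
    and F: "\<And>R t. 0 \<le> R \<Longrightarrow> 0 \<le> t \<Longrightarrow> t \<le> T \<Longrightarrow> integral {0..R} (\<lambda>x. (cmod (f x t))\<^sup>2) \<le> F"
    and A: "\<And>R. 0 \<le> R \<Longrightarrow> integral {0..R} (\<lambda>x. (cmod (u x 0))\<^sup>2) \<le> A"
    and t: "0 \<le> t" "t \<le> T" and R0: "0 \<le> R0"
  shows "integral {0..R0} (\<lambda>x. (cmod (u x t))\<^sup>2) \<le> exp T * (A + 2*b\<^sup>2 + F)"
proof -
  have q: "qcont u" using S by (auto simp: schro_def)
  have F0: "0 \<le> F" using F[of 0 t] t by simp
  have A0: "0 \<le> A" using A[of 0] by simp
  have ev: "(1 - R0/R) * integral {0..R0} (\<lambda>x. (cmod (u x t))\<^sup>2) \<le> exp T * (A + (2*b\<^sup>2 + F + 2 * M\<^sup>2/R))"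
    if R: "R > R0" for R
  proof -
    have Rp: "R > 0" using R R0 by simp
    have cu: "continuous_on {0..R'} (\<lambda>x. (1 - x/R) * (cmod (u x s))\<^sup>2)" if "0 \<le> s" for s R'
      by (intro continuous_intros qcont_x_Icc[OF q]) (use that Rp in auto)
    have "(1 - R0/R) * integral {0..R0} (\<lambda>x. (cmod (u x t))\<^sup>2) = integral {0..R0} (\<lambda>x. (1 - R0/R) * (cmod (u x t))\<^sup>2)"
      by simp
    also have "\<dots> \<le> integral {0..R0} (\<lambda>x. (1 - x/R) * (cmod (u x t))\<^sup>2)"
    proof (rule integral_le)
      show "(\<lambda>x. (1 - R0/R) * (cmod (u x t))\<^sup>2) integrable_on {0..R0}"
        by (intro integrable_continuous_real continuous_intros qcont_x_Icc[OF q]) (use t in auto)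
      show "(\<lambda>x. (1 - x/R) * (cmod (u x t))\<^sup>2) integrable_on {0..R0}"
        using t by (intro integrable_continuous_real cu)
      show "(1 - R0/R) * (cmod (u x t))\<^sup>2 \<le> (1 - x/R) * (cmod (u x t))\<^sup>2" if "x \<in> {0..R0}" for x
        by (rule mult_right_mono) (use that Rp in \<open>simp_all add: divide_right_mono\<close>)
    qed
    also have "\<dots> \<le> integral {0..R} (\<lambda>x. (1 - x/R) * (cmod (u x t))\<^sup>2)"
      by (rule integral_subset_le[OF _ integrable_continuous_real[OF cu] integrable_continuous_real[OF cu]])
         (use R Rp t in \<open>simp_all add: mult_nonneg_nonneg\<close>)
    also have "\<dots> \<le> exp t * (integral {0..R} (\<lambda>x. (1 - x/R) * (cmod (u x 0))\<^sup>2) + (2*b\<^sup>2 + F + 2 * M\<^sup>2/R))"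
    proof -
      have "0 \<le> 2*b\<^sup>2 + F + 2 * M\<^sup>2/R" using F0 Rp by (intro add_nonneg_nonneg) auto
      then show ?thesis using energy_cutoff[OF S Rp M b F t] by linarith
    qed
    also have "\<dots> \<le> exp T * (A + (2*b\<^sup>2 + F + 2 * M\<^sup>2/R))"
    proof (rule mult_mono)
      have "integral {0..R} (\<lambda>x. (1 - x/R) * (cmod (u x 0))\<^sup>2) \<le> integral {0..R} (\<lambda>x. (cmod (u x 0))\<^sup>2)"
        by (rule integral_le[OF integrable_continuous_real[OF cu] sq_norm_integrable[OF q]])
           (use Rp in \<open>simp_all add: mult_left_le_one_le\<close>)
      then show "integral {0..R} (\<lambda>x. (1 - x/R) * (cmod (u x 0))\<^sup>2) + (2*b\<^sup>2 + F + 2 * M\<^sup>2/R)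
          \<le> A + (2*b\<^sup>2 + F + 2 * M\<^sup>2/R)" using A[of R] Rp by linarith
      have "0 \<le> integral {0..R} (\<lambda>x. (1 - x/R) * (cmod (u x 0))\<^sup>2)"
        by (rule integral_nonneg[OF integrable_continuous_real[OF cu]]) (use Rp in \<open>simp_all add: mult_nonneg_nonneg\<close>)
      then show "0 \<le> integral {0..R} (\<lambda>x. (1 - x/R) * (cmod (u x 0))\<^sup>2) + (2*b\<^sup>2 + F + 2 * M\<^sup>2/R)"
        using F0 Rp by (intro add_nonneg_nonneg) auto
    qed (use t in auto)
    finally show ?thesis .
  qed
  have l0: "((\<lambda>R. K / R) \<longlongrightarrow> 0) at_top" for K :: real
    by (rule real_tendsto_divide_at_top[OF tendsto_const filterlim_ident])
  have l1: "((\<lambda>R. (1 - R0/R) * integral {0..R0} (\<lambda>x. (cmod (u x t))\<^sup>2)) \<longlongrightarrow>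
      (1 - 0) * integral {0..R0} (\<lambda>x. (cmod (u x t))\<^sup>2)) at_top"
    by (rule tendsto_mult[OF tendsto_diff[OF tendsto_const l0] tendsto_const])
  have l2: "((\<lambda>R. exp T * (A + (2*b\<^sup>2 + F + 2 * M\<^sup>2/R))) \<longlongrightarrow> exp T * (A + (2*b\<^sup>2 + F + 0))) at_top"
    by (rule tendsto_mult[OF tendsto_const tendsto_add[OF tendsto_const tendsto_add[OF tendsto_const l0]]])
  have evr: "\<forall>\<^sub>F R in at_top. (1 - R0/R) * integral {0..R0} (\<lambda>x. (cmod (u x t))\<^sup>2)
        \<le> exp T * (A + (2*b\<^sup>2 + F + 2 * M\<^sup>2/R))"
    by (rule eventually_mono[OF eventually_gt_at_top[of R0] ev])
  have "(1 - 0) * integral {0..R0} (\<lambda>x. (cmod (u x t))\<^sup>2) \<le> exp T * (A + (2*b\<^sup>2 + F + 0))"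
    by (rule tendsto_le[OF trivial_limit_at_top_linorder l2 l1 evr])
  then show ?thesis by (simp only: diff_zero mult_1 add_0_right add.assoc)
qed

section \<open>Steklov averages\<close>

text \<open>The Steklov average over \<open>[x, x + h]\<close>, written over the unit interval so that \<open>h = 0\<close> gives \<open>u\<close> itself.\<close>
definition stk :: "real \<Rightarrow> (real \<Rightarrow> real \<Rightarrow> complex) \<Rightarrow> real \<Rightarrow> real \<Rightarrow> complex" where
  "stk h u x t = integral {0..1} (\<lambda>y. u (x + h * y) t)"

lemma stk_continuous_slice:
  assumes "qcont u" "0 \<le> h" "0 \<le> x" "0 \<le> t"
  shows "continuous_on {0..1} (\<lambda>y. u (x + h * y) t)"
  by (rule qcont_compose[OF assms(1)]) (use assms in \<open>auto intro!: continuous_intros\<close>)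

lemma stk_slice_integrable:
  fixes u :: "real \<Rightarrow> real \<Rightarrow> complex"
  assumes "qcont u" "0 \<le> h" "0 \<le> x" "0 \<le> t"
  shows "(\<lambda>y. u (x + h * y) t) integrable_on {0..1}"
  by (rule integrable_continuous_real, rule stk_continuous_slice[OF assms])

lemma qcont_stk:
  assumes u: "qcont u" and h: "0 \<le> h"
  shows "qcont (stk h u)"
proof (rule qcontI)
  have "continuous_on (({0..} \<times> {0..}) \<times> cbox 0 1) (\<lambda>s. u (fst (fst s) + h * snd s) (snd (fst s)))"
    by (rule qcont_compose[OF u]) (use h in \<open>auto intro!: continuous_intros add_nonneg_nonneg\<close>)
  then have "continuous_on (({0..} \<times> {0..}) \<times> cbox 0 1) (\<lambda>(p, y). u (fst p + h * y) (snd p))"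
    by (simp only: case_prod_unfold)
  from integral_continuous_on_param[OF this]
  show "continuous_on ({0..} \<times> {0..}) (\<lambda>p. stk h u (fst p) (snd p))"
    by (simp only: stk_def cbox_interval)
qed

lemma stk_dx:
  assumes f: "qcont f" and f': "qcont f'" and h: "0 \<le> h" and x: "0 \<le> x" and t: "0 \<le> t"
    and d: "\<And>x. 0 \<le> x \<Longrightarrow> ((\<lambda>y. f y t) has_vector_derivative f' x t) (at x within {0..})"
  shows "((\<lambda>x. stk h f x t) has_vector_derivative stk h f' x t) (at x within {0..})"
proof -
  have "((\<lambda>x. integral (cbox 0 1) (\<lambda>y. f (x + h * y) t)) has_vector_derivative
      integral (cbox 0 1) (\<lambda>y. f' (x + h * y) t)) (at x within {0..})"
  proof (rule leibniz_rule_vector_derivative)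
    fix x y :: real assume x: "x \<in> {0..}" and y: "y \<in> cbox 0 1"
    have xy: "0 \<le> x + h * y" using x y h by simp
    have 1: "((\<lambda>x. x + h * y) has_vector_derivative 1) (at x within {0..})"
      unfolding has_real_derivative_iff_has_vector_derivative[symmetric]
      by (auto intro!: derivative_eq_intros)
    have 2: "((\<lambda>z. f z t) has_vector_derivative f' (x + h * y) t) (at (x + h * y) within (\<lambda>x. x + h * y) ` {0..})"
      by (rule has_vector_derivative_within_subset[OF d[OF xy]]) (use y h in auto)
    from vector_diff_chain_within[OF 1 2]
    show "((\<lambda>x. f (x + h * y) t) has_vector_derivative f' (x + h * y) t) (at x within {0..})"
      by (simp add: o_def)
  next
    fix x :: real assume "x \<in> {0..}"
    then show "(\<lambda>y. f (x + h * y) t) integrable_on cbox 0 1"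
      using stk_slice_integrable[OF f h _ t, of x] by simp
  next
    have "continuous_on ({0..} \<times> cbox 0 1) (\<lambda>s. f' (fst s + h * snd s) t)"
      by (rule qcont_compose[OF f']) (use h t in \<open>auto intro!: continuous_intros add_nonneg_nonneg\<close>)
    then show "continuous_on ({0..} \<times> cbox 0 1) (\<lambda>(x, y). f' (x + h * y) t)"
      by (simp only: case_prod_unfold)
  qed (use x in auto)
  then show ?thesis by (simp only: stk_def cbox_interval)
qed

lemma stk_dt:
  assumes f: "qcont f" and f': "qcont f'" and h: "0 \<le> h" and x: "0 \<le> x" and t: "0 \<le> t"
    and d: "\<And>x t. 0 \<le> x \<Longrightarrow> 0 \<le> t \<Longrightarrow> ((\<lambda>s. f x s) has_vector_derivative f' x t) (at t within {0..})"
  shows "((\<lambda>t. stk h f x t) has_vector_derivative stk h f' x t) (at t within {0..})"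
proof -
  have "((\<lambda>t. integral (cbox 0 1) (\<lambda>y. f (x + h * y) t)) has_vector_derivative
      integral (cbox 0 1) (\<lambda>y. f' (x + h * y) t)) (at t within {0..})"
  proof (rule leibniz_rule_vector_derivative)
    fix t y :: real assume "t \<in> {0..}" and "y \<in> cbox 0 1"
    then show "((\<lambda>t. f (x + h * y) t) has_vector_derivative f' (x + h * y) t) (at t within {0..})"
      by (intro d) (use x h in auto)
  next
    fix t :: real assume "t \<in> {0..}"
    then show "(\<lambda>y. f (x + h * y) t) integrable_on cbox 0 1"
      using stk_slice_integrable[OF f h x, of t] by simp
  next
    have "continuous_on ({0..} \<times> cbox 0 1) (\<lambda>s. f' (x + h * snd s) (fst s))"
      by (rule qcont_compose[OF f']) (use h x in \<open>auto intro!: continuous_intros add_nonneg_nonneg\<close>)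
    then show "continuous_on ({0..} \<times> cbox 0 1) (\<lambda>(t, y). f' (x + h * y) t)"
      by (simp only: case_prod_unfold)
  qed (use t in auto)
  then show ?thesis by (simp only: stk_def cbox_interval)
qed

text \<open>Averaging in x commutes with the derivatives and with the equation, whose coefficients
  are constant; a nonlinearity sits inside f and is averaged as a whole.\<close>

lemma schro_stk:
  assumes S: "schro u ux uxx ut f" and h: "0 \<le> h"
  shows "schro (stk h u) (stk h ux) (stk h uxx) (stk h ut) (stk h f)"
proof -
  have q: "qcont u" "qcont ux" "qcont uxx" "qcont ut" "qcont f"
    using S by (simp_all add: schro_def)
  have "stk h ut x t = \<i> * stk h uxx x t - \<i> * stk h f x t" if "0 \<le> x" "0 \<le> t" for x t
  proof -
    have "stk h ut x t = integral {0..1} (\<lambda>y. \<i> * uxx (x + h * y) t - \<i> * f (x + h * y) t)"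
      unfolding stk_def by (rule integral_cong, rule schroD(4)[OF S]) (use that h in auto)
    also have "\<dots> = integral {0..1} (\<lambda>y. \<i> * uxx (x + h * y) t) - integral {0..1} (\<lambda>y. \<i> * f (x + h * y) t)"
      by (intro integral_diff integrable_on_mult_right stk_slice_integrable[OF q(3) h that]
          stk_slice_integrable[OF q(5) h that])
    finally show ?thesis by (simp only: stk_def integral_mult_right)
  qed
  then show ?thesis
    unfolding schro_def
    by (intro conjI allI impI qcont_stk q h stk_dx stk_dt schroD[OF S])
qed

text \<open>The substitution z = x + hy turns the average into a difference quotient of any
  primitive. With v the integral of u it bounds the average by the L^1 norm of u; with v a solution
  and u its derivative it rewrites the average of the derivative through the solution
  itself.\<close>

lemma stk_primitive:
  assumes u: "qcont u" and h: "0 < h" and x: "0 \<le> x" and t: "0 \<le> t"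
    and d: "\<And>x. 0 \<le> x \<Longrightarrow> (v has_vector_derivative u x t) (at x within {0..})"
  shows "stk h u x t = (v (x + h) - v x) / of_real h"
proof -
  have "((\<lambda>y. u (x + h * y) t) has_integral (v (x + h * 1) / of_real h - v (x + h * 0) / of_real h)) {0..1}"
  proof (rule fundamental_theorem_of_calculus)
    fix y :: real assume y: "y \<in> {0..1}"
    have 1: "((\<lambda>y. x + h * y) has_vector_derivative h) (at y within {0..1})"
      unfolding has_real_derivative_iff_has_vector_derivative[symmetric]
      by (auto intro!: derivative_eq_intros)
    have 2: "(v has_vector_derivative u (x + h * y) t) (at (x + h * y) within (\<lambda>y. x + h * y) ` {0..1})"
      by (rule has_vector_derivative_within_subset[OF d]) (use x y h in auto)
    from has_vector_derivative_divide[OF vector_diff_chain_within[OF 1 2], of "of_real h"]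
    show "((\<lambda>y. v (x + h * y) / of_real h) has_vector_derivative u (x + h * y) t) (at y within {0..1})"
      using h by (simp add: o_def scaleR_conv_of_real)
  qed simp
  then show ?thesis by (simp add: stk_def integral_unique diff_divide_distrib)
qed

lemma stk_bound:
  assumes u: "qcont u" and h: "0 \<le> h" and x: "0 \<le> x" and t: "0 \<le> t"
    and b: "\<And>y. 0 \<le> y \<Longrightarrow> y \<le> x + h \<Longrightarrow> cmod (u y t) \<le> b"
  shows "cmod (stk h u x t) \<le> b"
proof -
  have "norm (integral {0..1} (\<lambda>y. u (x + h * y) t)) \<le> b * (1 - 0)"
  proof (rule integral_bound)
    show "cmod (u (x + h * y) t) \<le> b" if "y \<in> {0..1}" for y
      by (rule b) (use that x h in \<open>auto simp: mult_left_le\<close>)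
  qed (use stk_continuous_slice[OF u h x t] in auto)
  then show ?thesis by (simp add: stk_def)
qed

lemma norm_integral_diff_le:
  fixes f :: "real \<Rightarrow> complex"
  assumes c: "continuous_on {0..b} f" and ab: "0 \<le> a" "a \<le> b"
  shows "norm (integral {0..b} f - integral {0..a} f) \<le> integral {0..b} (\<lambda>x. cmod (f x))"
proof -
  have ci: "continuous_on {a..b} f" by (rule continuous_on_subset[OF c]) (use ab in auto)
  have "integral {0..a} f + integral {a..b} f = integral {0..b} f"
    by (rule Henstock_Kurzweil_Integration.integral_combine)
       (use ab c in \<open>auto intro: integrable_continuous_real\<close>)
  then have "integral {0..b} f - integral {0..a} f = integral {a..b} f" by (simp add: algebra_simps)
  also have "norm \<dots> \<le> integral {a..b} (\<lambda>x. cmod (f x))"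
    by (rule continuous_on_imp_absolutely_integrable_on[OF ci])
  also have "\<dots> \<le> integral {0..b} (\<lambda>x. cmod (f x))"
    by (rule integral_subset_le)
       (use ab in \<open>auto intro!: integrable_continuous_real continuous_on_norm c ci\<close>)
  finally show ?thesis .
qed

lemma stk_L1_bound:
  assumes u: "qcont u" and h: "0 < h" and x: "0 \<le> x" and t: "0 \<le> t"
    and M: "\<And>R. 0 \<le> R \<Longrightarrow> integral {0..R} (\<lambda>x. cmod (u x t)) \<le> M"
  shows "cmod (stk h u x t) \<le> M / h"
proof -
  have "stk h u x t = (integral {0..x+h} (\<lambda>y. u y t) - integral {0..x} (\<lambda>y. u y t)) / of_real h"
    by (rule stk_primitive[OF u h x t has_vector_derivative_integral_halfline[OF qcont_x[OF u t]]])
  moreover have "cmod (integral {0..x+h} (\<lambda>y. u y t) - integral {0..x} (\<lambda>y. u y t)) \<le> M"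
    by (rule order_trans[OF norm_integral_diff_le M]) (use x h qcont_x_Icc[OF u t] in auto)
  ultimately show ?thesis using h by (simp add: norm_divide divide_right_mono)
qed

lemma shifted_integral_le:
  fixes f :: "real \<Rightarrow> real"
  assumes c: "continuous_on {0..} f" and p: "\<And>x. 0 \<le> x \<Longrightarrow> 0 \<le> f x" and a: "0 \<le> a" and R: "0 \<le> R"
    and M: "\<And>R. 0 \<le> R \<Longrightarrow> integral {0..R} f \<le> M"
  shows "integral {0..R} (\<lambda>x. f (x + a)) \<le> M"
proof -
  have c': "continuous_on {b..d} f" if "0 \<le> b" for b d
    by (rule continuous_on_subset[OF c]) (use that in auto)
  have "integral {0..R} (f \<circ> (\<lambda>x. x + a)) = integral {0+a..R+a} f"
    by (rule integral_shift[OF c']) (use a in auto)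
  also have "\<dots> \<le> integral {0..R+a} f"
    by (rule integral_subset_le) (use a R p in \<open>auto intro!: integrable_continuous_real c'\<close>)
  also have "\<dots> \<le> M" using a R by (intro M) auto
  finally show ?thesis by (simp add: o_def)
qed

text \<open>The average of \<open>ux\<close> is a difference quotient of u, so the L^1 norm of u
  alone controls it, at the price of the factor 2/h.\<close>

lemma stk_deriv_L1_bound:
  assumes u: "qcont u" and ux: "qcont ux" and h: "0 < h" and R: "0 \<le> R" and t: "0 \<le> t"
    and d: "\<And>x. 0 \<le> x \<Longrightarrow> ((\<lambda>y. u y t) has_vector_derivative ux x t) (at x within {0..})"
    and M: "\<And>R. 0 \<le> R \<Longrightarrow> integral {0..R} (\<lambda>x. cmod (u x t)) \<le> M"
  shows "integral {0..R} (\<lambda>x. cmod (stk h ux x t)) \<le> 2 * M / h"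
proof -
  have cu: "continuous_on {0..} (\<lambda>x. cmod (u x t))"
    by (rule continuous_on_norm[OF qcont_x[OF u t]])
  have i1: "(\<lambda>x. cmod (u (x + h) t) / h) integrable_on {0..R}" and i2: "(\<lambda>x. cmod (u x t) / h) integrable_on {0..R}"
    by (rule integrable_continuous_real,
        intro continuous_on_divide continuous_on_norm continuous_on_const qcont_compose[OF u],
        use h t in \<open>auto intro!: continuous_intros\<close>)+
  have "integral {0..R} (\<lambda>x. cmod (stk h ux x t)) \<le> integral {0..R} (\<lambda>x. cmod (u (x + h) t) / h + cmod (u x t) / h)"
  proof (rule integral_le)
    show "(\<lambda>x. cmod (stk h ux x t)) integrable_on {0..R}"
      by (rule integrable_continuous_real[OF continuous_on_norm[OF qcont_x_Icc[OF qcont_stk[OF ux]]]]) (use h t in auto)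
    show "(\<lambda>x. cmod (u (x + h) t) / h + cmod (u x t) / h) integrable_on {0..R}"
      by (rule integrable_add[OF i1 i2])
    fix x assume x: "x \<in> {0..R}"
    have "stk h ux x t = (u (x + h) t - u x t) / of_real h"
      by (rule stk_primitive[OF ux h _ t d]) (use x in auto)
    then have "cmod (stk h ux x t) = cmod (u (x + h) t - u x t) / h" using h by (simp add: norm_divide)
    also have "\<dots> \<le> (cmod (u (x + h) t) + cmod (u x t)) / h"
      by (rule divide_right_mono[OF norm_triangle_ineq4]) (use h in auto)
    finally show "cmod (stk h ux x t) \<le> cmod (u (x + h) t) / h + cmod (u x t) / h"
      by (simp only: add_divide_distrib)
  qed
  also have "\<dots> = integral {0..R} (\<lambda>x. cmod (u (x + h) t) / h) + integral {0..R} (\<lambda>x. cmod (u x t) / h)"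
    by (rule integral_add[OF i1 i2])
  also have "\<dots> = (integral {0..R} (\<lambda>x. cmod (u (x + h) t)) + integral {0..R} (\<lambda>x. cmod (u x t))) / h"
    by (simp only: integral_divide add_divide_distrib)
  also have "\<dots> \<le> (M + M) / h"
    by (rule divide_right_mono[OF add_mono[OF shifted_integral_le[OF cu] M]]) (use h R M in auto)
  finally show ?thesis by simp
qed

text \<open>The variance of \<open>cmod (w y)\<close> about its mean m is nonnegative.\<close>

lemma integral_norm_sq_jensen:
  fixes w :: "real \<Rightarrow> complex"
  assumes c: "continuous_on {0..1} w"
  shows "(cmod (integral {0..1} w))\<^sup>2 \<le> integral {0..1} (\<lambda>y. (cmod (w y))\<^sup>2)"
proof -
  define m where "m = integral {0..1} (\<lambda>y. cmod (w y))"
  have i1: "(\<lambda>y. cmod (w y)) integrable_on {0..1}" and i2: "(\<lambda>y. (cmod (w y))\<^sup>2) integrable_on {0..1}"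
    by (intro integrable_continuous_real continuous_on_norm continuous_on_power c)+
  have le: "cmod (integral {0..1} w) \<le> m"
    unfolding m_def by (rule continuous_on_imp_absolutely_integrable_on[OF c])
  have "((\<lambda>y. (cmod (w y))\<^sup>2 - 2 * m * cmod (w y) + m\<^sup>2) has_integral
      (integral {0..1} (\<lambda>y. (cmod (w y))\<^sup>2) - 2 * m * m + m\<^sup>2 * (1 - 0))) {0..1}"
    using has_integral_const_real[of "m\<^sup>2" 0 1]
    by (intro has_integral_add has_integral_diff has_integral_mult_right integrable_integral i2)
       (auto simp: m_def intro!: integrable_integral i1)
  then have "0 \<le> integral {0..1} (\<lambda>y. (cmod (w y))\<^sup>2) - 2 * m * m + m\<^sup>2 * (1 - 0)"
  proof (rule has_integral_nonneg)
    fix y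
    have "0 \<le> (cmod (w y) - m)\<^sup>2" by simp
    then show "0 \<le> (cmod (w y))\<^sup>2 - 2 * m * cmod (w y) + m\<^sup>2"
      by (simp add: power2_eq_square algebra_simps)
  qed
  then have "m\<^sup>2 \<le> integral {0..1} (\<lambda>y. (cmod (w y))\<^sup>2)" by (simp add: power2_eq_square)
  then show ?thesis using power_mono[OF le norm_ge_zero, of 2] by linarith
qed

text \<open>Averaging does not increase the L^2 norm: Jensen for each x, then exchange of the two
  integrals, after which the inner one belongs to a translate of g. The bound is the same for all
  h.\<close>

lemma stk_L2_bound:
  assumes g: "qcont g" and h: "0 \<le> h" and R: "0 \<le> R" and t: "0 \<le> t"
    and F: "\<And>R. 0 \<le> R \<Longrightarrow> integral {0..R} (\<lambda>x. (cmod (g x t))\<^sup>2) \<le> F"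
  shows "integral {0..R} (\<lambda>x. (cmod (stk h g x t))\<^sup>2) \<le> F"
proof -
  have c2: "continuous_on (cbox (0,0) (R,1)) (\<lambda>s. (cmod (g (fst s + h * snd s) t))\<^sup>2)"
    by (intro continuous_on_power continuous_on_norm qcont_compose[OF g])
       (use h t in \<open>auto intro!: continuous_intros add_nonneg_nonneg\<close>)
  then have c2': "continuous_on (cbox (0,0) (R,1)) (\<lambda>(x,y). (cmod (g (x + h * y) t))\<^sup>2)"
    by (simp only: case_prod_unfold)
  have ci: "continuous_on (cbox 0 R) (\<lambda>x. integral (cbox 0 1) (\<lambda>y. (cmod (g (x + h * y) t))\<^sup>2))"
    using integral_continuous_on_param[OF c2'[unfolded cbox_Pair_eq]] .
  have "integral {0..R} (\<lambda>x. (cmod (stk h g x t))\<^sup>2)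
     \<le> integral {0..R} (\<lambda>x. integral {0..1} (\<lambda>y. (cmod (g (x + h * y) t))\<^sup>2))"
  proof (rule integral_le)
    show "(\<lambda>x. (cmod (stk h g x t))\<^sup>2) integrable_on {0..R}"
      by (rule sq_norm_integrable[OF qcont_stk[OF g h] t]) simp
    show "(\<lambda>x. integral {0..1} (\<lambda>y. (cmod (g (x + h * y) t))\<^sup>2)) integrable_on {0..R}"
      using integrable_continuous_real ci by (simp only: cbox_interval)
    show "(cmod (stk h g x t))\<^sup>2 \<le> integral {0..1} (\<lambda>y. (cmod (g (x + h * y) t))\<^sup>2)" if "x \<in> {0..R}" for x
      unfolding stk_def by (rule integral_norm_sq_jensen[OF stk_continuous_slice[OF g h _ t]]) (use that in auto)
  qed
  also have "\<dots> = integral {0..1} (\<lambda>y. integral {0..R} (\<lambda>x. (cmod (g (x + h * y) t))\<^sup>2))"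
    using integral_swap_continuous[OF c2'] by (simp only: cbox_interval)
  also have "\<dots> \<le> integral {0..1} (\<lambda>y::real. F)"
  proof (rule integral_le)
    have "continuous_on (cbox 0 1 \<times> cbox 0 R) (\<lambda>s. (cmod (g (snd s + h * fst s) t))\<^sup>2)"
      by (intro continuous_on_power continuous_on_norm qcont_compose[OF g])
         (use h t in \<open>auto intro!: continuous_intros add_nonneg_nonneg\<close>)
    then have "continuous_on (cbox 0 1 \<times> cbox 0 R) (\<lambda>(y,x). (cmod (g (x + h * y) t))\<^sup>2)"
      by (simp only: case_prod_unfold)
    from integral_continuous_on_param[OF this]
    show "(\<lambda>y. integral {0..R} (\<lambda>x. (cmod (g (x + h * y) t))\<^sup>2)) integrable_on {0..1}"
      using integrable_continuous_real by (simp only: cbox_interval)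
    show "integral {0..R} (\<lambda>x. (cmod (g (x + h * y) t))\<^sup>2) \<le> F" if "y \<in> {0..1}" for y
      by (rule shifted_integral_le[where f="\<lambda>x. (cmod (g x t))\<^sup>2"])
         (use that h R F qcont_x[OF qcont_norm_sq[OF g] t] in auto)
  qed auto
  finally show ?thesis by simp
qed

text \<open>At h = 0 the average is g itself, and the integral is continuous in h on
  \<open>{0..1}\<close>, so a bound for all positive h persists in the limit.\<close>

lemma L2_bound_from_stk:
  assumes g: "qcont g" and R: "0 \<le> R" and t: "0 \<le> t"
    and B: "\<And>h. 0 < h \<Longrightarrow> h \<le> 1 \<Longrightarrow> integral {0..R} (\<lambda>x. (cmod (stk h g x t))\<^sup>2) \<le> B"
  shows "integral {0..R} (\<lambda>x. (cmod (g x t))\<^sup>2) \<le> B"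
proof -
  have "continuous_on (({0..1} \<times> cbox 0 R) \<times> cbox 0 1) (\<lambda>s. g (snd (fst s) + fst (fst s) * snd s) t)"
    by (rule qcont_compose[OF g]) (use t in \<open>auto intro!: continuous_intros add_nonneg_nonneg\<close>)
  then have "continuous_on (({0..1} \<times> cbox 0 R) \<times> cbox 0 1) (\<lambda>(p,y). g (snd p + fst p * y) t)"
    by (simp only: case_prod_unfold)
  from integral_continuous_on_param[OF this]
  have "continuous_on ({0..1} \<times> cbox 0 R) (\<lambda>p. stk (fst p) g (snd p) t)"
    by (simp only: stk_def cbox_interval)
  then have "continuous_on ({0..1} \<times> cbox 0 R) (\<lambda>(h,x). (cmod (stk h g x t))\<^sup>2)"
    by (simp add: case_prod_beta continuous_on_power continuous_on_norm)
  from integral_continuous_on_param[OF this]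
  have c: "continuous_on {0..1} (\<lambda>h. integral {0..R} (\<lambda>x. (cmod (stk h g x t))\<^sup>2))"
    by (simp only: cbox_interval)
  have "(\<lambda>h. integral {0..R} (\<lambda>x. (cmod (stk h g x t))\<^sup>2)) 0 \<le> B"
    by (rule continuous_le_on_closure[where S="{0<..1}"]) (use c B in auto)
  then show ?thesis by (simp add: stk_def)
qed

text \<open>For fixed h the average meets the requirements of \<open>energy_estimate\<close> with M
  replaced by 2M/h, which does not enter the conclusion; then h tends to 0. The bounds near the
  boundary reach to x = 1 because the average at 0 sees u on [0, h].\<close>

lemma energy_estimate_L1:
  assumes S: "schro u ux uxx ut f"
    and M: "\<And>R t. 0 \<le> R \<Longrightarrow> 0 \<le> t \<Longrightarrow> t \<le> T \<Longrightarrow> integral {0..R} (\<lambda>x. cmod (u x t)) \<le> M"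
    and b: "\<And>x t. 0 \<le> x \<Longrightarrow> x \<le> 1 \<Longrightarrow> 0 \<le> t \<Longrightarrow> t \<le> T \<Longrightarrow> cmod (u x t) \<le> b"
           "\<And>x t. 0 \<le> x \<Longrightarrow> x \<le> 1 \<Longrightarrow> 0 \<le> t \<Longrightarrow> t \<le> T \<Longrightarrow> cmod (ux x t) \<le> b"
    and F: "\<And>R t. 0 \<le> R \<Longrightarrow> 0 \<le> t \<Longrightarrow> t \<le> T \<Longrightarrow> integral {0..R} (\<lambda>x. (cmod (f x t))\<^sup>2) \<le> F"
    and A: "\<And>R. 0 \<le> R \<Longrightarrow> integral {0..R} (\<lambda>x. (cmod (u x 0))\<^sup>2) \<le> A"
    and t: "0 \<le> t" "t \<le> T" and R: "0 \<le> R"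
  shows "integral {0..R} (\<lambda>x. (cmod (u x t))\<^sup>2) \<le> exp T * (A + 2*b\<^sup>2 + F)"
proof -
  have q: "qcont u" "qcont ux" "qcont f" using S by (simp_all add: schro_def)
  have M0: "0 \<le> M" using M[of 0 t] t by simp
  show ?thesis
  proof (rule L2_bound_from_stk[OF q(1) R t(1)])
    fix h :: real assume h: "0 < h" "h \<le> 1"
    have h0: "0 \<le> h" using h by simp
    show "integral {0..R} (\<lambda>x. (cmod (stk h u x t))\<^sup>2) \<le> exp T * (A + 2*b\<^sup>2 + F)"
    proof (rule energy_estimate[OF schro_stk[OF S h0], where T=T and M="2*M/h"])
      fix x s :: real assume x: "0 \<le> x" and s: "0 \<le> s" "s \<le> T"
      have "cmod (stk h u x s) \<le> M / h"
        by (rule stk_L1_bound[OF q(1) h(1) x s(1) M]) (use s in auto)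
      also have "\<dots> \<le> 2 * M / h" using M0 h by (intro divide_right_mono) auto
      finally show "cmod (stk h u x s) \<le> 2 * M / h" .
    next
      fix R s :: real assume "0 \<le> R" "0 \<le> s" "s \<le> T"
      then show "integral {0..R} (\<lambda>x. cmod (stk h ux x s)) \<le> 2 * M / h"
        by (intro stk_deriv_L1_bound[OF q(1,2) h(1)] schroD(1)[OF S] M)
    next
      fix s :: real assume s: "0 \<le> s" "s \<le> T"
      show "cmod (stk h u 0 s) \<le> b"
        by (rule stk_bound[OF q(1) h0 order.refl s(1)]) (use b s h in auto)
      show "cmod (stk h ux 0 s) \<le> b"
        by (rule stk_bound[OF q(2) h0 order.refl s(1)]) (use b s h in auto)
    next
      fix R s :: real assume "0 \<le> R" "0 \<le> s" "s \<le> T"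
      then show "integral {0..R} (\<lambda>x. (cmod (stk h f x s))\<^sup>2) \<le> F"
        by (intro stk_L2_bound[OF q(3) h0] F)
    next
      fix R :: real assume "0 \<le> R"
      then show "integral {0..R} (\<lambda>x. (cmod (stk h u x 0))\<^sup>2) \<le> A"
        by (intro stk_L2_bound[OF q(1) h0] A) auto
    qed (use t R in auto)
  qed
qed

text \<open>No L^1 bound for \<open>ux\<close> is at hand, but its average has one by
  \<open>stk_deriv_L1_bound\<close>. The averaged function is fed into
  \<open>energy_estimate_L1\<close>, which averages a second time; hence the boundary bounds up to x
  = 2.\<close>

lemma energy_estimate_deriv:
  assumes S: "schro u ux uxx ut f" and S': "schro ux uxx uxxx uxt fx"
    and M: "\<And>R t. 0 \<le> R \<Longrightarrow> 0 \<le> t \<Longrightarrow> t \<le> T \<Longrightarrow> integral {0..R} (\<lambda>x. cmod (u x t)) \<le> M"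
    and b: "\<And>x t. 0 \<le> x \<Longrightarrow> x \<le> 2 \<Longrightarrow> 0 \<le> t \<Longrightarrow> t \<le> T \<Longrightarrow> cmod (ux x t) \<le> b"
           "\<And>x t. 0 \<le> x \<Longrightarrow> x \<le> 2 \<Longrightarrow> 0 \<le> t \<Longrightarrow> t \<le> T \<Longrightarrow> cmod (uxx x t) \<le> b"
    and F: "\<And>R t. 0 \<le> R \<Longrightarrow> 0 \<le> t \<Longrightarrow> t \<le> T \<Longrightarrow> integral {0..R} (\<lambda>x. (cmod (fx x t))\<^sup>2) \<le> F"
    and A: "\<And>R. 0 \<le> R \<Longrightarrow> integral {0..R} (\<lambda>x. (cmod (ux x 0))\<^sup>2) \<le> A"
    and t: "0 \<le> t" "t \<le> T" and R: "0 \<le> R"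
  shows "integral {0..R} (\<lambda>x. (cmod (ux x t))\<^sup>2) \<le> exp T * (A + 2*b\<^sup>2 + F)"
proof -
  have q: "qcont u" "qcont ux" "qcont uxx" "qcont fx" using S S' by (simp_all add: schro_def)
  show ?thesis
  proof (rule L2_bound_from_stk[OF q(2) R t(1)])
    fix h :: real assume h: "0 < h" "h \<le> 1"
    have h0: "0 \<le> h" using h by simp
    show "integral {0..R} (\<lambda>x. (cmod (stk h ux x t))\<^sup>2) \<le> exp T * (A + 2*b\<^sup>2 + F)"
    proof (rule energy_estimate_L1[OF schro_stk[OF S' h0], where T=T and M="2*M/h"])
      fix R s :: real assume "0 \<le> R" "0 \<le> s" "s \<le> T"
      then show "integral {0..R} (\<lambda>x. cmod (stk h ux x s)) \<le> 2 * M / h"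
        by (intro stk_deriv_L1_bound[OF q(1,2) h(1)] schroD(1)[OF S] M)
    next
      fix x s :: real assume x: "0 \<le> x" "x \<le> 1" and s: "0 \<le> s" "s \<le> T"
      show "cmod (stk h ux x s) \<le> b"
        by (rule stk_bound[OF q(2) h0 x(1) s(1)]) (use b x s h in auto)
      show "cmod (stk h uxx x s) \<le> b"
        by (rule stk_bound[OF q(3) h0 x(1) s(1)]) (use b x s h in auto)
    next
      fix R s :: real assume "0 \<le> R" "0 \<le> s" "s \<le> T"
      then show "integral {0..R} (\<lambda>x. (cmod (stk h fx x s))\<^sup>2) \<le> F"
        by (intro stk_L2_bound[OF q(4) h0] F)
    next
      fix R :: real assume "0 \<le> R"
      then show "integral {0..R} (\<lambda>x. (cmod (stk h ux x 0))\<^sup>2) \<le> A"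
        by (intro stk_L2_bound[OF q(2) h0] A) auto
    qed (use t R in auto)
  qed
qed

text \<open>The derivative of the square of u is \<open>2 * (u y t \<bullet> ux y t)\<close>, which
  is at most the sum of the two squares.\<close>

lemma sup_bound_H1:
  assumes u: "qcont u" and ux: "qcont ux" and t: "0 \<le> t" and x: "0 \<le> x"
    and d: "\<And>x. 0 \<le> x \<Longrightarrow> ((\<lambda>y. u y t) has_vector_derivative ux x t) (at x within {0..})"
    and B: "integral {0..x} (\<lambda>x. (cmod (u x t))\<^sup>2) \<le> B" "integral {0..x} (\<lambda>x. (cmod (ux x t))\<^sup>2) \<le> B"
    and b: "cmod (u 0 t) \<le> b"
  shows "(cmod (u x t))\<^sup>2 \<le> b\<^sup>2 + 2 * B"
proof -
  have "((\<lambda>y. 2 * (u y t \<bullet> ux y t)) has_integral (cmod (u x t))\<^sup>2 - (cmod (u 0 t))\<^sup>2) {0..x}"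
  proof (rule fundamental_theorem_of_calculus[OF x])
    fix y assume y: "y \<in> {0..x}"
    have 1: "((\<lambda>y. u y t) has_vector_derivative ux y t) (at y within {0..x})"
      by (rule has_vector_derivative_within_subset[OF d]) (use y in auto)
    from bounded_bilinear.has_vector_derivative[OF bounded_bilinear_inner 1 1]
    show "((\<lambda>y. (cmod (u y t))\<^sup>2) has_vector_derivative 2 * (u y t \<bullet> ux y t)) (at y within {0..x})"
      by (simp add: power2_norm_eq_inner inner_commute)
  qed
  moreover have "((\<lambda>y. (cmod (u y t))\<^sup>2 + (cmod (ux y t))\<^sup>2) has_integral
     (integral {0..x} (\<lambda>x. (cmod (u x t))\<^sup>2) + integral {0..x} (\<lambda>x. (cmod (ux x t))\<^sup>2))) {0..x}"
    by (intro has_integral_add integrable_integral sq_norm_integrable u ux t order.refl)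
  ultimately have "(cmod (u x t))\<^sup>2 - (cmod (u 0 t))\<^sup>2 \<le>
     integral {0..x} (\<lambda>x. (cmod (u x t))\<^sup>2) + integral {0..x} (\<lambda>x. (cmod (ux x t))\<^sup>2)"
  proof (rule has_integral_le)
    fix y
    have "u y t \<bullet> ux y t \<le> cmod (u y t) * cmod (ux y t)" by (rule norm_cauchy_schwarz)
    moreover have "2 * cmod (u y t) * cmod (ux y t) \<le> (cmod (u y t))\<^sup>2 + (cmod (ux y t))\<^sup>2"
      by (rule sum_squares_bound)
    ultimately show "2 * (u y t \<bullet> ux y t) \<le> (cmod (u y t))\<^sup>2 + (cmod (ux y t))\<^sup>2" by linarith
  qed
  moreover have "(cmod (u 0 t))\<^sup>2 \<le> b\<^sup>2" by (rule power_mono[OF b norm_ge_zero])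
  ultimately show ?thesis using B by linarith
qed

section \<open>Bounds for the perturbation hierarchy\<close>

definition idx3 :: "nat \<Rightarrow> (nat \<times> nat \<times> nat) set" where
  "idx3 N = {(i, j, p). 1 \<le> i \<and> 1 \<le> j \<and> 1 \<le> p \<and> i + j + p = N}"

lemma finite_idx3: "finite (idx3 N)"
  by (rule finite_subset[of _ "{..N} \<times> {..N} \<times> {..N}"]) (auto simp: idx3_def)

text \<open>The indices are at least 1 and add up to N, so each is below N. This makes every
  equation of the hierarchy linear in the term of order N, with cubic terms known from lower
  orders.\<close>

lemma idx3D: "(i, j, p) \<in> idx3 N \<Longrightarrow> 1 \<le> i \<and> i < N \<and> 1 \<le> j \<and> j < N \<and> 1 \<le> p \<and> p < N"
  by (auto simp: idx3_def)

lemma coef3_idx3: "coef3 X Y Z N = (\<Sum>(i, j, p)\<in>idx3 N. X i * Y j * Z p)"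
  by (simp add: coef3_def idx3_def)

lemma coef3_cong:
  assumes "\<And>i. 1 \<le> i \<Longrightarrow> i < N \<Longrightarrow> X i = X' i" "\<And>i. 1 \<le> i \<Longrightarrow> i < N \<Longrightarrow> Y i = Y' i"
    "\<And>i. 1 \<le> i \<Longrightarrow> i < N \<Longrightarrow> Z i = Z' i"
  shows "coef3 X Y Z N = coef3 X' Y' Z' N"
  unfolding coef3_idx3 by (rule sum.cong) (auto dest: idx3D simp: assms)

lemma qcont_coef3:
  assumes "\<And>i. 1 \<le> i \<Longrightarrow> i < N \<Longrightarrow> qcont (X i)" "\<And>i. 1 \<le> i \<Longrightarrow> i < N \<Longrightarrow> qcont (Y i)"
    "\<And>i. 1 \<le> i \<Longrightarrow> i < N \<Longrightarrow> qcont (Z i)"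
  shows "qcont (\<lambda>x t. coef3 (\<lambda>i. X i x t) (\<lambda>i. Y i x t) (\<lambda>i. Z i x t) N)"
proof -
  have "qcont (\<lambda>x t. \<Sum>s\<in>idx3 N. X (fst s) x t * Y (fst (snd s)) x t * Z (snd (snd s)) x t)"
    by (rule qcont_sum, intro qcont_mult assms) (auto dest: idx3D)
  then show ?thesis by (simp add: coef3_idx3 case_prod_unfold)
qed

lemma coef3_has_vector_derivative:
  assumes X: "\<And>i. 1 \<le> i \<Longrightarrow> i < N \<Longrightarrow> ((\<lambda>s. X i s) has_vector_derivative X' i) (at x within S)"
    and Y: "\<And>i. 1 \<le> i \<Longrightarrow> i < N \<Longrightarrow> ((\<lambda>s. Y i s) has_vector_derivative Y' i) (at x within S)"
    and Z: "\<And>i. 1 \<le> i \<Longrightarrow> i < N \<Longrightarrow> ((\<lambda>s. Z i s) has_vector_derivative Z' i) (at x within S)"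
  shows "((\<lambda>s. coef3 (\<lambda>i. X i s) (\<lambda>i. Y i s) (\<lambda>i. Z i s) N) has_vector_derivative
     (coef3 X' (\<lambda>i. Y i x) (\<lambda>i. Z i x) N + coef3 (\<lambda>i. X i x) Y' (\<lambda>i. Z i x) N
        + coef3 (\<lambda>i. X i x) (\<lambda>i. Y i x) Z' N)) (at x within S)"
proof -
  have "((\<lambda>s. \<Sum>a\<in>idx3 N. X (fst a) s * Y (fst (snd a)) s * Z (snd (snd a)) s) has_vector_derivative
     (\<Sum>a\<in>idx3 N. (X (fst a) x * Y (fst (snd a)) x) * Z' (snd (snd a))
        + (X (fst a) x * Y' (fst (snd a)) + X' (fst a) * Y (fst (snd a)) x) * Z (snd (snd a)) x)) (at x within S)"
    by (rule has_vector_derivative_sum, intro has_vector_derivative_mult X Y Z) (auto dest: idx3D)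
  then show ?thesis
    by (simp add: coef3_idx3 case_prod_unfold sum.distrib algebra_simps)
qed

lemma has_vector_derivative_cnj':
  "(f has_vector_derivative f') (at x within S) \<Longrightarrow> ((\<lambda>s. cnj (f s)) has_vector_derivative cnj f') (at x within S)"
  by (rule bounded_linear.has_vector_derivative[OF bounded_linear_cnj])

lemma norm_coef3_le:
  assumes "\<And>i. 1 \<le> i \<Longrightarrow> i < N \<Longrightarrow> cmod (X i) \<le> A" "\<And>i. 1 \<le> i \<Longrightarrow> i < N \<Longrightarrow> cmod (Y i) \<le> B"
    "\<And>i. 1 \<le> i \<Longrightarrow> i < N \<Longrightarrow> cmod (Z i) \<le> C" and nn: "0 \<le> A" "0 \<le> B" "0 \<le> C"
  shows "cmod (coef3 X Y Z N) \<le> real (card (idx3 N)) * (A * B * C)"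
  unfolding coef3_idx3
proof (rule sum_norm_bound)
  fix s assume s: "s \<in> idx3 N"
  obtain i j p where [simp]: "s = (i, j, p)" by (cases s)
  have "cmod (X i * Y j * Z p) \<le> A * B * C"
    unfolding norm_mult using s nn
    by (intro mult_mono assms mult_nonneg_nonneg norm_ge_zero) (auto dest: idx3D)
  then show "cmod (case s of (i, j, p) \<Rightarrow> X i * Y j * Z p) \<le> A * B * C" by simp
qed

section \<open>Bounds uniform in x on a bounded time interval\<close>

definition supb :: "real \<Rightarrow> (real \<Rightarrow> real \<Rightarrow> complex) \<Rightarrow> bool" where
  "supb T f \<longleftrightarrow> qcont f \<and> (\<exists>B. \<forall>t x. 0 \<le> t \<and> t \<le> T \<and> 0 \<le> x \<longrightarrow> cmod (f x t) \<le> B)"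

text \<open>A bound on the integrals over \<open>{0..R}\<close> that is independent of R expresses
  membership in L^2 of the half line while only proper integrals of continuous functions
  occur.\<close>

definition l2b :: "real \<Rightarrow> (real \<Rightarrow> real \<Rightarrow> complex) \<Rightarrow> bool" where
  "l2b T f \<longleftrightarrow> qcont f \<and>
     (\<exists>B. \<forall>t R. 0 \<le> t \<and> t \<le> T \<and> 0 \<le> R \<longrightarrow> integral {0..R} (\<lambda>x. (cmod (f x t))\<^sup>2) \<le> B)"

lemma l2b_compare:
  assumes g: "l2b T g" and f: "qcont f"
    and le: "\<And>x t. 0 \<le> t \<Longrightarrow> t \<le> T \<Longrightarrow> 0 \<le> x \<Longrightarrow> (cmod (f x t))\<^sup>2 \<le> C * (cmod (g x t))\<^sup>2"
    and C: "0 \<le> C"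
  shows "l2b T f"
proof -
  obtain B where B: "\<And>t R. 0 \<le> t \<Longrightarrow> t \<le> T \<Longrightarrow> 0 \<le> R \<Longrightarrow> integral {0..R} (\<lambda>x. (cmod (g x t))\<^sup>2) \<le> B"
    and gq: "qcont g" using g by (auto simp: l2b_def)
  have "integral {0..R} (\<lambda>x. (cmod (f x t))\<^sup>2) \<le> C * B" if t: "0 \<le> t" "t \<le> T" and R: "0 \<le> R" for t R
  proof -
    have "integral {0..R} (\<lambda>x. (cmod (f x t))\<^sup>2) \<le> integral {0..R} (\<lambda>x. C * (cmod (g x t))\<^sup>2)"
      by (rule integral_le)
         (use le t in \<open>auto intro!: sq_norm_integrable f gq integrable_on_mult_right\<close>)
    also have "\<dots> = C * integral {0..R} (\<lambda>x. (cmod (g x t))\<^sup>2)" by simp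
    also have "\<dots> \<le> C * B" by (rule mult_left_mono[OF B C]) (use t R in auto)
    finally show ?thesis .
  qed
  then show ?thesis using f by (auto simp: l2b_def)
qed

lemma l2b_add:
  assumes f: "l2b T f" and g: "l2b T g"
  shows "l2b T (\<lambda>x t. f x t + g x t)"
proof -
  obtain A where A: "\<And>t R. 0 \<le> t \<Longrightarrow> t \<le> T \<Longrightarrow> 0 \<le> R \<Longrightarrow> integral {0..R} (\<lambda>x. (cmod (f x t))\<^sup>2) \<le> A"
    and fq: "qcont f" using f by (auto simp: l2b_def)
  obtain B where B: "\<And>t R. 0 \<le> t \<Longrightarrow> t \<le> T \<Longrightarrow> 0 \<le> R \<Longrightarrow> integral {0..R} (\<lambda>x. (cmod (g x t))\<^sup>2) \<le> B"
    and gq: "qcont g" using g by (auto simp: l2b_def)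
  have "integral {0..R} (\<lambda>x. (cmod (f x t + g x t))\<^sup>2) \<le> 2 * A + 2 * B"
    if t: "0 \<le> t" "t \<le> T" and R: "0 \<le> R" for t R
  proof -
    have i: "(\<lambda>x. 2 * (cmod (f x t))\<^sup>2) integrable_on {0..R}" "(\<lambda>x. 2 * (cmod (g x t))\<^sup>2) integrable_on {0..R}"
      using t by (auto intro!: sq_norm_integrable fq gq integrable_on_mult_right)
    have "integral {0..R} (\<lambda>x. (cmod (f x t + g x t))\<^sup>2)
      \<le> integral {0..R} (\<lambda>x. 2 * (cmod (f x t))\<^sup>2 + 2 * (cmod (g x t))\<^sup>2)"
    proof (rule integral_le)
      show "(\<lambda>x. (cmod (f x t + g x t))\<^sup>2) integrable_on {0..R}"
        by (rule sq_norm_integrable[OF qcont_add[OF fq gq] t(1) order.refl])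
      show "(\<lambda>x. 2 * (cmod (f x t))\<^sup>2 + 2 * (cmod (g x t))\<^sup>2) integrable_on {0..R}"
        by (rule integrable_add[OF i])
      fix x
      have "(cmod (f x t + g x t))\<^sup>2 \<le> (cmod (f x t) + cmod (g x t))\<^sup>2"
        by (rule power_mono[OF norm_triangle_ineq norm_ge_zero])
      moreover have "2 * cmod (f x t) * cmod (g x t) \<le> (cmod (f x t))\<^sup>2 + (cmod (g x t))\<^sup>2"
        by (rule sum_squares_bound)
      ultimately show "(cmod (f x t + g x t))\<^sup>2 \<le> 2 * (cmod (f x t))\<^sup>2 + 2 * (cmod (g x t))\<^sup>2"
        unfolding power2_sum by linarith
    qed
    also have "\<dots> = 2 * integral {0..R} (\<lambda>x. (cmod (f x t))\<^sup>2) + 2 * integral {0..R} (\<lambda>x. (cmod (g x t))\<^sup>2)"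
      by (simp only: integral_add[OF i] integral_mult_right)
    also have "\<dots> \<le> 2 * A + 2 * B" using A[OF t R] B[OF t R] by linarith
    finally show ?thesis .
  qed
  then show ?thesis using qcont_add[OF fq gq] unfolding l2b_def by blast
qed

lemma l2b_zero: "l2b T (\<lambda>x t. 0)"
  unfolding l2b_def by (intro conjI qcont_const exI[of _ 0]) auto

lemma l2b_sum: "finite I \<Longrightarrow> (\<And>i. i \<in> I \<Longrightarrow> l2b T (f i)) \<Longrightarrow> l2b T (\<lambda>x t. \<Sum>i\<in>I. f i x t)"
  by (induction I rule: finite_induct) (auto intro!: l2b_zero l2b_add)

lemma l2b_mult:
  assumes f: "supb T f" and g: "l2b T g"
  shows "l2b T (\<lambda>x t. f x t * g x t)"
proof -
  obtain B where B: "\<And>t x. 0 \<le> t \<Longrightarrow> t \<le> T \<Longrightarrow> 0 \<le> x \<Longrightarrow> cmod (f x t) \<le> B" and fq: "qcont f"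
    using f by (auto simp: supb_def)
  have gq: "qcont g" using g by (simp add: l2b_def)
  show ?thesis
  proof (rule l2b_compare[OF g qcont_mult[OF fq gq], where C="B\<^sup>2"])
    fix x t :: real assume "0 \<le> t" "t \<le> T" "0 \<le> x"
    then have "(cmod (f x t))\<^sup>2 \<le> B\<^sup>2" by (intro power_mono B) auto
    then show "(cmod (f x t * g x t))\<^sup>2 \<le> B\<^sup>2 * (cmod (g x t))\<^sup>2"
      by (simp add: norm_mult power_mult_distrib mult_right_mono)
  qed simp
qed

lemma l2b_cnj: "l2b T f \<Longrightarrow> l2b T (\<lambda>x t. cnj (f x t))"
  by (simp add: l2b_def qcont_cnj)

lemma supb_cnj: "supb T f \<Longrightarrow> supb T (\<lambda>x t. cnj (f x t))"
  by (simp add: supb_def qcont_cnj)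

lemma supb_mult: assumes "supb T f" "supb T g" shows "supb T (\<lambda>x t. f x t * g x t)"
proof -
  obtain A where A: "\<And>t x. 0 \<le> t \<Longrightarrow> t \<le> T \<Longrightarrow> 0 \<le> x \<Longrightarrow> cmod (f x t) \<le> A" and fq: "qcont f"
    using assms(1) by (auto simp: supb_def)
  obtain B where B: "\<And>t x. 0 \<le> t \<Longrightarrow> t \<le> T \<Longrightarrow> 0 \<le> x \<Longrightarrow> cmod (g x t) \<le> B" and gq: "qcont g"
    using assms(2) by (auto simp: supb_def)
  have "cmod (f x t * g x t) \<le> A * B" if "0 \<le> t" "t \<le> T" "0 \<le> x" for x t
    unfolding norm_mult
    by (rule mult_mono[OF A[OF that] B[OF that] order_trans[OF norm_ge_zero A[OF that]] norm_ge_zero])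
  then show ?thesis using qcont_mult[OF fq gq] unfolding supb_def by blast
qed

lemma l2b_mult3:
  assumes "supb T f" "supb T g" "l2b T h"
  shows "l2b T (\<lambda>x t. f x t * g x t * h x t)" "l2b T (\<lambda>x t. f x t * h x t * g x t)"
    "l2b T (\<lambda>x t. h x t * f x t * g x t)"
proof -
  note m = l2b_mult[OF supb_mult[OF assms(1,2)] assms(3)]
  have "(\<lambda>x t. f x t * h x t * g x t) = (\<lambda>x t. f x t * g x t * h x t)"
    "(\<lambda>x t. h x t * f x t * g x t) = (\<lambda>x t. f x t * g x t * h x t)"
    by (intro ext, simp only: mult_ac)+
  then show "l2b T (\<lambda>x t. f x t * g x t * h x t)" "l2b T (\<lambda>x t. f x t * h x t * g x t)"
    "l2b T (\<lambda>x t. h x t * f x t * g x t)" using m by (simp_all only:)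
qed

lemma l2b_coef3:
  assumes "\<And>i j p. 1 \<le> i \<Longrightarrow> i < N \<Longrightarrow> 1 \<le> j \<Longrightarrow> j < N \<Longrightarrow> 1 \<le> p \<Longrightarrow> p < N \<Longrightarrow>
    l2b T (\<lambda>x t. X i x t * Y j x t * Z p x t)"
  shows "l2b T (\<lambda>x t. coef3 (\<lambda>i. X i x t) (\<lambda>i. Y i x t) (\<lambda>i. Z i x t) N)"
proof -
  have "l2b T (\<lambda>x t. \<Sum>s\<in>idx3 N. X (fst s) x t * Y (fst (snd s)) x t * Z (snd (snd s)) x t)"
    by (rule l2b_sum[OF finite_idx3], rule assms) (auto dest: idx3D)
  then show ?thesis by (simp add: coef3_idx3 case_prod_unfold)
qed

text \<open>Bounds on \<open>F j\<close> and on x times \<open>F j\<close> make the square decay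
  like 1/(1 + x^2), whose primitive \<open>arctan\<close> is bounded by pi/2.\<close>

lemma schwartz_Rplus_L2:
  assumes F: "\<And>j. continuous_on {0..} (F j)" and b: "\<And>j k. \<exists>C. \<forall>x\<ge>0. cmod (of_real (x ^ k) * F j x) \<le> C"
  shows "\<exists>A. \<forall>R\<ge>0. integral {0..R} (\<lambda>x. (cmod (F j x :: complex))\<^sup>2) \<le> A"
proof -
  obtain C0 C1 where C0: "\<And>x. 0 \<le> x \<Longrightarrow> cmod (of_real (x ^ 0) * F j x) \<le> C0"
    and C1: "\<And>x. 0 \<le> x \<Longrightarrow> cmod (of_real (x ^ 1) * F j x) \<le> C1" using b by metis
  have le: "(cmod (F j x))\<^sup>2 \<le> (C0\<^sup>2 + C1\<^sup>2) * inverse (1 + x\<^sup>2)" if x: "0 \<le> x" for x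
  proof -
    have "(cmod (F j x))\<^sup>2 \<le> C0\<^sup>2" using power_mono[OF C0[OF x] norm_ge_zero, of 2] by simp
    moreover have "x\<^sup>2 * (cmod (F j x))\<^sup>2 \<le> C1\<^sup>2"
      using power_mono[OF C1[OF x] norm_ge_zero, of 2] by (simp add: norm_mult power_mult_distrib)
    ultimately have le: "(1 + x\<^sup>2) * (cmod (F j x))\<^sup>2 \<le> C0\<^sup>2 + C1\<^sup>2" by (simp add: distrib_right)
    have pos: "0 < 1 + x\<^sup>2" by (simp add: add_pos_nonneg)
    have "(cmod (F j x))\<^sup>2 = (1 + x\<^sup>2) * (cmod (F j x))\<^sup>2 * inverse (1 + x\<^sup>2)" using pos by simp
    also have "\<dots> \<le> (C0\<^sup>2 + C1\<^sup>2) * inverse (1 + x\<^sup>2)"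
      by (rule mult_right_mono[OF le]) (use pos in simp)
    finally show ?thesis .
  qed
  have "integral {0..R} (\<lambda>x. (cmod (F j x))\<^sup>2) \<le> (C0\<^sup>2 + C1\<^sup>2) * (pi / 2)" if R: "0 \<le> R" for R
  proof -
    have "((\<lambda>x. inverse (1 + x\<^sup>2)) has_integral (arctan R - arctan 0)) {0..R}"
    proof (rule fundamental_theorem_of_calculus[OF R])
      fix x show "(arctan has_vector_derivative inverse (1 + x\<^sup>2)) (at x within {0..R})"
        unfolding has_real_derivative_iff_has_vector_derivative[symmetric]
        by (rule has_field_derivative_at_within[OF DERIV_arctan])
    qed
    from has_integral_mult_right[OF this, of "C0\<^sup>2 + C1\<^sup>2"]
    have I: "((\<lambda>x. (C0\<^sup>2 + C1\<^sup>2) * inverse (1 + x\<^sup>2)) has_integral (C0\<^sup>2 + C1\<^sup>2) * arctan R) {0..R}" by simp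
    have "(\<lambda>x. (cmod (F j x))\<^sup>2) integrable_on {0..R}"
      by (intro integrable_continuous_real continuous_on_power continuous_on_norm
           continuous_on_subset[OF F]) auto
    then have "integral {0..R} (\<lambda>x. (cmod (F j x))\<^sup>2) \<le> (C0\<^sup>2 + C1\<^sup>2) * arctan R"
      by (rule has_integral_le[OF integrable_integral I]) (use le in auto)
    also have "\<dots> \<le> (C0\<^sup>2 + C1\<^sup>2) * (pi / 2)"
      using arctan_ubound[of R] by (intro mult_left_mono) auto
    finally show ?thesis .
  qed
  then show ?thesis by blast
qed

lemma vector_derivative_unique_halfline:
  assumes "0 \<le> x" "(f has_vector_derivative a) (at x within {0..})" "(f has_vector_derivative b) (at x within {0..})"
  shows "a = b"
proof (rule vector_derivative_unique_within_closed_interval[of 0 "x+1" x f])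
  show "(f has_vector_derivative a) (at x within cbox 0 (x+1))" "(f has_vector_derivative b) (at x within cbox 0 (x+1))"
    by (rule has_vector_derivative_within_subset, rule assms, simp)+
qed (use assms in auto)

section \<open>The hierarchy up to the boundary of the quarter plane\<close>

locale nls_hierarchy =
  fixes lam :: real and Q :: "nat \<Rightarrow> nat \<Rightarrow> nat \<Rightarrow> real \<Rightarrow> real \<Rightarrow> complex"
  assumes sol: "pert_sol lam Q"
    and L1: "\<And>N. 1 \<le> N \<Longrightarrow> \<exists>M. \<forall>t\<ge>0. set_integrable lborel {0..} (\<lambda>x. Q N 0 0 x t) \<and>
               (LINT x:{0..}|lborel. norm (Q N 0 0 x t)) \<le> M"
begin

definition cub where
  "cub N x t = 2 * of_real lam * coef3 (\<lambda>j. Q j 0 0 x t) (\<lambda>j. cnj (Q j 0 0 x t)) (\<lambda>j. Q j 0 0 x t) N"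

definition cubx where
  "cubx N x t = 2 * of_real lam *
     (coef3 (\<lambda>j. Q j 1 0 x t) (\<lambda>j. cnj (Q j 0 0 x t)) (\<lambda>j. Q j 0 0 x t) N
    + coef3 (\<lambda>j. Q j 0 0 x t) (\<lambda>j. cnj (Q j 1 0 x t)) (\<lambda>j. Q j 0 0 x t) N
    + coef3 (\<lambda>j. Q j 0 0 x t) (\<lambda>j. cnj (Q j 0 0 x t)) (\<lambda>j. Q j 1 0 x t) N)"

lemma smooth: "1 \<le> N \<Longrightarrow> smooth_qp (Q N)"
  using sol by (simp add: pert_sol_def)

lemma Q_qcont: "1 \<le> N \<Longrightarrow> qcont (Q N i j)"
  by (rule smooth_qp_qcont[OF smooth])

lemma Q_dx: "1 \<le> N \<Longrightarrow> 0 \<le> x \<Longrightarrow> 0 \<le> t \<Longrightarrow>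
    ((\<lambda>y. Q N i j y t) has_vector_derivative Q N (Suc i) j x t) (at x within {0..})"
  by (rule smooth_qp_dx[OF smooth])

lemma Q_dt: "1 \<le> N \<Longrightarrow> 0 \<le> x \<Longrightarrow> 0 \<le> t \<Longrightarrow>
    ((\<lambda>s. Q N i j x s) has_vector_derivative Q N i (Suc j) x t) (at t within {0..})"
  by (rule smooth_qp_dt[OF smooth])

lemma qcont_cub: "qcont (cub N)"
  unfolding cub_def by (intro qcont_mult[OF qcont_const] qcont_coef3 qcont_cnj Q_qcont) auto

lemma qcont_cubx: "qcont (cubx N)"
  unfolding cubx_def by (intro qcont_mult[OF qcont_const] qcont_add qcont_coef3 qcont_cnj Q_qcont) auto

lemma cub_dx:
  assumes "0 \<le> x" "0 \<le> t"
  shows "((\<lambda>y. cub N y t) has_vector_derivative cubx N x t) (at x within {0..})"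
  unfolding cub_def cubx_def
  by (rule has_vector_derivative_mult_right, rule coef3_has_vector_derivative)
     (use assms Q_dx[where i=0 and j=0] in \<open>auto intro!: has_vector_derivative_cnj'\<close>)

lemma pde:
  assumes N: "1 \<le> N" and "0 \<le> x" "0 \<le> t"
  shows "\<i> * Q N 0 1 x t + Q N 2 0 x t = cub N x t"
proof (rule qcont_eqI[of _ "cub N"])
  show "qcont (\<lambda>x t. \<i> * Q N 0 1 x t + Q N 2 0 x t)"
    by (intro qcont_add qcont_mult[OF qcont_const] Q_qcont N)
  show "\<i> * Q N 0 1 x t + Q N 2 0 x t = cub N x t" if "0 < x" "0 < t" for x t
  proof -
    have "\<i> * Q N 0 1 x t + Q N 2 0 x t
          - 2 * of_real lam * coef3 (\<lambda>j. Q j 0 0 x t) (\<lambda>j. cnj (Q j 0 0 x t)) (\<lambda>j. Q j 0 0 x t) N = 0"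
      using sol N that unfolding pert_sol_def by blast
    then show ?thesis by (simp add: cub_def)
  qed
qed (use assms qcont_cub in auto)

text \<open>In the encoding of partial derivatives \<open>Q N 1 1\<close> is both the x-derivative
  of \<open>Q N 0 1\<close> and the t-derivative of \<open>Q N 1 0\<close>. Differentiating the
  equation in x therefore yields a Schroedinger equation for \<open>Q N 1 0\<close>.\<close>

lemma pde_dx:
  assumes N: "1 \<le> N" and x: "0 \<le> x" and t: "0 \<le> t"
  shows "\<i> * Q N 1 1 x t + Q N 3 0 x t = cubx N x t"
proof (rule vector_derivative_unique_halfline[OF x])
  have "((\<lambda>y. \<i> * Q N 0 1 y t + Q N 2 0 y t) has_vector_derivative
      \<i> * Q N (Suc 0) 1 x t + Q N (Suc 2) 0 x t) (at x within {0..})"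
    by (intro has_vector_derivative_add has_vector_derivative_mult_right Q_dx N x t)
  then show "((\<lambda>y. \<i> * Q N 0 1 y t + Q N 2 0 y t) has_vector_derivative
      \<i> * Q N 1 1 x t + Q N 3 0 x t) (at x within {0..})"
    by (simp add: numeral_3_eq_3 numeral_2_eq_2)
  show "((\<lambda>y. \<i> * Q N 0 1 y t + Q N 2 0 y t) has_vector_derivative cubx N x t) (at x within {0..})"
    by (rule has_vector_derivative_transform[OF _ _ cub_dx[OF x t]]) (use x t pde[OF N] in auto)
qed

lemma schro_Q:
  assumes N: "1 \<le> N"
  shows "schro (Q N 0 0) (Q N 1 0) (Q N 2 0) (Q N 0 1) (cub N)"
    and "schro (Q N 1 0) (Q N 2 0) (Q N 3 0) (Q N 1 1) (cubx N)"
proof -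
  have e: "a = \<i> * b - \<i> * c" if "\<i> * a + b = c" for a b c :: complex
    using that by (auto simp: algebra_simps)
  note d = Q_dx[OF N, of _ _ 0 0] Q_dx[OF N, of _ _ "Suc 0" 0] Q_dx[OF N, of _ _ "Suc (Suc 0)" 0]
    Q_dt[OF N, of _ _ 0 0] Q_dt[OF N, of _ _ "Suc 0" 0]
  show "schro (Q N 0 0) (Q N 1 0) (Q N 2 0) (Q N 0 1) (cub N)"
    unfolding schro_def
    by (intro conjI allI impI Q_qcont[OF N] qcont_cub e pde[OF N])
       (use d in \<open>auto simp: numeral_3_eq_3 numeral_2_eq_2\<close>)
  show "schro (Q N 1 0) (Q N 2 0) (Q N 3 0) (Q N 1 1) (cubx N)"
    unfolding schro_def
    by (intro conjI allI impI Q_qcont[OF N] qcont_cubx e pde_dx[OF N])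
       (use d in \<open>auto simp: numeral_3_eq_3 numeral_2_eq_2\<close>)
qed

lemma L1_bound:
  assumes N: "1 \<le> N"
  shows "\<exists>M. \<forall>R t. 0 \<le> R \<longrightarrow> 0 \<le> t \<longrightarrow> integral {0..R} (\<lambda>x. cmod (Q N 0 0 x t)) \<le> M"
proof -
  obtain M where M: "\<And>t. 0 \<le> t \<Longrightarrow> set_integrable lborel {0..} (\<lambda>x. Q N 0 0 x t)"
    "\<And>t. 0 \<le> t \<Longrightarrow> (LINT x:{0..}|lborel. norm (Q N 0 0 x t)) \<le> M" using L1[OF N] by blast
  have "integral {0..R} (\<lambda>x. cmod (Q N 0 0 x t)) \<le> M" if t: "0 \<le> t" for R t
  proof -
    have i: "set_integrable lborel {0..} (\<lambda>x. norm (Q N 0 0 x t))"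
      by (rule set_integrable_norm[OF M(1)[OF t]])
    have "integral {0..R} (\<lambda>x. cmod (Q N 0 0 x t)) \<le> integral {0..} (\<lambda>x. cmod (Q N 0 0 x t))"
    proof (rule integral_subset_le)
      show "(\<lambda>x. cmod (Q N 0 0 x t)) integrable_on {0..R}"
        by (rule integrable_continuous_real[OF continuous_on_norm[OF qcont_x_Icc[OF Q_qcont[OF N] t]]]) simp
      show "(\<lambda>x. cmod (Q N 0 0 x t)) integrable_on {0..}"
        by (rule set_borel_integral_eq_integral(1)[OF i])
    qed auto
    also have "\<dots> \<le> M" using M(2)[OF t] set_borel_integral_eq_integral(2)[OF i] by simp
    finally show ?thesis .
  qed
  then show ?thesis by blast
qed

text \<open>The functions that witness the Schwartz condition at t = 0 coincide with q_N and its
  x-derivative, since derivatives on the half line are unique.\<close>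

lemma initial_L2:
  assumes N: "1 \<le> N"
  shows "\<exists>A. \<forall>R\<ge>0. integral {0..R} (\<lambda>x. (cmod (Q N 0 0 x 0))\<^sup>2) \<le> A \<and>
           integral {0..R} (\<lambda>x. (cmod (Q N 1 0 x 0))\<^sup>2) \<le> A"
proof -
  have "schwartz_Rplus (\<lambda>x. Q N 0 0 x 0)" using sol N by (simp add: pert_sol_def)
  then obtain F where F0: "\<And>x. 0 \<le> x \<Longrightarrow> F 0 x = Q N 0 0 x 0"
    and Fd: "\<And>j x. 0 \<le> x \<Longrightarrow> (F j has_vector_derivative F (Suc j) x) (at x within {0..})"
    and Fb: "\<And>j k. \<exists>C. \<forall>x\<ge>0. norm (of_real (x ^ k) * F j x) \<le> C"
    unfolding schwartz_Rplus_def by blast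
  have Fc: "continuous_on {0..} (F j)" for j
    by (rule continuous_on_vector_derivative[OF Fd]) simp
  have F1: "F 1 x = Q N 1 0 x 0" if x: "0 \<le> x" for x
  proof (rule vector_derivative_unique_halfline[OF x])
    show "(F 0 has_vector_derivative F 1 x) (at x within {0..})" using Fd[OF x, of 0] by simp
    show "(F 0 has_vector_derivative Q N 1 0 x 0) (at x within {0..})"
      by (rule has_vector_derivative_transform[where f="\<lambda>x. Q N 0 0 x 0"])
         (use x F0 Q_dx[OF N x, of 0 0 0] in auto)
  qed
  from schwartz_Rplus_L2[OF Fc Fb, where j=0]
  obtain A0 where A0: "\<forall>R\<ge>0. integral {0..R} (\<lambda>x. (cmod (F 0 x))\<^sup>2) \<le> A0" by (rule exE)
  from schwartz_Rplus_L2[OF Fc Fb, where j=1]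
  obtain A1 where A1: "\<forall>R\<ge>0. integral {0..R} (\<lambda>x. (cmod (F 1 x))\<^sup>2) \<le> A1" by (rule exE)
  have "integral {0..R} (\<lambda>x. (cmod (Q N 0 0 x 0))\<^sup>2) = integral {0..R} (\<lambda>x. (cmod (F 0 x))\<^sup>2)"
    "integral {0..R} (\<lambda>x. (cmod (Q N 1 0 x 0))\<^sup>2) = integral {0..R} (\<lambda>x. (cmod (F 1 x))\<^sup>2)" for R
    by (rule integral_cong; simp add: F0 F1[unfolded One_nat_def])+
  then have "\<forall>R\<ge>0. integral {0..R} (\<lambda>x. (cmod (Q N 0 0 x 0))\<^sup>2) \<le> max A0 A1 \<and>
      integral {0..R} (\<lambda>x. (cmod (Q N 1 0 x 0))\<^sup>2) \<le> max A0 A1"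
    using A0 A1 by (simp only: le_max_iff_disj) blast
  then show ?thesis by (rule exI)
qed

text \<open>Induction on N. In each product of the source and of its x-derivative at most one factor
  is a derivative, and all factors have lower order: one is taken in L^2, the others are bounded. So
  the source is in L^2, the energy estimates apply to q_N and to its x-derivative, and together they
  bound q_N. The constants depend on T, which is enough because \<open>lax_transport\<close> works
  on one bounded time interval at a time.\<close>

lemma H1_bounds:
  assumes T: "0 \<le> T"
  shows "1 \<le> N \<Longrightarrow> supb T (Q N 0 0) \<and> l2b T (Q N 0 0) \<and> l2b T (Q N 1 0)"
proof (induction N rule: less_induct)
  case (less N)
  note N = less.prems
  have IH: "supb T (Q i 0 0)" "l2b T (Q i 0 0)" "l2b T (Q i 1 0)" if "1 \<le> i" "i < N" for i
    using less.IH that by auto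
  have lam: "supb T (\<lambda>x t. 2 * of_real lam)"
    unfolding supb_def by (intro conjI qcont_const exI[of _ "cmod (2 * of_real lam)"]) auto
  have "l2b T (cub N)"
    unfolding cub_def
    by (rule l2b_mult[OF lam], rule l2b_coef3, rule l2b_mult3(1)) (intro supb_cnj IH; assumption)+
  then obtain F where F: "\<And>R t. 0 \<le> R \<Longrightarrow> 0 \<le> t \<Longrightarrow> t \<le> T \<Longrightarrow> integral {0..R} (\<lambda>x. (cmod (cub N x t))\<^sup>2) \<le> F"
    unfolding l2b_def by blast
  have "l2b T (cubx N)"
    unfolding cubx_def
  proof (intro l2b_mult[OF lam] l2b_add)
    show "l2b T (\<lambda>x t. coef3 (\<lambda>j. Q j 1 0 x t) (\<lambda>j. cnj (Q j 0 0 x t)) (\<lambda>j. Q j 0 0 x t) N)"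
      by (rule l2b_coef3, rule l2b_mult3(3)) (intro supb_cnj IH; assumption)+
    show "l2b T (\<lambda>x t. coef3 (\<lambda>j. Q j 0 0 x t) (\<lambda>j. cnj (Q j 1 0 x t)) (\<lambda>j. Q j 0 0 x t) N)"
      by (rule l2b_coef3, rule l2b_mult3(2)) (intro supb_cnj l2b_cnj IH; assumption)+
    show "l2b T (\<lambda>x t. coef3 (\<lambda>j. Q j 0 0 x t) (\<lambda>j. cnj (Q j 0 0 x t)) (\<lambda>j. Q j 1 0 x t) N)"
      by (rule l2b_coef3, rule l2b_mult3(1)) (intro supb_cnj IH; assumption)+
  qed
  then obtain F' where F': "\<And>R t. 0 \<le> R \<Longrightarrow> 0 \<le> t \<Longrightarrow> t \<le> T \<Longrightarrow> integral {0..R} (\<lambda>x. (cmod (cubx N x t))\<^sup>2) \<le> F'"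
    unfolding l2b_def by blast
  obtain M where M: "\<And>R t. 0 \<le> R \<Longrightarrow> 0 \<le> t \<Longrightarrow> integral {0..R} (\<lambda>x. cmod (Q N 0 0 x t)) \<le> M"
    using L1_bound[OF N] by blast
  obtain A where A: "\<And>R. 0 \<le> R \<Longrightarrow> integral {0..R} (\<lambda>x. (cmod (Q N 0 0 x 0))\<^sup>2) \<le> A"
    "\<And>R. 0 \<le> R \<Longrightarrow> integral {0..R} (\<lambda>x. (cmod (Q N 1 0 x 0))\<^sup>2) \<le> A"
    using initial_L2[OF N] by blast
  obtain b0 where b0: "\<And>x t. 0 \<le> x \<Longrightarrow> x \<le> 2 \<Longrightarrow> 0 \<le> t \<Longrightarrow> t \<le> T \<Longrightarrow> cmod (Q N 0 0 x t) \<le> b0"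
    using qcont_bounded[OF Q_qcont[OF N]] by metis
  obtain b1 where b1: "\<And>x t. 0 \<le> x \<Longrightarrow> x \<le> 2 \<Longrightarrow> 0 \<le> t \<Longrightarrow> t \<le> T \<Longrightarrow> cmod (Q N 1 0 x t) \<le> b1"
    using qcont_bounded[OF Q_qcont[OF N]] by metis
  obtain b2 where b2: "\<And>x t. 0 \<le> x \<Longrightarrow> x \<le> 2 \<Longrightarrow> 0 \<le> t \<Longrightarrow> t \<le> T \<Longrightarrow> cmod (Q N 2 0 x t) \<le> b2"
    using qcont_bounded[OF Q_qcont[OF N]] by metis
  define b where "b = max b0 (max b1 b2)"
  have b: "cmod (Q N 0 0 x t) \<le> b" "cmod (Q N 1 0 x t) \<le> b" "cmod (Q N 2 0 x t) \<le> b"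
    if "0 \<le> x" "x \<le> 2" "0 \<le> t" "t \<le> T" for x t
    using b0[OF that] b1[OF that] b2[OF that] by (auto simp: b_def)
  define B where "B = max (exp T * (A + 2*b\<^sup>2 + F)) (exp T * (A + 2*b\<^sup>2 + F'))"
  have B0: "integral {0..R} (\<lambda>x. (cmod (Q N 0 0 x t))\<^sup>2) \<le> B" if "0 \<le> t" "t \<le> T" "0 \<le> R" for t R
  proof -
    have "integral {0..R} (\<lambda>x. (cmod (Q N 0 0 x t))\<^sup>2) \<le> exp T * (A + 2*b\<^sup>2 + F)"
      by (rule energy_estimate_L1[OF schro_Q(1)[OF N], where T=T and M=M]) (use that M b F A in auto)
    then show ?thesis by (simp add: B_def)
  qed
  have B1: "integral {0..R} (\<lambda>x. (cmod (Q N 1 0 x t))\<^sup>2) \<le> B" if "0 \<le> t" "t \<le> T" "0 \<le> R" for t R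
  proof -
    have "integral {0..R} (\<lambda>x. (cmod (Q N 1 0 x t))\<^sup>2) \<le> exp T * (A + 2*b\<^sup>2 + F')"
      by (rule energy_estimate_deriv[OF schro_Q[OF N], where T=T and M=M]) (use that M b F' A in auto)
    then show ?thesis by (simp add: B_def)
  qed
  have "cmod (Q N 0 0 x t) \<le> sqrt (b\<^sup>2 + 2 * B)" if "0 \<le> t" "t \<le> T" "0 \<le> x" for t x
  proof (rule real_le_rsqrt)
    show "(cmod (Q N 0 0 x t))\<^sup>2 \<le> b\<^sup>2 + 2 * B"
      by (rule sup_bound_H1[OF Q_qcont[OF N] Q_qcont[OF N] that(1,3) schroD(1)[OF schro_Q(1)[OF N]]])
         (use that B0 B1 b in auto)
  qed
  then show ?case using B0 B1 Q_qcont[OF N] unfolding supb_def l2b_def by blast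
qed

end

section \<open>The Riccati equations of the Lax pair\<close>

text \<open>Order-by-order recursion: the term of order \<open>N\<close> is computed by \<open>G\<close> from the terms of lower order.\<close>
function rser :: "((nat \<Rightarrow> 'a) \<Rightarrow> nat \<Rightarrow> 'a) \<Rightarrow> nat \<Rightarrow> 'a" where
  "rser G N = G (\<lambda>j. if j < N then rser G j else undefined) N"
  by pat_completeness auto
termination by (relation "Wellfounded.measure snd") auto

declare rser.simps [simp del]

text \<open>The filler \<open>undefined\<close> for orders from N on is invisible to a G that reads
  only orders below N.\<close>

lemma rser_unfold:
  assumes "\<And>X X'. (\<And>j. j < N \<Longrightarrow> X j = X' j) \<Longrightarrow> G X N = G X' N"
  shows "rser G N = G (rser G) N"
  by (subst rser.simps, rule assms) simp

text \<open>All series start at order \<open>1\<close>, so the value of the sequence at \<open>0\<close> is discarded.\<close>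
definition fser :: "(nat \<Rightarrow> complex) \<Rightarrow> complex fps" where
  "fser X = Abs_fps (\<lambda>n. if n = 0 then 0 else X n)"

lemma fser_nth: "fps_nth (fser X) n = (if n = 0 then 0 else X n)"
  by (simp add: fser_def)

text \<open>In the iterated Cauchy product m is the joint order of the first two factors and i that
  of the first. Index pairs that do not come from \<open>idx3\<close> contain a coefficient of order
  0, which \<open>fser\<close> sets to 0.\<close>

lemma coef3_fser: "coef3 X Y Z N = fps_nth (fser X * fser Y * fser Z) N"
proof -
  let ?g = "\<lambda>(m, i). fps_nth (fser X) i * fps_nth (fser Y) (m - i) * fps_nth (fser Z) (N - m)"
  let ?h = "\<lambda>(i::nat, j::nat, p::nat). (i + j, i)"
  have inj: "inj_on ?h (idx3 N)" by (auto simp: inj_on_def idx3_def)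
  have "fps_nth (fser X * fser Y * fser Z) N = (\<Sum>m=0..N. \<Sum>i=0..m. ?g (m, i))"
    by (simp add: fps_mult_nth sum_distrib_right)
  also have "\<dots> = sum ?g (SIGMA m:{0..N}. {0..m})"
    by (subst sum.Sigma) auto
  also have "\<dots> = sum ?g (?h ` idx3 N)"
  proof (rule sum.mono_neutral_right)
    show "finite (SIGMA m:{0..N}. {0..m})" by auto
    show "?h ` idx3 N \<subseteq> (SIGMA m:{0..N}. {0..m})" by (auto simp: idx3_def)
    show "\<forall>s\<in>(SIGMA m:{0..N}. {0..m}) - ?h ` idx3 N. ?g s = 0"
    proof
      fix s assume s: "s \<in> (SIGMA m:{0..N}. {0..m}) - ?h ` idx3 N"
      obtain m i where [simp]: "s = (m, i)" by (cases s)
      have le: "m \<le> N" "i \<le> m" using s by auto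
      have "i = 0 \<or> m - i = 0 \<or> N - m = 0"
      proof (rule ccontr)
        assume "\<not> (i = 0 \<or> m - i = 0 \<or> N - m = 0)"
        then have "(i, m - i, N - m) \<in> idx3 N" using le by (auto simp: idx3_def)
        then have "?h (i, m - i, N - m) \<in> ?h ` idx3 N" by (rule imageI)
        then show False using s le by simp
      qed
      then show "?g s = 0" by (auto simp: fser_nth)
    qed
  qed
  also have "\<dots> = sum (?g \<circ> ?h) (idx3 N)" by (rule sum.reindex[OF inj])
  also have "\<dots> = (\<Sum>(i, j, p)\<in>idx3 N. X i * Y j * Z p)"
    by (rule sum.cong) (auto simp: fser_nth idx3_def)
  finally show ?thesis by (simp add: coef3_idx3)
qed

text \<open>Cross-differentiation of the two Riccati equations \<open>r\<^sub>x = U - 2ikr\<close> and \<open>r\<^sub>t = V - 4ik\<^sup>2r\<close>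
  obeyed by the quotient \<open>r\<close> of the components of an eigenfunction of the Lax pair.\<close>
lemma riccati_compat_ring:
  fixes q qb qx qbx qxx qbxx r k L I :: "'a::comm_ring_1"
  assumes I: "I * I = -1"
    and U: "U = q - L * (qb * r * r)"
    and V: "V = 2*k*q + I*qx - 2*L*k*(qb*r*r) + I*L*(qbx*r*r) - 2*I*L*(qb*q*r)"
    and rx: "rx = U - 2*I*k*r" and rt: "rt = V - 4*I*k*k*r"
    and qt: "qt = I*qxx - 2*I*L*(q*qb*q)" and qbt: "qbt = - I*qbxx + 2*I*L*(qb*q*qb)"
  shows "qt - L*(qbt*r*r + qb*rt*r + qb*r*rt) + 4*I*k*k*U =
     2*k*qx + I*qxx - 2*L*k*(qbx*r*r + qb*rx*r + qb*r*rx)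
     + I*L*(qbxx*r*r + qbx*rx*r + qbx*r*rx) - 2*I*L*(qbx*q*r + qb*qx*r + qb*q*rx) + 2*I*k*V"
proof -
  have II: "I * (I * x) = - x" for x by (simp add: I flip: mult.assoc)
  show ?thesis unfolding rx rt V U qt qbt by (simp add: algebra_simps I II)
qed

text \<open>Read in formal power series the triple sums become products, and the claim is the
  coefficient of order N in \<open>riccati_compat_ring\<close>. The conjugate of q is treated as an
  independent unknown, with its own evolution equation.\<close>

lemma riccati_compat:
  fixes q qb qx qbx qxx qbxx qt qbt r U V rx rt :: "nat \<Rightarrow> complex" and k L :: complex
  assumes U: "\<And>n. U n = q n - L * coef3 qb r r n"
    and V: "\<And>n. V n = 2*k*q n + \<i>*qx n - 2*L*k*coef3 qb r r n + \<i>*L*coef3 qbx r r n - 2*\<i>*L*coef3 qb q r n"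
    and rx: "\<And>n. rx n = U n - 2*\<i>*k*r n" and rt: "\<And>n. rt n = V n - 4*\<i>*k\<^sup>2*r n"
    and qt: "\<And>n. 1 \<le> n \<Longrightarrow> qt n = \<i>*qxx n - 2*\<i>*L*coef3 q qb q n"
    and qbt: "\<And>n. 1 \<le> n \<Longrightarrow> qbt n = - \<i>*qbxx n + 2*\<i>*L*coef3 qb q qb n"
    and N: "1 \<le> N"
  shows "qt N - L*(coef3 qbt r r N + coef3 qb rt r N + coef3 qb r rt N) + 4*\<i>*k\<^sup>2*U N =
     2*k*qx N + \<i>*qxx N - 2*L*k*(coef3 qbx r r N + coef3 qb rx r N + coef3 qb r rx N)
     + \<i>*L*(coef3 qbxx r r N + coef3 qbx rx r N + coef3 qbx r rx N)
     - 2*\<i>*L*(coef3 qbx q r N + coef3 qb qx r N + coef3 qb q rx N) + 2*\<i>*k*V N"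
proof -
  let ?k = "fps_const k" and ?L = "fps_const L" and ?I = "fps_const \<i>"
  have two: "(2 :: complex fps) = fps_const 2" and four: "(4 :: complex fps) = fps_const 4"
    by (simp_all add: numeral_fps_const)
  note nth = fps_sub_nth fps_add_nth fps_neg_nth fser_nth mult.assoc fps_mult_left_const_nth
  have cN: "coef3 X Y Z n = fps_nth (fser X * (fser Y * fser Z)) n" for X Y Z n
    by (simp add: coef3_fser mult.assoc)
  have c0': "fps_nth (fser X * (fser Y * fser Z)) 0 = 0" for X Y Z by (simp add: fser_nth)
  have FU: "fser U = fser q - ?L * (fser qb * fser r * fser r)"
    by (rule fps_ext) (auto simp: nth U cN c0')
  have FV: "fser V = 2*?k*fser q + ?I*fser qx - 2*?L*?k*(fser qb*fser r*fser r)
     + ?I*?L*(fser qbx*fser r*fser r) - 2*?I*?L*(fser qb*fser q*fser r)"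
    by (rule fps_ext) (auto simp: two nth V cN c0')
  have Frx: "fser rx = fser U - 2*?I*?k*fser r"
    by (rule fps_ext) (auto simp: two nth rx)
  have Frt: "fser rt = fser V - 4*?I*?k*?k*fser r"
    by (rule fps_ext) (auto simp: four nth rt power2_eq_square)
  have Fqt: "fser qt = ?I*fser qxx - 2*?I*?L*(fser q*fser qb*fser q)"
    by (rule fps_ext) (auto simp: two nth qt cN c0')
  have Fqbt: "fser qbt = - ?I*fser qbxx + 2*?I*?L*(fser qb*fser q*fser qb)"
    by (rule fps_ext) (auto simp: two nth qbt cN c0')
  have II: "?I * ?I = -1" by (rule fps_ext) simp
  from riccati_compat_ring[OF II FU FV Frx Frt Fqt Fqbt, THEN arg_cong[where f="\<lambda>F. fps_nth F N"]]
  show ?thesis using N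
    by (simp add: two four nth cN power2_eq_square distrib_left) (simp add: algebra_simps)
qed

section \<open>Solving the equation in x from infinity\<close>

lemma exp_linear_has_vector_derivative:
  "((\<lambda>x. exp (c * of_real x)) has_vector_derivative c * exp (c * of_real x)) (at (x::real) within S)" for c :: complex
proof -
  have "((\<lambda>z. exp (c * z)) has_field_derivative c * exp (c * of_real x)) (at (of_real x))"
    by (auto intro!: derivative_eq_intros)
  from has_vector_derivative_real_field[OF this] show ?thesis .
qed

lemma absolutely_integrable_dominated:
  fixes f :: "real \<Rightarrow> complex" and g :: "real \<Rightarrow> real"
  assumes c: "continuous_on {a..} f" and g: "g integrable_on {a..}" and le: "\<And>x. a \<le> x \<Longrightarrow> cmod (f x) \<le> g x"
  shows "f absolutely_integrable_on {a..}"
proof (rule measurable_bounded_by_integrable_imp_absolutely_integrable[OF _ _ g])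
  show "f \<in> borel_measurable (lebesgue_on {a..})"
    by (rule continuous_imp_measurable_on_sets_lebesgue[OF c]) simp
qed (use le in auto)

lemma integrable_on_halfline_mono:
  fixes f :: "real \<Rightarrow> real"
  assumes f: "f integrable_on {0..}" and p: "\<And>x. 0 \<le> x \<Longrightarrow> 0 \<le> f x" and a: "0 \<le> a"
  shows "f integrable_on {a..}"
proof -
  have "f absolutely_integrable_on {0..}"
    by (rule nonnegative_absolutely_integrable_1[OF f]) (use p in auto)
  then have "f absolutely_integrable_on {a..}"
    by (rule set_integrable_subset) (use a in auto)
  then show ?thesis by (rule set_lebesgue_integral_eq_integral(1))
qed

text \<open>Variation of constants started at infinity. For y at least x the kernel has modulus at
  most 1, so the L^1 norm of f bounds g uniformly in \<open>\<kappa>\<close>, including the case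
  that \<open>\<kappa>\<close> is imaginary.\<close>

lemma tail_integral:
  fixes f :: "real \<Rightarrow> complex" and \<kappa> :: complex
  assumes c: "continuous_on {0..} f" and i: "(\<lambda>x. cmod (f x)) integrable_on {0..}" and \<kappa>: "Re \<kappa> \<le> 0"
    and g: "\<And>x. g x = - integral {x..} (\<lambda>y. exp (\<kappa> * of_real (y - x)) * f y)" and x: "0 \<le> x"
  shows "cmod (g x) \<le> integral {0..} (\<lambda>x. cmod (f x))"
    and "(g has_vector_derivative f x - \<kappa> * g x) (at x within {0..})"
proof -
  have ia: "(\<lambda>x. cmod (f x)) integrable_on {a..}" if "0 \<le> a" for a
    by (rule integrable_on_halfline_mono[OF i _ that]) simp
  have ne: "cmod (exp (\<kappa> * of_real (y - a)) * f y) \<le> cmod (f y)" if "a \<le> y" for a y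
  proof -
    have "Re \<kappa> * (y - a) \<le> 0" using \<kappa> that by (intro mult_nonpos_nonneg) auto
    then have "cmod (exp (\<kappa> * of_real (y - a))) \<le> 1" by simp
    then show ?thesis unfolding norm_mult by (rule mult_left_le_one_le[OF norm_ge_zero norm_ge_zero])
  qed
  have wi: "(\<lambda>y. exp (\<kappa> * of_real (y - a)) * f y) integrable_on {b..}" if ab: "0 \<le> a" "a \<le> b" for a b
  proof -
    have cb: "continuous_on {b..} f" by (rule continuous_on_subset[OF c]) (use ab in auto)
    have "(\<lambda>y. exp (\<kappa> * of_real (y - a)) * f y) absolutely_integrable_on {b..}"
    proof (rule absolutely_integrable_dominated[OF _ ia[of b]])
      show "continuous_on {b..} (\<lambda>y. exp (\<kappa> * of_real (y - a)) * f y)"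
        by (intro continuous_on_mult cb) (intro continuous_intros)
    qed (use ab ne in auto)
    then show ?thesis by (rule set_lebesgue_integral_eq_integral(1))
  qed
  have "cmod (g x) \<le> integral {x..} (\<lambda>x. cmod (f x))"
    unfolding g norm_minus_cancel
    by (rule integral_norm_bound_integral[OF wi[OF x order.refl] ia[OF x]]) (use ne in auto)
  also have "\<dots> \<le> integral {0..} (\<lambda>x. cmod (f x))"
    by (rule integral_subset_le[OF _ ia[OF x] i]) (use x in auto)
  finally show "cmod (g x) \<le> integral {0..} (\<lambda>x. cmod (f x))" .
  \<comment> \<open>Splitting the kernel into a factor in x and a factor in y removes x from the
    integrand, so that g can be differentiated.\<close>
  define h where "h = (\<lambda>y. exp (\<kappa> * of_real y) * f y)"
  have hc: "continuous_on {0..} h"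
    unfolding h_def by (intro continuous_on_mult c) (intro continuous_intros)
  have hi: "h integrable_on {b..}" if "0 \<le> b" for b using wi[of 0 b] that by (simp add: h_def)
  have geq: "g z = - exp (- \<kappa> * of_real z) * (integral {0..} h - integral {0..z} h)" if "z \<in> {0..}" for z
  proof -
    have z: "0 \<le> z" using that by simp
    have "integral ({0..z} \<union> {z..}) h = integral {0..z} h + integral {z..} h"
    proof (rule integral_Un[OF _ hi[OF z]])
      show "h integrable_on {0..z}"
        by (rule integrable_continuous_real[OF continuous_on_subset[OF hc]]) auto
      have "{0..z} \<inter> {z..} = {z}" using z by auto
      then show "negligible ({0..z} \<inter> {z..})" by simp
    qed
    moreover have "{0..z} \<union> {z..} = {0..}" using z by auto
    ultimately have e: "integral {z..} h = integral {0..} h - integral {0..z} h" by simp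
    have "integral {z..} (\<lambda>y. exp (\<kappa> * of_real (y - z)) * f y) = integral {z..} (\<lambda>y. exp (- \<kappa> * of_real z) * h y)"
    proof (rule integral_cong)
      fix y
      have "exp (\<kappa> * of_real (y - z)) = exp (- \<kappa> * of_real z) * exp (\<kappa> * of_real y)"
        unfolding exp_add[symmetric] by (rule arg_cong[where f=exp]) (simp add: right_diff_distrib)
      then show "exp (\<kappa> * of_real (y - z)) * f y = exp (- \<kappa> * of_real z) * h y"
        by (simp only: h_def mult.assoc)
    qed
    also have "\<dots> = exp (- \<kappa> * of_real z) * integral {z..} h" by (rule integral_mult_right)
    finally show ?thesis unfolding g e by (simp only: mult_minus_left)
  qed
  have "((\<lambda>z. - exp (- \<kappa> * of_real z) * (integral {0..} h - integral {0..z} h)) has_vector_derivative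
     (- exp (- \<kappa> * of_real x)) * (0 - h x) + (- (- \<kappa> * exp (- \<kappa> * of_real x))) * (integral {0..} h - integral {0..x} h))
     (at x within {0..})"
    by (intro has_vector_derivative_mult has_vector_derivative_minus exp_linear_has_vector_derivative
        has_vector_derivative_diff has_vector_derivative_const has_vector_derivative_integral_halfline[OF hc x])
  moreover have "(- exp (- \<kappa> * of_real x)) * (0 - h x) + (- (- \<kappa> * exp (- \<kappa> * of_real x))) * (integral {0..} h - integral {0..x} h)
      = f x - \<kappa> * g x"
  proof -
    have e: "exp (- \<kappa> * of_real x) * h x = f x"
      by (simp add: h_def exp_minus flip: mult.assoc)
    have gx: "g x = - exp (- \<kappa> * of_real x) * (integral {0..} h - integral {0..x} h)"
      by (rule geq) (use x in simp)
    have "(- E) * (0 - H) + (- (- \<kappa> * E)) * D = E * H - \<kappa> * (- E * D)" for E H D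
      by (simp add: algebra_simps)
    then show ?thesis unfolding gx e[symmetric] .
  qed
  ultimately have D: "((\<lambda>z. - exp (- \<kappa> * of_real z) * (integral {0..} h - integral {0..z} h)) has_vector_derivative
     f x - \<kappa> * g x) (at x within {0..})" by (simp only:)
  show "(g has_vector_derivative f x - \<kappa> * g x) (at x within {0..})"
    by (rule has_vector_derivative_transform[OF _ geq D]) (use x in simp)
qed

text \<open>Uniformly local L^1 is the common ground for the terms of V: some are bounded without
  decay, while those with q_x are only known to be in L^2.\<close>

definition loc1 :: "real \<Rightarrow> (real \<Rightarrow> real \<Rightarrow> complex) \<Rightarrow> bool" where
  "loc1 T f \<longleftrightarrow> qcont f \<and>
     (\<exists>B. \<forall>t X. 0 \<le> t \<and> t \<le> T \<and> 0 \<le> X \<longrightarrow> integral {X..X+1} (\<lambda>x. cmod (f x t)) \<le> B)"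

lemma cmod_integrable:
  assumes "qcont f" "0 \<le> t" "0 \<le> a"
  shows "(\<lambda>x. cmod (f x t)) integrable_on {a..b}"
  by (rule integrable_continuous_real[OF continuous_on_norm[OF qcont_x_Icc[OF assms]]])

lemma loc1_add:
  assumes f: "loc1 T f" and g: "loc1 T g"
  shows "loc1 T (\<lambda>x t. f x t + g x t)"
proof -
  obtain A where A: "\<And>t X. 0 \<le> t \<Longrightarrow> t \<le> T \<Longrightarrow> 0 \<le> X \<Longrightarrow> integral {X..X+1} (\<lambda>x. cmod (f x t)) \<le> A"
    and fq: "qcont f" using f by (auto simp: loc1_def)
  obtain B where B: "\<And>t X. 0 \<le> t \<Longrightarrow> t \<le> T \<Longrightarrow> 0 \<le> X \<Longrightarrow> integral {X..X+1} (\<lambda>x. cmod (g x t)) \<le> B"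
    and gq: "qcont g" using g by (auto simp: loc1_def)
  have "integral {X..X+1} (\<lambda>x. cmod (f x t + g x t)) \<le> A + B" if t: "0 \<le> t" "t \<le> T" and X: "0 \<le> X" for t X
  proof -
    have "integral {X..X+1} (\<lambda>x. cmod (f x t + g x t)) \<le> integral {X..X+1} (\<lambda>x. cmod (f x t) + cmod (g x t))"
      by (rule integral_le[OF cmod_integrable[OF qcont_add[OF fq gq] t(1) X]
           integrable_add[OF cmod_integrable[OF fq t(1) X] cmod_integrable[OF gq t(1) X]] norm_triangle_ineq])
    also have "\<dots> = integral {X..X+1} (\<lambda>x. cmod (f x t)) + integral {X..X+1} (\<lambda>x. cmod (g x t))"
      by (rule integral_add[OF cmod_integrable[OF fq t(1) X] cmod_integrable[OF gq t(1) X]])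
    also have "\<dots> \<le> A + B" by (rule add_mono[OF A[OF t X] B[OF t X]])
    finally show ?thesis .
  qed
  then show ?thesis using qcont_add[OF fq gq] unfolding loc1_def by blast
qed

lemma loc1_zero: "loc1 T (\<lambda>x t. 0)"
  unfolding loc1_def by (intro conjI qcont_const exI[of _ 0]) auto

lemma loc1_sum: "finite I \<Longrightarrow> (\<And>i. i \<in> I \<Longrightarrow> loc1 T (f i)) \<Longrightarrow> loc1 T (\<lambda>x t. \<Sum>i\<in>I. f i x t)"
  by (induction I rule: finite_induct) (auto intro!: loc1_zero loc1_add)

lemma loc1_cmult: assumes f: "loc1 T f" shows "loc1 T (\<lambda>x t. c * f x t)"
proof -
  obtain A where A: "\<And>t X. 0 \<le> t \<Longrightarrow> t \<le> T \<Longrightarrow> 0 \<le> X \<Longrightarrow> integral {X..X+1} (\<lambda>x. cmod (f x t)) \<le> A"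
    and fq: "qcont f" using f by (auto simp: loc1_def)
  have "integral {X..X+1} (\<lambda>x. cmod (c * f x t)) \<le> cmod c * A" if "0 \<le> t" "t \<le> T" "0 \<le> X" for t X
    unfolding norm_mult integral_mult_right by (rule mult_left_mono[OF A[OF that] norm_ge_zero])
  then show ?thesis using qcont_mult[OF qcont_const fq] unfolding loc1_def by blast
qed

lemma loc1_supb: assumes f: "supb T f" shows "loc1 T f"
proof -
  obtain A where A: "\<And>t x. 0 \<le> t \<Longrightarrow> t \<le> T \<Longrightarrow> 0 \<le> x \<Longrightarrow> cmod (f x t) \<le> A"
    and fq: "qcont f" using f by (auto simp: supb_def)
  have "integral {X..X+1} (\<lambda>x. cmod (f x t)) \<le> A" if t: "0 \<le> t" "t \<le> T" "0 \<le> X" for t X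
  proof -
    have "integral {X..X+1} (\<lambda>x. cmod (f x t)) \<le> integral {X..X+1} (\<lambda>x::real. A)"
      by (rule integral_le[OF cmod_integrable[OF fq t(1,3)]]) (use A t in auto)
    then show ?thesis by simp
  qed
  then show ?thesis using fq unfolding loc1_def by blast
qed

lemma loc1_l2b: assumes f: "l2b T f" shows "loc1 T f"
proof -
  obtain A where A: "\<And>t R. 0 \<le> t \<Longrightarrow> t \<le> T \<Longrightarrow> 0 \<le> R \<Longrightarrow> integral {0..R} (\<lambda>x. (cmod (f x t))\<^sup>2) \<le> A"
    and fq: "qcont f" using f by (auto simp: l2b_def)
  have "integral {X..X+1} (\<lambda>x. cmod (f x t)) \<le> 1 + A" if t: "0 \<le> t" "t \<le> T" and X: "0 \<le> X" for t X
  proof -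
    have i: "(\<lambda>x. (cmod (f x t))\<^sup>2) integrable_on {a..b}" if "0 \<le> a" for a b
      by (rule sq_norm_integrable[OF fq t(1) that])
    have c: "(\<lambda>x::real. 1::real) integrable_on {X..X+1}" by (rule integrable_const_ivl)
    have "integral {X..X+1} (\<lambda>x. cmod (f x t)) \<le> integral {X..X+1} (\<lambda>x. 1 + (cmod (f x t))\<^sup>2)"
    proof (rule integral_le[OF cmod_integrable[OF fq t(1) X] integrable_add[OF c i[OF X]]])
      show "cmod (f x t) \<le> 1 + (cmod (f x t))\<^sup>2" for x
        using sum_squares_bound[of 1 "cmod (f x t)"] norm_ge_zero[of "f x t"]
        by (simp only: power_one mult_1_right)
    qed
    also have "\<dots> = integral {X..X+1} (\<lambda>x::real. 1) + integral {X..X+1} (\<lambda>x. (cmod (f x t))\<^sup>2)"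
      by (rule integral_add[OF c i[OF X]])
    also have "integral {X..X+1} (\<lambda>x. (cmod (f x t))\<^sup>2) \<le> integral {0..X+1} (\<lambda>x. (cmod (f x t))\<^sup>2)"
      by (rule integral_subset_le[OF _ i[OF X] i]) (use X in auto)
    also have "\<dots> \<le> A" using A t X by simp
    finally show ?thesis by simp
  qed
  then show ?thesis using fq unfolding loc1_def by blast
qed

lemma loc1_coef3:
  assumes "\<And>i j p. 1 \<le> i \<Longrightarrow> i < N \<Longrightarrow> 1 \<le> j \<Longrightarrow> j < N \<Longrightarrow> 1 \<le> p \<Longrightarrow> p < N \<Longrightarrow>
    loc1 T (\<lambda>x t. X i x t * Y j x t * Z p x t)"
  shows "loc1 T (\<lambda>x t. coef3 (\<lambda>i. X i x t) (\<lambda>i. Y i x t) (\<lambda>i. Z i x t) N)"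
proof -
  have "loc1 T (\<lambda>x t. \<Sum>s\<in>idx3 N. X (fst s) x t * Y (fst (snd s)) x t * Z (snd (snd s)) x t)"
    by (rule loc1_sum[OF finite_idx3], rule assms) (auto dest: idx3D)
  then show ?thesis by (simp add: coef3_idx3 case_prod_unfold)
qed

text \<open>Scaling \<open>{0..t}\<close> to the unit interval moves the variable endpoint into the
  integrand, where joint continuity is a standard fact about parameters. For positive t the scaling
  is \<open>stk_primitive\<close> with step t from 0.\<close>

lemma qcont_integral_t:
  fixes W :: "real \<Rightarrow> real \<Rightarrow> complex"
  assumes W: "qcont W"
  shows "qcont (\<lambda>x t. integral {0..t} (\<lambda>s. W x s))"
proof (rule qcontI)
  have W': "qcont (\<lambda>s x. W x s)" by (rule qcont_swap[OF W])
  have eq: "integral {0..t} (\<lambda>s. W x s) = of_real t * integral {0..1} (\<lambda>y. W x (t * y))"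
    if x: "0 \<le> x" and t: "0 \<le> t" for x t
  proof (cases "t = 0")
    case False
    then have t: "0 < t" using t by simp
    have "stk t (\<lambda>s x. W x s) 0 x = (integral {0..0+t} (\<lambda>s. W x s) - integral {0..0} (\<lambda>s. W x s)) / of_real t"
      by (rule stk_primitive[OF W' t order.refl x has_vector_derivative_integral_halfline[OF qcont_x[OF W' x]]])
    then show ?thesis using t by (simp add: stk_def)
  qed simp
  have "continuous_on (({0..} \<times> {0..}) \<times> cbox 0 1) (\<lambda>s. W (fst (fst s)) (snd (fst s) * snd s))"
    by (rule qcont_compose[OF W]) (auto intro!: continuous_intros)
  then have "continuous_on (({0..} \<times> {0..}) \<times> cbox 0 1) (\<lambda>(p, y). W (fst p) (snd p * y))"
    by (simp only: case_prod_unfold)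
  from integral_continuous_on_param[OF this]
  have "continuous_on ({0..} \<times> {0..}) (\<lambda>p. of_real (snd p) * integral {0..1} (\<lambda>y. W (fst p) (snd p * y)))"
    unfolding cbox_interval by (intro continuous_on_mult) (auto intro!: continuous_intros)
  then show "continuous_on ({0..} \<times> {0..}) (\<lambda>p. integral {0..snd p} (\<lambda>s. W (fst p) s))"
    by (rule continuous_on_eq) (auto simp: eq)
qed

lemma qcont_of_x: "continuous_on {0..} g \<Longrightarrow> qcont (\<lambda>x t. g x)"
  unfolding qcont_def case_prod_unfold
  by (rule continuous_on_compose2[where s="{0..} \<times> {0..}" and f=fst]) (auto intro!: continuous_intros)

lemma qcont_of_t: "continuous_on {0..} g \<Longrightarrow> qcont (\<lambda>x t. g t)"
  unfolding qcont_def case_prod_unfold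
  by (rule continuous_on_compose2[where s="{0..} \<times> {0..}" and f=snd]) (auto intro!: continuous_intros)

lemma continuous_on_coef3:
  assumes "\<And>i. 1 \<le> i \<Longrightarrow> i < N \<Longrightarrow> continuous_on S (\<lambda>x. X i x)" "\<And>i. 1 \<le> i \<Longrightarrow> i < N \<Longrightarrow> continuous_on S (\<lambda>x. Y i x)"
    "\<And>i. 1 \<le> i \<Longrightarrow> i < N \<Longrightarrow> continuous_on S (\<lambda>x. Z i x)"
  shows "continuous_on S (\<lambda>x. coef3 (\<lambda>i. X i x) (\<lambda>i. Y i x) (\<lambda>i. Z i x) N)"
proof -
  have "continuous_on S (\<lambda>x. \<Sum>s\<in>idx3 N. X (fst s) x * Y (fst (snd s)) x * Z (snd (snd s)) x)"
    by (rule continuous_on_sum, intro continuous_on_mult assms) (auto dest: idx3D)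
  then show ?thesis by (simp add: coef3_idx3 case_prod_unfold)
qed

lemma cnj_coef3: "cnj (coef3 X Y Z N) = coef3 (\<lambda>i. cnj (X i)) (\<lambda>i. cnj (Y i)) (\<lambda>i. cnj (Z i)) N"
  by (simp add: coef3_idx3 case_prod_unfold)

lemma continuous_exp_linear: "continuous_on S (\<lambda>x::real. exp (c * of_real x) :: complex)"
  by (intro continuous_intros)

text \<open>The error \<open>H\<close> in the integrated equation in \<open>t\<close> is constant in \<open>x\<close> by compatibility, and the
  exponential decay of \<open>e\<^sup>2\<^sup>i\<^sup>k\<^sup>x\<close> forces it to vanish; averaging over unit intervals makes a local \<open>L\<^sup>1\<close> bound on \<open>V\<close> sufficient.\<close>
lemma lax_transport:
  fixes R U V Ut Vx :: "real \<Rightarrow> real \<Rightarrow> complex"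
  assumes k: "0 < Im k"
    and qU: "qcont U" and qV: "qcont V" and qVx: "qcont Vx"
    and dR: "\<And>x t. 0 \<le> x \<Longrightarrow> 0 \<le> t \<Longrightarrow> ((\<lambda>x. R x t) has_vector_derivative U x t - 2*\<i>*k * R x t) (at x within {0..})"
    and dU: "\<And>x t. 0 \<le> x \<Longrightarrow> 0 \<le> t \<Longrightarrow> ((\<lambda>t. U x t) has_vector_derivative Ut x t) (at t within {0..})"
    and dV: "\<And>x t. 0 \<le> x \<Longrightarrow> 0 \<le> t \<Longrightarrow> ((\<lambda>x. V x t) has_vector_derivative Vx x t) (at x within {0..})"
    and compat: "\<And>x t. 0 \<le> x \<Longrightarrow> 0 \<le> t \<Longrightarrow> Ut x t + 4*\<i>*k\<^sup>2 * U x t = Vx x t + 2*\<i>*k * V x t"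
    and M: "\<And>x t. 0 \<le> x \<Longrightarrow> 0 \<le> t \<Longrightarrow> cmod (R x t) \<le> M"
    and loc: "\<And>T. 0 \<le> T \<Longrightarrow> loc1 T V"
  shows "qcont R" and "\<And>x t. 0 \<le> x \<Longrightarrow> 0 \<le> t \<Longrightarrow>
    ((\<lambda>t. R x t) has_vector_derivative V x t - 4*\<i>*k\<^sup>2 * R x t) (at t within {0..})"
proof -
  define \<alpha> \<beta> where "\<alpha> = 2*\<i>*k" and "\<beta> = 4*\<i>*k\<^sup>2"
  define e where "e = (\<lambda>x::real. exp (\<alpha> * of_real x))"
  define E where "E = (\<lambda>s::real. exp (\<beta> * of_real s))"
  have e': "(e has_vector_derivative \<alpha> * e x) (at x within S)" for x S
    unfolding e_def by (rule exp_linear_has_vector_derivative)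
  have E': "(E has_vector_derivative \<beta> * E x) (at x within S)" for x S
    unfolding E_def by (rule exp_linear_has_vector_derivative)
  have ec: "continuous_on S e" and Ec: "continuous_on S E" for S
    unfolding e_def E_def by (rule continuous_exp_linear)+
  have ne: "cmod (e x) = exp (- (2 * Im k * x))" for x by (simp add: e_def \<alpha>_def)
  have main: "E t * R x t = R x 0 + integral {0..t} (\<lambda>s. E s * V x s)" if x0: "0 \<le> x" and t: "0 \<le> t" for x t
  proof -
    \<comment> \<open>This is the error of the integrated equation times exp(2ikx). The factor
      absorbs the linear term of the equation in x and later supplies the decay.\<close>
    define H where "H = (\<lambda>x. E t * (e x * R x t) - e x * R x 0 - integral {0..t} (\<lambda>s. e x * (E s * V x s)))"
    have H': "(H has_vector_derivative 0) (at x within {0..})" if x: "x \<in> {0..}" for x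
    proof -
      have x: "0 \<le> x" using x by simp
      have d1: "((\<lambda>x. e x * R x s) has_vector_derivative e x * U x s) (at x within {0..})" if "0 \<le> s" for s
      proof -
        have "((\<lambda>x. e x * R x s) has_vector_derivative e x * (U x s - 2*\<i>*k * R x s) + (\<alpha> * e x) * R x s) (at x within {0..})"
          by (rule has_vector_derivative_mult[OF e' dR[OF x that]])
        then show ?thesis by (simp add: \<alpha>_def algebra_simps)
      qed
      have "((\<lambda>x. integral (cbox 0 t) (\<lambda>s. e x * (E s * V x s))) has_vector_derivative
          integral (cbox 0 t) (\<lambda>s. e x * (E s * (Vx x s + \<alpha> * V x s)))) (at x within {0..})"
      proof (rule leibniz_rule_vector_derivative)
        fix x s :: real assume x: "x \<in> {0..}" and s: "s \<in> cbox 0 t"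
        have "((\<lambda>x. e x * (E s * V x s)) has_vector_derivative e x * (E s * Vx x s) + (\<alpha> * e x) * (E s * V x s)) (at x within {0..})"
          by (rule has_vector_derivative_mult[OF e' has_vector_derivative_mult_right[OF dV]]) (use x s in auto)
        then show "((\<lambda>x. e x * (E s * V x s)) has_vector_derivative e x * (E s * (Vx x s + \<alpha> * V x s))) (at x within {0..})"
          by (simp add: algebra_simps)
      next
        fix x :: real assume x: "x \<in> {0..}"
        have "continuous_on {0..t} (\<lambda>s. V x s)" by (rule qcont_t_Icc[OF qV]) (use x in auto)
        then show "(\<lambda>s. e x * (E s * V x s)) integrable_on cbox 0 t"
          unfolding cbox_interval
          by (intro integrable_continuous_real continuous_on_mult continuous_on_const Ec)
      next
        have e2: "continuous_on ({0..} \<times> cbox 0 t) (\<lambda>p. e (fst p))" and E2: "continuous_on ({0..} \<times> cbox 0 t) (\<lambda>p. E (snd p))"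
          unfolding e_def E_def by (intro continuous_intros)+
        have V2: "continuous_on ({0..} \<times> cbox 0 t) (\<lambda>p. V (fst p) (snd p))" "continuous_on ({0..} \<times> cbox 0 t) (\<lambda>p. Vx (fst p) (snd p))"
          by (rule continuous_on_subset[OF qcontD[OF qV]], auto, rule continuous_on_subset[OF qcontD[OF qVx]], auto)
        show "continuous_on ({0..} \<times> cbox 0 t) (\<lambda>(x, s). e x * (E s * (Vx x s + \<alpha> * V x s)))"
          unfolding case_prod_unfold
          by (intro continuous_on_mult continuous_on_add continuous_on_const e2 E2 V2)
      qed (use x in auto)
      then have d3: "((\<lambda>x. integral {0..t} (\<lambda>s. e x * (E s * V x s))) has_vector_derivative
          integral {0..t} (\<lambda>s. e x * (E s * (Vx x s + \<alpha> * V x s)))) (at x within {0..})"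
        by (simp only: cbox_interval)
      \<comment> \<open>By compatibility the integrand is the t-derivative of
        \<open>E s * U x s\<close>.\<close>
      have "((\<lambda>s. E s * (Vx x s + \<alpha> * V x s)) has_integral E t * U x t - E 0 * U x 0) {0..t}"
      proof (rule fundamental_theorem_of_calculus[OF t])
        fix s assume s: "s \<in> {0..t}"
        have "((\<lambda>s. E s * U x s) has_vector_derivative E s * Ut x s + (\<beta> * E s) * U x s) (at s within {0..})"
          by (rule has_vector_derivative_mult[OF E' dU[OF x]]) (use s in auto)
        moreover have "E s * Ut x s + (\<beta> * E s) * U x s = E s * (Vx x s + \<alpha> * V x s)"
        proof -
          have "E s * (Ut x s + 4*\<i>*k\<^sup>2 * U x s) = E s * (Vx x s + 2*\<i>*k * V x s)"
            by (rule arg_cong[OF compat[OF x]]) (use s in simp)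
          then show ?thesis by (simp only: \<alpha>_def \<beta>_def distrib_left mult_ac)
        qed
        ultimately have "((\<lambda>s. E s * U x s) has_vector_derivative E s * (Vx x s + \<alpha> * V x s)) (at s within {0..})"
          by (simp only:)
        then show "((\<lambda>s. E s * U x s) has_vector_derivative E s * (Vx x s + \<alpha> * V x s)) (at s within {0..t})"
          by (rule has_vector_derivative_within_subset) auto
      qed
      then have "integral {0..t} (\<lambda>s. e x * (E s * (Vx x s + \<alpha> * V x s))) = e x * (E t * U x t - U x 0)"
        by (simp add: integral_unique E_def)
      with d3 have d3': "((\<lambda>x. integral {0..t} (\<lambda>s. e x * (E s * V x s))) has_vector_derivative e x * (E t * U x t - U x 0)) (at x within {0..})"
        by (simp only:)
      have "(H has_vector_derivative E t * (e x * U x t) - e x * U x 0 - e x * (E t * U x t - U x 0)) (at x within {0..})"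
        unfolding H_def
        by (intro has_vector_derivative_diff has_vector_derivative_mult_right d1 d3' t order.refl)
      then show ?thesis by (simp add: algebra_simps)
    qed
    have Heq: "H x = e x * (E t * R x t - R x 0 - integral {0..t} (\<lambda>s. E s * V x s))" for x
    proof -
      have I: "integral {0..t} (\<lambda>s. e x * (E s * V x s)) = e x * integral {0..t} (\<lambda>s. E s * V x s)"
        by (rule integral_mult_right)
      show ?thesis unfolding H_def I by (simp only: right_diff_distrib mult.left_commute)
    qed
    define c where "c = H 0"
    have c: "H x = c" if x: "x \<in> {0..}" for x
    proof (rule has_vector_derivative_zero_constant[OF convex_real_interval(1) H'])
      fix c' assume *: "\<And>x. x \<in> {0..} \<Longrightarrow> H x = c'"
      show "H x = c" using *[OF x] *[of 0] by (simp add: c_def)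
    qed
    obtain B where B: "\<And>s X. 0 \<le> s \<Longrightarrow> s \<le> t \<Longrightarrow> 0 \<le> X \<Longrightarrow> integral {X..X+1} (\<lambda>x. cmod (V x s)) \<le> B"
      using loc[OF t] unfolding loc1_def by blast
    define C1 where "C1 = cmod (E t) * M + M"
    have "\<exists>C. \<forall>s\<in>{0..t}. cmod (E s) \<le> C"
      using compact_imp_bounded[OF compact_continuous_image[OF Ec compact_Icc, of 0 t]]
      unfolding bounded_iff by blast
    then obtain C2 where C2: "\<And>s. s \<in> {0..t} \<Longrightarrow> cmod (E s) \<le> C2" by blast
    have C20: "0 \<le> C2" by (rule order_trans[OF norm_ge_zero C2[of 0]]) (use t in simp)
    define \<phi> where "\<phi> = (\<lambda>x. integral {0..t} (\<lambda>s. cmod (V x s)))"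
    have Hb: "cmod c \<le> exp (- (2 * Im k * X)) * (C1 + C2 * \<phi> x)" if X: "0 \<le> X" and x: "x \<in> {X..X+1}" for X x
    proof -
      have x0: "0 \<le> x" using X x by simp
      have Vi: "continuous_on {0..t} (\<lambda>s. V x s)" by (rule qcont_t_Icc[OF qV x0 order.refl])
      have "c = e x * (E t * R x t - R x 0 - integral {0..t} (\<lambda>s. E s * V x s))"
        using c[of x] x0 by (simp only: Heq atLeast_iff)
      then have "cmod c = cmod (e x) * cmod (E t * R x t - R x 0 - integral {0..t} (\<lambda>s. E s * V x s))"
        by (simp only: norm_mult)
      also have "\<dots> \<le> exp (- (2 * Im k * X)) * (C1 + C2 * \<phi> x)"
      proof (rule mult_mono)
        show "cmod (e x) \<le> exp (- (2 * Im k * X))" unfolding ne using k x by simp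
        have 1: "cmod (E t * R x t) \<le> cmod (E t) * M"
          unfolding norm_mult by (rule mult_left_mono[OF M[OF x0 t] norm_ge_zero])
        have 2: "cmod (integral {0..t} (\<lambda>s. E s * V x s)) \<le> C2 * \<phi> x"
        proof -
          have "cmod (integral {0..t} (\<lambda>s. E s * V x s)) \<le> integral {0..t} (\<lambda>s. C2 * cmod (V x s))"
          proof (rule integral_norm_bound_integral)
            show "(\<lambda>s. E s * V x s) integrable_on {0..t}"
              by (intro integrable_continuous_real continuous_on_mult Ec Vi)
            show "(\<lambda>s. C2 * cmod (V x s)) integrable_on {0..t}"
              by (intro integrable_continuous_real continuous_on_mult continuous_on_const continuous_on_norm Vi)
            show "cmod (E s * V x s) \<le> C2 * cmod (V x s)" if "s \<in> {0..t}" for s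
              unfolding norm_mult by (rule mult_right_mono[OF C2[OF that] norm_ge_zero])
          qed
          then show ?thesis by (simp add: \<phi>_def)
        qed
        have "cmod (E t * R x t - R x 0 - integral {0..t} (\<lambda>s. E s * V x s))
           \<le> cmod (E t * R x t) + cmod (R x 0) + cmod (integral {0..t} (\<lambda>s. E s * V x s))"
          using norm_triangle_ineq4[of "E t * R x t - R x 0" "integral {0..t} (\<lambda>s. E s * V x s)"]
            norm_triangle_ineq4[of "E t * R x t" "R x 0"] by linarith
        then show "cmod (E t * R x t - R x 0 - integral {0..t} (\<lambda>s. E s * V x s)) \<le> C1 + C2 * \<phi> x"
          using 1 2 M[OF x0 order.refl] unfolding C1_def by linarith
      qed auto
      finally show ?thesis .
    qed
    have Vc: "continuous_on (cbox (X,0) (X+1,t)) (\<lambda>(x,s). cmod (V x s))" if "0 \<le> X" for X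
      unfolding case_prod_unfold
      by (rule continuous_on_norm, rule continuous_on_subset[OF qcontD[OF qV]])
         (use that in \<open>auto simp: cbox_Pair_eq\<close>)
    have \<phi>c: "continuous_on {X..X+1} \<phi>" if "0 \<le> X" for X
      using integral_continuous_on_param[OF Vc[OF that, unfolded cbox_Pair_eq]]
      by (simp only: \<phi>_def cbox_interval)
    have \<phi>B: "integral {X..X+1} \<phi> \<le> B * t" if X: "0 \<le> X" for X
    proof -
      have "integral {X..X+1} \<phi> = integral {0..t} (\<lambda>s. integral {X..X+1} (\<lambda>x. cmod (V x s)))"
        using integral_swap_continuous[OF Vc[OF X]] by (simp only: \<phi>_def cbox_interval)
      also have "\<dots> \<le> integral {0..t} (\<lambda>s::real. B)"
      proof (rule integral_le)
        have "continuous_on (cbox 0 t \<times> cbox X (X+1)) (\<lambda>(s,x). cmod (V x s))"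
          unfolding case_prod_unfold
          by (rule continuous_on_norm, rule qcont_compose[OF qV]) (use X in \<open>auto intro!: continuous_intros\<close>)
        from integral_continuous_on_param[OF this]
        show "(\<lambda>s. integral {X..X+1} (\<lambda>x. cmod (V x s))) integrable_on {0..t}"
          unfolding cbox_interval by (rule integrable_continuous_real)
      qed (use B X in auto)
      finally show ?thesis using t by (simp add: mult.commute)
    qed
    \<comment> \<open>Only integrals of V over unit windows are bounded, so the estimate for c is
      integrated over \<open>{X..X+1}\<close>; as c is constant and the window has length 1, the
      left side stays \<open>cmod c\<close>.\<close>
    have Hc: "cmod c \<le> exp (- (2 * Im k * X)) * (C1 + C2 * (B * t))" if X: "0 \<le> X" for X
    proof -
      have \<phi>i: "\<phi> integrable_on {X..X+1}" by (rule integrable_continuous_real[OF \<phi>c[OF X]])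
      have i2: "((\<lambda>x. exp (- (2 * Im k * X)) * (C1 + C2 * \<phi> x)) has_integral
         exp (- (2 * Im k * X)) * (C1 * 1 + C2 * integral {X..X+1} \<phi>)) {X..X+1}"
        using has_integral_const_real[of C1 X "X+1"]
        by (intro has_integral_mult_right has_integral_add integrable_integral \<phi>i) simp
      have i1: "((\<lambda>x. cmod c) has_integral cmod c) {X..X+1}"
        using has_integral_const_real[of "cmod c" X "X+1"] by simp
      have "cmod c \<le> exp (- (2 * Im k * X)) * (C1 * 1 + C2 * integral {X..X+1} \<phi>)"
        by (rule has_integral_le[OF i1 i2 Hb[OF X]])
      also have "\<dots> \<le> exp (- (2 * Im k * X)) * (C1 + C2 * (B * t))"
        using mult_left_mono[OF \<phi>B[OF X] C20] by (intro mult_left_mono) auto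
      finally show ?thesis .
    qed
    have "((\<lambda>X. exp (- (2 * Im k * X)) * (C1 + C2 * (B * t))) \<longlongrightarrow> 0 * (C1 + C2 * (B * t))) at_top"
    proof (rule tendsto_mult[OF _ tendsto_const])
      have "filterlim (\<lambda>X. 2 * Im k * X) at_top at_top"
        by (rule filterlim_tendsto_pos_mult_at_top[OF tendsto_const _ filterlim_ident]) (use k in simp)
      then show "((\<lambda>X. exp (- (2 * Im k * X))) \<longlongrightarrow> 0) at_top"
        by (intro filterlim_compose[OF exp_at_bot] filterlim_compose[OF filterlim_uminus_at_bot_at_top])
    qed
    then have "cmod c \<le> 0 * (C1 + C2 * (B * t))"
      by (rule tendsto_lowerbound[OF _ eventually_mono[OF eventually_ge_at_top[of 0] Hc]]) auto
    then have "c = 0" by simp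
    then have "H x = 0" using c[of x] x0 by simp
    moreover have "e x \<noteq> 0" by (simp add: e_def)
    ultimately have "E t * R x t - R x 0 - integral {0..t} (\<lambda>s. E s * V x s) = 0"
      by (simp only: Heq mult_eq_0_iff simp_thms)
    then show ?thesis by (simp only: diff_diff_eq right_minus_eq)
  qed
  have EE: "exp (- \<beta> * of_real t) * E t = 1" for t
    by (simp add: E_def exp_minus)
  \<comment> \<open>No regularity of R in t was assumed. Joint continuity and the derivative in t
    are both read off from this representation.\<close>
  have rep: "R x t = exp (- \<beta> * of_real t) * (R x 0 + integral {0..t} (\<lambda>s. E s * V x s))"
    if "0 \<le> x" "0 \<le> t" for x t
    unfolding main[OF that, symmetric] mult.assoc[symmetric] EE by simp
  have EV: "qcont (\<lambda>x t. E t * V x t)" by (rule qcont_mult[OF qcont_of_t[OF Ec] qV])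
  have R0: "continuous_on {0..} (\<lambda>x. R x 0)"
    by (rule continuous_on_vector_derivative[OF dR]) auto
  have "qcont (\<lambda>x t. exp (- \<beta> * of_real t) * (R x 0 + integral {0..t} (\<lambda>s. E s * V x s)))"
    by (intro qcont_mult qcont_add qcont_of_t[OF continuous_exp_linear] qcont_of_x[OF R0] qcont_integral_t[OF EV])
  then show "qcont R"
    unfolding qcont_def case_prod_unfold
    by (rule continuous_on_eq, intro rep[symmetric]) auto
  show "((\<lambda>t. R x t) has_vector_derivative V x t - 4*\<i>*k\<^sup>2 * R x t) (at t within {0..})"
    if x: "0 \<le> x" and t: "0 \<le> t" for x t
  proof -
    have D: "((\<lambda>t. exp (- \<beta> * of_real t) * (R x 0 + integral {0..t} (\<lambda>s. E s * V x s))) has_vector_derivative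
       exp (- \<beta> * of_real t) * (0 + E t * V x t) + (- \<beta> * exp (- \<beta> * of_real t)) * (R x 0 + integral {0..t} (\<lambda>s. E s * V x s)))
       (at t within {0..})"
      by (intro has_vector_derivative_mult has_vector_derivative_add has_vector_derivative_const
          exp_linear_has_vector_derivative has_vector_derivative_integral_halfline[OF qcont_t[OF EV x] t])
    have "exp (- \<beta> * of_real t) * (0 + E t * V x t) + (- \<beta> * exp (- \<beta> * of_real t)) * (R x 0 + integral {0..t} (\<lambda>s. E s * V x s))
       = (exp (- \<beta> * of_real t) * E t) * V x t - \<beta> * (exp (- \<beta> * of_real t) * (R x 0 + integral {0..t} (\<lambda>s. E s * V x s)))"
      by (simp only: add_0_left mult.assoc mult_minus_left) simp
    also have "\<dots> = V x t - 4*\<i>*k\<^sup>2 * R x t"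
      unfolding EE rep[OF x t, symmetric] by (simp add: \<beta>_def)
    finally have D': "((\<lambda>t. exp (- \<beta> * of_real t) * (R x 0 + integral {0..t} (\<lambda>s. E s * V x s))) has_vector_derivative
       V x t - 4*\<i>*k\<^sup>2 * R x t) (at t within {0..})" using D by (simp only:)
    show ?thesis
    proof (rule has_vector_derivative_transform[OF _ _ D'])
      show "R x s = exp (- \<beta> * of_real s) * (R x 0 + integral {0..s} (\<lambda>s. E s * V x s))" if "s \<in> {0..}" for s
        by (rule rep[OF x]) (use that in simp)
    qed (use t in simp)
  qed
qed

section \<open>The bounded solution of the Riccati hierarchy\<close>

context nls_hierarchy
begin

text \<open>The Riccati equation in x is r_x = q - 2ikr - lambda conj(q) r^2. \<open>ricU\<close> is
  its part of order N without the linear term -2ik r_N and so involves r only in orders below N.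
  \<open>ricV\<close> plays the same role for the equation in t, whose linear term is -4ik^2
  r_N.\<close>

definition ricU where
  "ricU r N x t = Q N 0 0 x t - of_real lam *
     coef3 (\<lambda>i. cnj (Q i 0 0 x t)) (\<lambda>j. r j x t) (\<lambda>p. r p x t) N"

definition ricV where
  "ricV k r N x t = 2 * k * Q N 0 0 x t + \<i> * Q N 1 0 x t
     - 2 * of_real lam * k * coef3 (\<lambda>i. cnj (Q i 0 0 x t)) (\<lambda>j. r j x t) (\<lambda>p. r p x t) N
     + \<i> * of_real lam * coef3 (\<lambda>i. cnj (Q i 1 0 x t)) (\<lambda>j. r j x t) (\<lambda>p. r p x t) N
     - 2 * \<i> * of_real lam * coef3 (\<lambda>i. cnj (Q i 0 0 x t)) (\<lambda>j. Q j 0 0 x t) (\<lambda>p. r p x t) N"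

text \<open>Integrating from infinity singles out the solution bounded in x; this is
  \<open>tail_integral\<close> with \<open>\<kappa>\<close> equal to 2ik.\<close>

definition ric where
  "ric k = rser (\<lambda>r N x t. - integral {x..} (\<lambda>y. exp (2 * \<i> * k * of_real (y - x)) * ricU r N y t))"

lemma ricU_cong: "(\<And>j. j < N \<Longrightarrow> r j = r' j) \<Longrightarrow> ricU r N = ricU r' N"
  by (intro ext) (auto simp: ricU_def intro!: coef3_cong)

lemma ric_unfold:
  "ric k N x t = - integral {x..} (\<lambda>y. exp (2 * \<i> * k * of_real (y - x)) * ricU (ric k) N y t)"
proof -
  have "ric k N = (\<lambda>x t. - integral {x..} (\<lambda>y. exp (2 * \<i> * k * of_real (y - x)) * ricU (ric k) N y t))"
    unfolding ric_def
  proof (rule rser_unfold)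
    fix X X' :: "nat \<Rightarrow> real \<Rightarrow> real \<Rightarrow> complex" assume "\<And>j. j < N \<Longrightarrow> X j = X' j"
    then have "ricU X N = ricU X' N" by (rule ricU_cong)
    then show "(\<lambda>x t. - integral {x..} (\<lambda>y. exp (2 * \<i> * k * of_real (y - x)) * ricU X N y t)) =
      (\<lambda>x t. - integral {x..} (\<lambda>y. exp (2 * \<i> * k * of_real (y - x)) * ricU X' N y t))"
      by (simp only:)
  qed
  then show ?thesis by (rule fun_cong[THEN fun_cong])
qed

lemma Q_L1:
  "\<exists>m. \<forall>i t. 1 \<le> i \<longrightarrow> 0 \<le> t \<longrightarrow> (\<lambda>x. cmod (Q i 0 0 x t)) integrable_on {0..} \<and>
     integral {0..} (\<lambda>x. cmod (Q i 0 0 x t)) \<le> m i"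
proof -
  have "\<exists>M. 1 \<le> i \<longrightarrow> (\<forall>t. 0 \<le> t \<longrightarrow> (\<lambda>x. cmod (Q i 0 0 x t)) integrable_on {0..} \<and>
     integral {0..} (\<lambda>x. cmod (Q i 0 0 x t)) \<le> M)" for i
  proof (cases "1 \<le> i")
    case True
    from L1[OF True] obtain M where M: "\<forall>t\<ge>0. set_integrable lborel {0..} (\<lambda>x. Q i 0 0 x t) \<and>
               (LINT x:{0..}|lborel. norm (Q i 0 0 x t)) \<le> M" by (rule exE)
    have "(\<lambda>x. cmod (Q i 0 0 x t)) integrable_on {0..} \<and> integral {0..} (\<lambda>x. cmod (Q i 0 0 x t)) \<le> M"
      if "0 \<le> t" for t
    proof -
      have "set_integrable lborel {0..} (\<lambda>x. norm (Q i 0 0 x t))"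
        by (rule set_integrable_norm) (use M that in blast)
      note e = set_borel_integral_eq_integral[OF this]
      have "(LINT x:{0..}|lborel. norm (Q i 0 0 x t)) \<le> M" using M that by blast
      then show ?thesis using e(1) unfolding e(2) by blast
    qed
    then show ?thesis by blast
  qed simp
  then have "\<forall>i. \<exists>M. 1 \<le> i \<longrightarrow> (\<forall>t. 0 \<le> t \<longrightarrow> (\<lambda>x. cmod (Q i 0 0 x t)) integrable_on {0..} \<and>
     integral {0..} (\<lambda>x. cmod (Q i 0 0 x t)) \<le> M)" ..
  from choice[OF this] show ?thesis by blast
qed

text \<open>Each product in the cubic term has exactly one factor from q, integrable in x, and two
  factors r of lower order, bounded by C.\<close>

lemma ricU_L1:
  assumes N: "1 \<le> N" and t: "0 \<le> t" and C: "0 \<le> C"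
    and rc: "\<And>j. 1 \<le> j \<Longrightarrow> j < N \<Longrightarrow> continuous_on {0..} (\<lambda>x. r j x t)"
    and rb: "\<And>j x. 1 \<le> j \<Longrightarrow> j < N \<Longrightarrow> 0 \<le> x \<Longrightarrow> cmod (r j x t) \<le> C"
    and m: "\<And>i. 1 \<le> i \<Longrightarrow> (\<lambda>x. cmod (Q i 0 0 x t)) integrable_on {0..}"
      "\<And>i. 1 \<le> i \<Longrightarrow> integral {0..} (\<lambda>x. cmod (Q i 0 0 x t)) \<le> m i"
  shows "continuous_on {0..} (\<lambda>x. ricU r N x t)"
    and "(\<lambda>x. cmod (ricU r N x t)) integrable_on {0..}"
    and "integral {0..} (\<lambda>x. cmod (ricU r N x t)) \<le> m N + \<bar>lam\<bar> * (\<Sum>s\<in>idx3 N. m (fst s) * (C * C))"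
proof -
  have qc: "continuous_on {0..} (\<lambda>x. Q i 0 0 x t)" if "1 \<le> i" for i
    by (rule qcont_x[OF Q_qcont[OF that] t])
  show c: "continuous_on {0..} (\<lambda>x. ricU r N x t)"
    unfolding ricU_def
    by (intro continuous_on_diff continuous_on_mult continuous_on_const qc N continuous_on_coef3 continuous_on_cnj rc)
  let ?I = "\<lambda>i. integral {0..} (\<lambda>x. cmod (Q i 0 0 x t))"
  define W where "W = (\<lambda>x. cmod (Q N 0 0 x t) + \<bar>lam\<bar> * (\<Sum>s\<in>idx3 N. cmod (Q (fst s) 0 0 x t) * (C * C)))"
  have W: "(W has_integral ?I N + \<bar>lam\<bar> * (\<Sum>s\<in>idx3 N. ?I (fst s) * (C * C))) {0..}"
    unfolding W_def
    by (intro has_integral_add has_integral_mult_right has_integral_sum finite_idx3 has_integral_mult_left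
        integrable_integral m(1) N) (auto dest: idx3D)
  have le: "cmod (ricU r N x t) \<le> W x" if x: "0 \<le> x" for x
  proof -
    have "cmod (coef3 (\<lambda>i. cnj (Q i 0 0 x t)) (\<lambda>j. r j x t) (\<lambda>p. r p x t) N)
      \<le> (\<Sum>s\<in>idx3 N. cmod (Q (fst s) 0 0 x t) * (C * C))"
      unfolding coef3_idx3
    proof (rule sum_norm_le)
      fix s assume s: "s \<in> idx3 N"
      obtain i j p where sp: "s = (i, j, p)" by (cases s)
      have jp: "1 \<le> j" "j < N" "1 \<le> p" "p < N" using idx3D s sp by auto
      have "cmod (cnj (Q i 0 0 x t) * r j x t * r p x t) = cmod (Q i 0 0 x t) * (cmod (r j x t) * cmod (r p x t))"
        by (simp add: norm_mult)
      also have "\<dots> \<le> cmod (Q i 0 0 x t) * (C * C)"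
        by (intro mult_left_mono mult_mono rb jp x C norm_ge_zero)
      finally show "cmod (case s of (i, j, p) \<Rightarrow> cnj (Q i 0 0 x t) * r j x t * r p x t) \<le> cmod (Q (fst s) 0 0 x t) * (C * C)"
        by (simp add: sp)
    qed
    then have "\<bar>lam\<bar> * cmod (coef3 (\<lambda>i. cnj (Q i 0 0 x t)) (\<lambda>j. r j x t) (\<lambda>p. r p x t) N)
      \<le> \<bar>lam\<bar> * (\<Sum>s\<in>idx3 N. cmod (Q (fst s) 0 0 x t) * (C * C))" by (rule mult_left_mono) simp
    moreover have "cmod (ricU r N x t) \<le> cmod (Q N 0 0 x t)
       + \<bar>lam\<bar> * cmod (coef3 (\<lambda>i. cnj (Q i 0 0 x t)) (\<lambda>j. r j x t) (\<lambda>p. r p x t) N)"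
      unfolding ricU_def by (rule order_trans[OF norm_triangle_ineq4]) (simp add: norm_mult)
    ultimately show ?thesis unfolding W_def by linarith
  qed
  have Wi: "W integrable_on {0..}" using W by (rule has_integral_integrable)
  show i: "(\<lambda>x. cmod (ricU r N x t)) integrable_on {0..}"
    using absolutely_integrable_dominated[OF c Wi le] by (simp add: absolutely_integrable_on_def)
  have "integral {0..} (\<lambda>x. cmod (ricU r N x t)) \<le> ?I N + \<bar>lam\<bar> * (\<Sum>s\<in>idx3 N. ?I (fst s) * (C * C))"
    by (rule has_integral_le[OF integrable_integral[OF i] W]) (use le in auto)
  also have "\<dots> \<le> m N + \<bar>lam\<bar> * (\<Sum>s\<in>idx3 N. m (fst s) * (C * C))"
    by (intro add_mono mult_left_mono sum_mono mult_right_mono m(2) N mult_nonneg_nonneg C) (auto dest: idx3D)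
  finally show "integral {0..} (\<lambda>x. cmod (ricU r N x t)) \<le> m N + \<bar>lam\<bar> * (\<Sum>s\<in>idx3 N. m (fst s) * (C * C))" .
qed

text \<open>Induction on N with \<open>tail_integral\<close>. The constant M is chosen before k and
  t: this uniformity over the upper half plane is what survives the passage to the boundary of the
  quadrant and to k_1(n).\<close>

lemma ric_bound:
  "1 \<le> N \<Longrightarrow> \<exists>M. \<forall>k t. 0 < Im k \<longrightarrow> 0 \<le> t \<longrightarrow>
     (\<forall>x\<ge>0. cmod (ric k N x t) \<le> M \<and>
       ((\<lambda>x. ric k N x t) has_vector_derivative ricU (ric k) N x t - 2*\<i>*k * ric k N x t) (at x within {0..}))"
proof (induction N rule: less_induct)
  case (less N)
  note N = less.prems
  obtain m where m: "\<And>i t. 1 \<le> i \<Longrightarrow> 0 \<le> t \<Longrightarrow> (\<lambda>x. cmod (Q i 0 0 x t)) integrable_on {0..}"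
     "\<And>i t. 1 \<le> i \<Longrightarrow> 0 \<le> t \<Longrightarrow> integral {0..} (\<lambda>x. cmod (Q i 0 0 x t)) \<le> m i"
    using Q_L1 by blast
  have "\<forall>j. \<exists>M. 1 \<le> j \<and> j < N \<longrightarrow> (\<forall>k t. 0 < Im k \<longrightarrow> 0 \<le> t \<longrightarrow>
     (\<forall>x\<ge>0. cmod (ric k j x t) \<le> M \<and>
       ((\<lambda>x. ric k j x t) has_vector_derivative ricU (ric k) j x t - 2*\<i>*k * ric k j x t) (at x within {0..})))"
    using less.IH by blast
  from choice[OF this] obtain B where B0: "\<forall>j. 1 \<le> j \<and> j < N \<longrightarrow> (\<forall>k t. 0 < Im k \<longrightarrow> 0 \<le> t \<longrightarrow>
     (\<forall>x\<ge>0. cmod (ric k j x t) \<le> B j \<and>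
       ((\<lambda>x. ric k j x t) has_vector_derivative ricU (ric k) j x t - 2*\<i>*k * ric k j x t) (at x within {0..})))"
    by (rule exE)
  have B: "\<And>j k t x. 1 \<le> j \<Longrightarrow> j < N \<Longrightarrow> 0 < Im k \<Longrightarrow> 0 \<le> t \<Longrightarrow> 0 \<le> x \<Longrightarrow>
     cmod (ric k j x t) \<le> B j"
    using B0 by blast
  have D: "\<And>j k t x. 1 \<le> j \<Longrightarrow> j < N \<Longrightarrow> 0 < Im k \<Longrightarrow> 0 \<le> t \<Longrightarrow> 0 \<le> x \<Longrightarrow>
      ((\<lambda>x. ric k j x t) has_vector_derivative ricU (ric k) j x t - 2*\<i>*k * ric k j x t) (at x within {0..})"
    using B0 by blast
  define C where "C = (\<Sum>j<N. \<bar>B j\<bar>)"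
  have C: "0 \<le> C" unfolding C_def by (rule sum_nonneg) simp
  have BC: "B j \<le> C" if "j < N" for j
  proof -
    have "\<bar>B j\<bar> \<le> C" unfolding C_def by (rule member_le_sum) (use that in auto)
    then show ?thesis by simp
  qed
  have "cmod (ric k N x t) \<le> m N + \<bar>lam\<bar> * (\<Sum>s\<in>idx3 N. m (fst s) * (C * C)) \<and>
     ((\<lambda>x. ric k N x t) has_vector_derivative ricU (ric k) N x t - 2*\<i>*k * ric k N x t) (at x within {0..})"
    if k: "0 < Im k" and t: "0 \<le> t" and x: "0 \<le> x" for k t x
  proof -
    have rc: "continuous_on {0..} (\<lambda>x. ric k j x t)" if "1 \<le> j" "j < N" for j
      by (rule continuous_on_vector_derivative[OF D[OF that k t]]) simp
    have rb: "cmod (ric k j x t) \<le> C" if "1 \<le> j" "j < N" "0 \<le> x" for j x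
      by (rule order_trans[OF B[OF that(1,2) k t that(3)] BC[OF that(2)]])
    note u = ricU_L1[where r="ric k" and m=m, OF N t C rc rb m(1)[OF _ t] m(2)[OF _ t]]
    have "Re (2 * \<i> * k) \<le> 0" using k by simp
    note T = tail_integral[where g="\<lambda>x. ric k N x t" and f="\<lambda>x. ricU (ric k) N x t", OF u(1,2) this ric_unfold x]
    show ?thesis using order_trans[OF T(1) u(3)] T(2) by blast
  qed
  then show ?case by blast
qed

lemma pde_t:
  assumes "1 \<le> n" "0 \<le> x" "0 \<le> t"
  shows "Q n 0 1 x t = \<i> * Q n 2 0 x t - 2 * \<i> * of_real lam *
     coef3 (\<lambda>j. Q j 0 0 x t) (\<lambda>j. cnj (Q j 0 0 x t)) (\<lambda>j. Q j 0 0 x t) n"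
  using schroD(4)[OF schro_Q(1)[OF assms(1)] assms(2,3)] by (simp add: cub_def)

lemma loc1_ricV:
  assumes N: "1 \<le> N" and T: "0 \<le> T" and r: "\<And>j. 1 \<le> j \<Longrightarrow> j < N \<Longrightarrow> supb T (r j)"
  shows "loc1 T (ricV k r N)"
proof -
  note h = H1_bounds[OF T]
  have q: "supb T (Q i 0 0)" "l2b T (Q i 1 0)" if "1 \<le> i" for i using h[OF that] by auto
  have c1: "loc1 T (\<lambda>x t. coef3 (\<lambda>i. cnj (Q i 0 0 x t)) (\<lambda>j. r j x t) (\<lambda>p. r p x t) N)"
    by (rule loc1_coef3, rule loc1_supb, intro supb_mult supb_cnj q r)
  have c2: "loc1 T (\<lambda>x t. coef3 (\<lambda>i. cnj (Q i 1 0 x t)) (\<lambda>j. r j x t) (\<lambda>p. r p x t) N)"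
    by (rule loc1_coef3, rule loc1_l2b, rule l2b_mult3(3), intro r, assumption+, intro r, assumption+,
        intro l2b_cnj q)
  have c3: "loc1 T (\<lambda>x t. coef3 (\<lambda>i. cnj (Q i 0 0 x t)) (\<lambda>j. Q j 0 0 x t) (\<lambda>p. r p x t) N)"
    by (rule loc1_coef3, rule loc1_supb, intro supb_mult supb_cnj q r)
  have "ricV k r N = (\<lambda>x t. 2 * k * Q N 0 0 x t + \<i> * Q N 1 0 x t
     + (- 2 * of_real lam * k) * coef3 (\<lambda>i. cnj (Q i 0 0 x t)) (\<lambda>j. r j x t) (\<lambda>p. r p x t) N
     + \<i> * of_real lam * coef3 (\<lambda>i. cnj (Q i 1 0 x t)) (\<lambda>j. r j x t) (\<lambda>p. r p x t) N
     + (- 2 * \<i> * of_real lam) * coef3 (\<lambda>i. cnj (Q i 0 0 x t)) (\<lambda>j. Q j 0 0 x t) (\<lambda>p. r p x t) N)"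
    by (intro ext) (simp add: ricV_def)
  then show ?thesis
    by (simp only:) (intro loc1_add loc1_cmult c1 c2 c3 loc1_supb[OF q(1)] loc1_l2b[OF q(2)] N)
qed

text \<open>Differentiating the defining integral under the integral sign would require
  integrability of q_t in x, which is not known. Instead \<open>lax_transport\<close> is applied
  order by order; the t-derivative of U at order N uses those of r at lower orders, given by the
  induction.\<close>

lemma ric_dt:
  assumes k: "0 < Im k"
  shows "1 \<le> N \<Longrightarrow> qcont (ric k N) \<and> (\<forall>x t. 0 \<le> x \<longrightarrow> 0 \<le> t \<longrightarrow>
     ((\<lambda>t. ric k N x t) has_vector_derivative ricV k (ric k) N x t - 4*\<i>*k\<^sup>2 * ric k N x t) (at t within {0..}))"
proof (induction N rule: less_induct)
  case (less N)
  note N = less.prems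
  let ?R = "ric k" and ?L = "of_real lam :: complex"
  have qR: "qcont (?R j)" if "1 \<le> j" "j < N" for j using less.IH that by blast
  have dtR: "((\<lambda>t. ?R j x t) has_vector_derivative ricV k ?R j x t - 4*\<i>*k\<^sup>2 * ?R j x t) (at t within {0..})"
    if "1 \<le> j" "j < N" "0 \<le> x" "0 \<le> t" for j x t using less.IH that by blast
  obtain M where M: "\<And>j x t. 1 \<le> j \<Longrightarrow> 0 \<le> x \<Longrightarrow> 0 \<le> t \<Longrightarrow> cmod (?R j x t) \<le> M j"
  proof -
    have "\<forall>j. \<exists>M. 1 \<le> j \<longrightarrow> (\<forall>x t. 0 \<le> x \<longrightarrow> 0 \<le> t \<longrightarrow> cmod (?R j x t) \<le> M)"
    proof
      fix j
      show "\<exists>M. 1 \<le> j \<longrightarrow> (\<forall>x t. 0 \<le> x \<longrightarrow> 0 \<le> t \<longrightarrow> cmod (?R j x t) \<le> M)"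
      proof (cases "1 \<le> j")
        case True
        from ric_bound[OF True] obtain M where "\<forall>k t. 0 < Im k \<longrightarrow> 0 \<le> t \<longrightarrow>
          (\<forall>x\<ge>0. cmod (ric k j x t) \<le> M \<and>
            ((\<lambda>x. ric k j x t) has_vector_derivative ricU (ric k) j x t - 2*\<i>*k * ric k j x t) (at x within {0..}))"
          by (rule exE)
        then show ?thesis using k by blast
      qed simp
    qed
    from choice[OF this] obtain M where "\<forall>j. 1 \<le> j \<longrightarrow> (\<forall>x t. 0 \<le> x \<longrightarrow> 0 \<le> t \<longrightarrow> cmod (?R j x t) \<le> M j)"
      by (rule exE)
    then show ?thesis by (intro that[of M]) blast
  qed
  have dxR: "((\<lambda>x. ?R j x t) has_vector_derivative ricU ?R j x t - 2*\<i>*k * ?R j x t) (at x within {0..})"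
    if "1 \<le> j" "0 \<le> x" "0 \<le> t" for j x t using ric_bound[OF that(1)] k that by blast
  define Rx where "Rx = (\<lambda>j x t. ricU ?R j x t - 2*\<i>*k * ?R j x t)"
  define Rt where "Rt = (\<lambda>j x t. ricV k ?R j x t - 4*\<i>*k\<^sup>2 * ?R j x t)"
  have qU: "qcont (ricU ?R n)" if "1 \<le> n" "n \<le> N" for n
    unfolding ricU_def
    by (intro qcont_diff qcont_mult[OF qcont_const] qcont_coef3 qcont_cnj Q_qcont qR that) (use that in auto)
  have qRx: "qcont (Rx j)" if "1 \<le> j" "j < N" for j
    unfolding Rx_def by (intro qcont_diff qcont_mult[OF qcont_const] qU qR that) (use that in auto)
  have qV: "qcont (ricV k ?R N)"
    unfolding ricV_def
    by (intro qcont_add qcont_diff qcont_mult[OF qcont_const] qcont_coef3 qcont_cnj Q_qcont qR N) auto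
  define Ut where "Ut = (\<lambda>x t. Q N 0 1 x t - ?L *
     (coef3 (\<lambda>i. cnj (Q i 0 1 x t)) (\<lambda>j. ?R j x t) (\<lambda>p. ?R p x t) N
    + coef3 (\<lambda>i. cnj (Q i 0 0 x t)) (\<lambda>j. Rt j x t) (\<lambda>p. ?R p x t) N
    + coef3 (\<lambda>i. cnj (Q i 0 0 x t)) (\<lambda>j. ?R j x t) (\<lambda>p. Rt p x t) N))"
  define Vx where "Vx = (\<lambda>x t. 2*k * Q N 1 0 x t + \<i> * Q N 2 0 x t
     - 2*?L*k * (coef3 (\<lambda>i. cnj (Q i 1 0 x t)) (\<lambda>j. ?R j x t) (\<lambda>p. ?R p x t) N
        + coef3 (\<lambda>i. cnj (Q i 0 0 x t)) (\<lambda>j. Rx j x t) (\<lambda>p. ?R p x t) N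
        + coef3 (\<lambda>i. cnj (Q i 0 0 x t)) (\<lambda>j. ?R j x t) (\<lambda>p. Rx p x t) N)
     + \<i>*?L * (coef3 (\<lambda>i. cnj (Q i 2 0 x t)) (\<lambda>j. ?R j x t) (\<lambda>p. ?R p x t) N
        + coef3 (\<lambda>i. cnj (Q i 1 0 x t)) (\<lambda>j. Rx j x t) (\<lambda>p. ?R p x t) N
        + coef3 (\<lambda>i. cnj (Q i 1 0 x t)) (\<lambda>j. ?R j x t) (\<lambda>p. Rx p x t) N)
     - 2*\<i>*?L * (coef3 (\<lambda>i. cnj (Q i 1 0 x t)) (\<lambda>j. Q j 0 0 x t) (\<lambda>p. ?R p x t) N
        + coef3 (\<lambda>i. cnj (Q i 0 0 x t)) (\<lambda>j. Q j 1 0 x t) (\<lambda>p. ?R p x t) N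
        + coef3 (\<lambda>i. cnj (Q i 0 0 x t)) (\<lambda>j. Q j 0 0 x t) (\<lambda>p. Rx p x t) N))"
  have qVx: "qcont Vx"
    unfolding Vx_def
    by (intro qcont_add qcont_diff qcont_mult[OF qcont_const] qcont_coef3 qcont_cnj Q_qcont qR qRx N) auto
  have Qdx1: "((\<lambda>y. Q n 0 0 y t) has_vector_derivative Q n 1 0 x t) (at x within {0..})"
    "((\<lambda>y. Q n 1 0 y t) has_vector_derivative Q n 2 0 x t) (at x within {0..})"
    "((\<lambda>s. Q n 0 0 x s) has_vector_derivative Q n 0 1 x t) (at t within {0..})"
    if "1 \<le> n" "0 \<le> x" "0 \<le> t" for n x t
    using schroD(1-3)[OF schro_Q(1)[OF that(1)] that(2,3)] by blast+
  have dU: "((\<lambda>t. ricU ?R N x t) has_vector_derivative Ut x t) (at t within {0..})" if "0 \<le> x" "0 \<le> t" for x t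
    unfolding ricU_def Ut_def Rt_def
    by (intro has_vector_derivative_diff has_vector_derivative_mult_right coef3_has_vector_derivative
        has_vector_derivative_cnj' Qdx1 dtR that N)
  have dRx: "((\<lambda>x. ?R j x t) has_vector_derivative Rx j x t) (at x within {0..})"
    if "1 \<le> j" "0 \<le> x" "0 \<le> t" for j x t unfolding Rx_def by (rule dxR[OF that])
  have dV: "((\<lambda>x. ricV k ?R N x t) has_vector_derivative Vx x t) (at x within {0..})" if "0 \<le> x" "0 \<le> t" for x t
    unfolding ricV_def Vx_def
    by (intro has_vector_derivative_add has_vector_derivative_diff has_vector_derivative_mult_right
        coef3_has_vector_derivative has_vector_derivative_cnj' Qdx1 dRx that N)
  have compat: "Ut x t + 4*\<i>*k\<^sup>2 * ricU ?R N x t = Vx x t + 2*\<i>*k * ricV k ?R N x t"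
    if x: "0 \<le> x" and t: "0 \<le> t" for x t
    unfolding Ut_def Vx_def
    by (rule riccati_compat[where U="\<lambda>n. ricU ?R n x t" and V="\<lambda>n. ricV k ?R n x t"
          and qxx="\<lambda>n. Q n 2 0 x t" and qbxx="\<lambda>n. cnj (Q n 2 0 x t)" and qx="\<lambda>n. Q n 1 0 x t"])
       (use pde_t[OF _ x t] N in \<open>auto simp: ricU_def ricV_def Rx_def Rt_def cnj_coef3\<close>)
  have sup: "supb T (?R j)" if "0 \<le> T" "1 \<le> j" "j < N" for T j
    unfolding supb_def using qR[OF that(2,3)] M[OF that(2)] by blast
  have loc: "loc1 T (ricV k ?R N)" if T: "0 \<le> T" for T
    by (rule loc1_ricV[OF N T sup[OF T]])
  note lt = lax_transport[OF k qU[OF N order.refl] qV qVx dxR[OF N] dU dV compat M[OF N] loc]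
  show ?case using lt by blast
qed

end

section \<open>Periodic solutions of the Riccati equation in time\<close>

text \<open>For periodic p the equation gives that \<open>exp (\<kappa> * of_real t) * p t\<close>
  has derivative \<open>exp (\<kappa> * of_real t) * F t\<close>. Integrating over one period from t
  and solving for p(t) yields the formula; the condition on the exponential is that its denominator
  is not 0.\<close>

lemma periodic_ode_solution:
  fixes F p :: "real \<Rightarrow> complex"
  assumes \<tau>: "0 < \<tau>" and c: "continuous_on {0..} F" and per: "\<And>t. 0 \<le> t \<Longrightarrow> F (t + \<tau>) = F t"
    and E: "exp (\<kappa> * of_real \<tau>) \<noteq> 1"
    and p: "\<And>t. p t = integral {0..\<tau>} (\<lambda>s. exp (\<kappa> * of_real s) * F (t + s)) / (exp (\<kappa> * of_real \<tau>) - 1)"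
    and t: "0 \<le> t"
  shows "p (t + \<tau>) = p t" and "(p has_vector_derivative F t - \<kappa> * p t) (at t within {0..})"
proof -
  let ?E = "exp (\<kappa> * of_real \<tau>)"
  have "integral {0..\<tau>} (\<lambda>s. exp (\<kappa> * of_real s) * F (t + \<tau> + s)) = integral {0..\<tau>} (\<lambda>s. exp (\<kappa> * of_real s) * F (t + s))"
  proof (rule integral_cong)
    fix s assume "s \<in> {0..\<tau>}"
    then have "F ((t + s) + \<tau>) = F (t + s)" using t by (intro per) simp
    then show "exp (\<kappa> * of_real s) * F (t + \<tau> + s) = exp (\<kappa> * of_real s) * F (t + s)" by (simp only: add_ac)
  qed
  then show "p (t + \<tau>) = p t" unfolding p by (simp only:)
  define h where "h = (\<lambda>u. exp (\<kappa> * of_real u) * F u)"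
  define G where "G = (\<lambda>x. integral {0..x} h)"
  have hc: "continuous_on {0..} h" unfolding h_def by (intro continuous_on_mult c continuous_exp_linear)
  have hci: "continuous_on {a..b} h" if "0 \<le> a" for a b
    by (rule continuous_on_subset[OF hc]) (use that in auto)
  have G': "(G has_vector_derivative h x) (at x within {0..})" if "0 \<le> x" for x
    unfolding G_def by (rule has_vector_derivative_integral_halfline[OF hc that])
  have rep: "p t = exp (- \<kappa> * of_real t) * (G (t + \<tau>) - G t) / (?E - 1)" if "t \<in> {0..}" for t
  proof -
    have t: "0 \<le> t" using that by simp
    have "integral {0..\<tau>} (\<lambda>s. exp (\<kappa> * of_real s) * F (t + s)) = integral {0..\<tau>} (\<lambda>s. exp (- \<kappa> * of_real t) * (h \<circ> (\<lambda>s. s + t)) s)"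
    proof (rule integral_cong)
      fix s :: real
      have "exp (\<kappa> * of_real s) = exp (- \<kappa> * of_real t) * exp (\<kappa> * of_real (s + t))"
        unfolding exp_add[symmetric] by (rule arg_cong[where f=exp]) (simp add: distrib_left)
      then show "exp (\<kappa> * of_real s) * F (t + s) = exp (- \<kappa> * of_real t) * (h \<circ> (\<lambda>s. s + t)) s"
        by (simp add: h_def add.commute)
    qed
    also have "\<dots> = exp (- \<kappa> * of_real t) * integral {0..\<tau>} (h \<circ> (\<lambda>s. s + t))" by (rule integral_mult_right)
    also have "integral {0..\<tau>} (h \<circ> (\<lambda>s. s + t)) = integral {0+t..\<tau>+t} h"
      by (rule integral_shift[OF hci]) (use t in simp)
    also have "\<dots> = G (t + \<tau>) - G t"
    proof -
      have "integral {0..t} h + integral {t..t+\<tau>} h = integral {0..t+\<tau>} h"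
        by (rule Henstock_Kurzweil_Integration.integral_combine)
           (use t \<tau> in \<open>auto intro!: integrable_continuous_real hci\<close>)
      then show ?thesis by (simp add: G_def algebra_simps)
    qed
    finally show ?thesis unfolding p by (simp only:)
  qed
  have sh: "((\<lambda>t. G (t + \<tau>)) has_vector_derivative h (t + \<tau>)) (at t within {0..})"
  proof -
    have 1: "((\<lambda>t. t + \<tau>) has_vector_derivative 1) (at t within {0..})"
      unfolding has_real_derivative_iff_has_vector_derivative[symmetric]
      by (auto intro!: derivative_eq_intros)
    have 2: "(G has_vector_derivative h (t + \<tau>)) (at (t + \<tau>) within (\<lambda>t. t + \<tau>) ` {0..})"
      by (rule has_vector_derivative_within_subset[OF G']) (use t \<tau> in auto)
    from vector_diff_chain_within[OF 1 2] show ?thesis by (simp add: o_def)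
  qed
  have "((\<lambda>t. exp (- \<kappa> * of_real t) * (G (t + \<tau>) - G t) / (?E - 1)) has_vector_derivative
      (exp (- \<kappa> * of_real t) * (h (t + \<tau>) - h t) + (- \<kappa> * exp (- \<kappa> * of_real t)) * (G (t + \<tau>) - G t)) / (?E - 1)) (at t within {0..})"
    by (intro has_vector_derivative_divide has_vector_derivative_mult has_vector_derivative_diff sh G' t
        exp_linear_has_vector_derivative)
  moreover have "(exp (- \<kappa> * of_real t) * (h (t + \<tau>) - h t) + (- \<kappa> * exp (- \<kappa> * of_real t)) * (G (t + \<tau>) - G t)) / (?E - 1)
     = F t - \<kappa> * p t"
  proof -
    have e1: "exp (- \<kappa> * of_real t) * h t = F t" by (simp add: h_def exp_minus flip: mult.assoc)
    have "exp (- \<kappa> * of_real t) * exp (\<kappa> * of_real (t + \<tau>)) = ?E"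
      unfolding exp_add[symmetric] by (rule arg_cong[where f=exp]) (simp add: distrib_left)
    then have e2: "exp (- \<kappa> * of_real t) * h (t + \<tau>) = ?E * F t"
      by (simp only: h_def per[OF t] flip: mult.assoc)
    have E1: "?E - 1 \<noteq> 0" using E by simp
    have pt: "p t = exp (- \<kappa> * of_real t) * (G (t + \<tau>) - G t) / (?E - 1)" by (rule rep) (use t in simp)
    have "exp (- \<kappa> * of_real t) * (h (t + \<tau>) - h t) = (?E - 1) * F t"
      by (simp only: right_diff_distrib e1 e2 left_diff_distrib mult_1)
    then have "(exp (- \<kappa> * of_real t) * (h (t + \<tau>) - h t) + (- \<kappa> * exp (- \<kappa> * of_real t)) * (G (t + \<tau>) - G t)) / (?E - 1)
      = (?E - 1) * F t / (?E - 1) + (- \<kappa> * exp (- \<kappa> * of_real t)) * (G (t + \<tau>) - G t) / (?E - 1)"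
      by (simp only: add_divide_distrib)
    also have "(?E - 1) * F t / (?E - 1) = F t" using E1 by (simp only: nonzero_mult_div_cancel_left simp_thms)
    also have "(- \<kappa> * exp (- \<kappa> * of_real t)) * (G (t + \<tau>) - G t) / (?E - 1) = - \<kappa> * p t"
      unfolding pt by simp
    finally show ?thesis by simp
  qed
  ultimately have D: "((\<lambda>t. exp (- \<kappa> * of_real t) * (G (t + \<tau>) - G t) / (?E - 1)) has_vector_derivative F t - \<kappa> * p t) (at t within {0..})"
    by (simp only:)
  show "(p has_vector_derivative F t - \<kappa> * p t) (at t within {0..})"
    by (rule has_vector_derivative_transform[OF _ rep D]) (use t in simp)
qed

text \<open>Homogeneous solutions are multiples of \<open>exp (- \<kappa> * of_real t)\<close> and
  grow, so boundedness of w excludes them. Integrating from t to T and letting T tend to infinity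
  expresses w(t) through the values of \<open>e\<close> after time t, which are small.\<close>

lemma damped_ode_decay:
  fixes w e :: "real \<Rightarrow> complex"
  assumes \<kappa>: "Re \<kappa> < 0" and d: "\<And>t. 0 \<le> t \<Longrightarrow> (w has_vector_derivative e t - \<kappa> * w t) (at t within {0..})"
    and e: "(e \<longlongrightarrow> 0) at_top" and M: "\<And>t. 0 \<le> t \<Longrightarrow> cmod (w t) \<le> M"
  shows "(w \<longlongrightarrow> 0) at_top"
proof (rule tendstoI)
  fix \<epsilon> :: real assume \<epsilon>: "0 < \<epsilon>"
  define a where "a = - Re \<kappa>"
  have a: "0 < a" using \<kappa> by (simp add: a_def)
  have ex: "cmod (exp (\<kappa> * of_real s)) = exp (- a * s)" for s by (simp add: a_def)
  \<comment> \<open>The factor a compensates for the integral of exp(-as) over s from t to infinity,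
    which is exp(-at)/a.\<close>
  have "\<forall>\<^sub>F s in at_top. dist (e s) 0 < \<epsilon> / 2 * a"
    by (rule tendstoD[OF e]) (use \<epsilon> a in simp)
  then obtain T1 where T1: "\<And>s. T1 \<le> s \<Longrightarrow> cmod (e s) < \<epsilon> / 2 * a"
    unfolding eventually_at_top_linorder by auto
  define T0 where "T0 = max T1 0"
  have small: "cmod (w t) \<le> \<epsilon> / 2" if t: "T0 \<le> t" for t
  proof -
    have t0: "0 \<le> t" "T1 \<le> t" using t by (auto simp: T0_def)
    have le: "exp (- a * t) * cmod (w t) \<le> exp (- a * T) * M + \<epsilon> / 2 * exp (- a * t)" if T: "t \<le> T" for T
    proof -
      have I: "((\<lambda>s. exp (\<kappa> * of_real s) * e s) has_integral exp (\<kappa> * of_real T) * w T - exp (\<kappa> * of_real t) * w t) {t..T}"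
      proof (rule fundamental_theorem_of_calculus[OF T])
        fix s assume s: "s \<in> {t..T}"
        then have s0: "0 \<le> s" using t0 by simp
        have "((\<lambda>s. exp (\<kappa> * of_real s) * w s) has_vector_derivative
           exp (\<kappa> * of_real s) * (e s - \<kappa> * w s) + (\<kappa> * exp (\<kappa> * of_real s)) * w s) (at s within {0..})"
          by (rule has_vector_derivative_mult[OF exp_linear_has_vector_derivative d[OF s0]])
        then have "((\<lambda>s. exp (\<kappa> * of_real s) * w s) has_vector_derivative exp (\<kappa> * of_real s) * e s) (at s within {0..})"
          by (simp add: algebra_simps)
        then show "((\<lambda>s. exp (\<kappa> * of_real s) * w s) has_vector_derivative exp (\<kappa> * of_real s) * e s) (at s within {t..T})"
          by (rule has_vector_derivative_within_subset) (use t0 in auto)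
      qed
      have J: "((\<lambda>s. \<epsilon> / 2 * a * exp (- a * s)) has_integral (- (\<epsilon> / 2) * exp (- a * T)) - (- (\<epsilon> / 2) * exp (- a * t))) {t..T}"
      proof (rule fundamental_theorem_of_calculus[OF T])
        fix s
        show "((\<lambda>s. - (\<epsilon> / 2) * exp (- a * s)) has_vector_derivative \<epsilon> / 2 * a * exp (- a * s)) (at s within {t..T})"
          unfolding has_real_derivative_iff_has_vector_derivative[symmetric]
          by (auto intro!: derivative_eq_intros)
      qed
      have "cmod (exp (\<kappa> * of_real T) * w T - exp (\<kappa> * of_real t) * w t) \<le> (- (\<epsilon> / 2) * exp (- a * T)) - (- (\<epsilon> / 2) * exp (- a * t))"
      proof (rule integral_norm_bound_integral[OF has_integral_integrable[OF I] has_integral_integrable[OF J],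
            unfolded integral_unique[OF I] integral_unique[OF J]])
        fix s assume s: "s \<in> {t..T}"
        have "cmod (exp (\<kappa> * of_real s) * e s) = exp (- a * s) * cmod (e s)" by (simp only: norm_mult ex)
        also have "\<dots> \<le> exp (- a * s) * (\<epsilon> / 2 * a)"
          by (rule mult_left_mono) (use T1[of s] s t0 in auto)
        finally show "cmod (exp (\<kappa> * of_real s) * e s) \<le> \<epsilon> / 2 * a * exp (- a * s)" by (simp only: mult.commute)
      qed
      also have "\<dots> \<le> \<epsilon> / 2 * exp (- a * t)" using \<epsilon> by simp
      finally have "cmod (exp (\<kappa> * of_real T) * w T - exp (\<kappa> * of_real t) * w t) \<le> \<epsilon> / 2 * exp (- a * t)" .
      moreover have "cmod (exp (\<kappa> * of_real t) * w t) \<le> cmod (exp (\<kappa> * of_real T) * w T)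
          + cmod (exp (\<kappa> * of_real T) * w T - exp (\<kappa> * of_real t) * w t)"
        using norm_triangle_ineq4[of "exp (\<kappa> * of_real T) * w T" "exp (\<kappa> * of_real T) * w T - exp (\<kappa> * of_real t) * w t"]
        by simp
      moreover have "cmod (exp (\<kappa> * of_real T) * w T) \<le> exp (- a * T) * M"
        unfolding norm_mult ex by (rule mult_left_mono[OF M]) (use t0 T in auto)
      ultimately show ?thesis unfolding norm_mult ex by linarith
    qed
    have "((\<lambda>T. exp (- a * T) * M + \<epsilon> / 2 * exp (- a * t)) \<longlongrightarrow> 0 * M + \<epsilon> / 2 * exp (- a * t)) at_top"
    proof (rule tendsto_add[OF tendsto_mult[OF _ tendsto_const] tendsto_const])
      have "filterlim (\<lambda>T. a * T) at_top at_top"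
        by (rule filterlim_tendsto_pos_mult_at_top[OF tendsto_const a filterlim_ident])
      then have "((\<lambda>T. exp (- (a * T))) \<longlongrightarrow> 0) at_top"
        by (intro filterlim_compose[OF exp_at_bot] filterlim_compose[OF filterlim_uminus_at_bot_at_top])
      then show "((\<lambda>T. exp (- a * T)) \<longlongrightarrow> 0) at_top" by simp
    qed
    then have "exp (- a * t) * cmod (w t) \<le> 0 * M + \<epsilon> / 2 * exp (- a * t)"
      by (rule tendsto_lowerbound[OF _ eventually_mono[OF eventually_ge_at_top[of t] le]]) auto
    then have "exp (- a * t) * cmod (w t) \<le> exp (- a * t) * (\<epsilon> / 2)" by (simp only: mult_zero_left add_0_left mult.commute)
    then show ?thesis by (simp only: mult_le_cancel_left_pos exp_gt_zero)
  qed
  show "\<forall>\<^sub>F t in at_top. dist (w t) 0 < \<epsilon>"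
    unfolding eventually_at_top_linorder
    by (rule exI[of _ T0]) (use small \<epsilon> in force)
qed

text \<open>Boundedness of g is included to make the relation stable under products.\<close>

definition asy :: "(real \<Rightarrow> complex) \<Rightarrow> (real \<Rightarrow> complex) \<Rightarrow> bool" where
  "asy f g \<longleftrightarrow> ((\<lambda>t. f t - g t) \<longlongrightarrow> 0) at_top \<and> (\<exists>B. \<forall>t\<ge>0. cmod (g t) \<le> B)"

lemma asy_add: assumes "asy f1 g1" "asy f2 g2" shows "asy (\<lambda>t. f1 t + f2 t) (\<lambda>t. g1 t + g2 t)"
proof -
  have "((\<lambda>t. (f1 t - g1 t) + (f2 t - g2 t)) \<longlongrightarrow> 0 + 0) at_top"
    by (rule tendsto_add) (use assms in \<open>simp_all add: asy_def\<close>)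
  moreover obtain A B where "\<And>t. 0 \<le> t \<Longrightarrow> cmod (g1 t) \<le> A" "\<And>t. 0 \<le> t \<Longrightarrow> cmod (g2 t) \<le> B"
    using assms unfolding asy_def by blast
  then have "\<forall>t\<ge>0. cmod (g1 t + g2 t) \<le> A + B"
    by (intro allI impI order_trans[OF norm_triangle_ineq] add_mono)
  ultimately show ?thesis unfolding asy_def by (auto simp: algebra_simps)
qed

lemma asy_mult: assumes "asy f1 g1" "asy f2 g2" shows "asy (\<lambda>t. f1 t * f2 t) (\<lambda>t. g1 t * g2 t)"
proof -
  have d: "((\<lambda>t. f1 t - g1 t) \<longlongrightarrow> 0) at_top" "((\<lambda>t. f2 t - g2 t) \<longlongrightarrow> 0) at_top"
    using assms by (simp_all add: asy_def)
  obtain A where A: "\<And>t. 0 \<le> t \<Longrightarrow> cmod (g1 t) \<le> A" using assms unfolding asy_def by blast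
  obtain B where B: "\<And>t. 0 \<le> t \<Longrightarrow> cmod (g2 t) \<le> B" using assms unfolding asy_def by blast
  have 1: "((\<lambda>t. (f1 t - g1 t) * g2 t) \<longlongrightarrow> 0) at_top"
  proof (rule tendsto_0_le[OF d(1), where K=B])
    show "\<forall>\<^sub>F t in at_top. cmod ((f1 t - g1 t) * g2 t) \<le> cmod (f1 t - g1 t) * B"
      using eventually_ge_at_top[of 0] by eventually_elim (simp only: norm_mult mult_left_mono B norm_ge_zero)
  qed
  have 2: "((\<lambda>t. g1 t * (f2 t - g2 t)) \<longlongrightarrow> 0) at_top"
  proof (rule tendsto_0_le[OF d(2), where K=A])
    show "\<forall>\<^sub>F t in at_top. cmod (g1 t * (f2 t - g2 t)) \<le> cmod (f2 t - g2 t) * A"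
      using eventually_ge_at_top[of 0]
      by eventually_elim (simp only: norm_mult mult.commute[of "cmod (g1 _)"] mult_left_mono A norm_ge_zero)
  qed
  have "((\<lambda>t. (f1 t - g1 t) * (f2 t - g2 t) + (f1 t - g1 t) * g2 t + g1 t * (f2 t - g2 t)) \<longlongrightarrow> 0 * 0 + 0 + 0) at_top"
    by (intro tendsto_add tendsto_mult d 1 2)
  moreover have "(f1 t - g1 t) * (f2 t - g2 t) + (f1 t - g1 t) * g2 t + g1 t * (f2 t - g2 t) = f1 t * f2 t - g1 t * g2 t" for t
    by (simp add: algebra_simps)
  ultimately have "((\<lambda>t. f1 t * f2 t - g1 t * g2 t) \<longlongrightarrow> 0) at_top" by simp
  moreover have "\<forall>t\<ge>0. cmod (g1 t * g2 t) \<le> A * B"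
    unfolding norm_mult using A B by (intro allI impI mult_mono order_trans[OF norm_ge_zero A]) auto
  ultimately show ?thesis unfolding asy_def by blast
qed

lemma asy_const: "asy (\<lambda>t. c) (\<lambda>t. c)"
  unfolding asy_def by auto

lemma asy_cnj: "asy f g \<Longrightarrow> asy (\<lambda>t. cnj (f t)) (\<lambda>t. cnj (g t))"
  unfolding asy_def using tendsto_cnj[of "\<lambda>t. f t - g t" 0 at_top] by simp

lemma asy_diff: assumes "asy f1 g1" "asy f2 g2" shows "asy (\<lambda>t. f1 t - f2 t) (\<lambda>t. g1 t - g2 t)"
  using asy_add[OF assms(1) asy_mult[OF asy_const[of "-1"] assms(2)]] by simp

lemma asy_sum: "finite I \<Longrightarrow> (\<And>i. i \<in> I \<Longrightarrow> asy (f i) (g i)) \<Longrightarrow> asy (\<lambda>t. \<Sum>i\<in>I. f i t) (\<lambda>t. \<Sum>i\<in>I. g i t)"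
  by (induction I rule: finite_induct) (auto intro!: asy_const asy_add)

lemma asy_coef3:
  assumes "\<And>i. 1 \<le> i \<Longrightarrow> i < N \<Longrightarrow> asy (X i) (X' i)" "\<And>i. 1 \<le> i \<Longrightarrow> i < N \<Longrightarrow> asy (Y i) (Y' i)"
    "\<And>i. 1 \<le> i \<Longrightarrow> i < N \<Longrightarrow> asy (Z i) (Z' i)"
  shows "asy (\<lambda>t. coef3 (\<lambda>i. X i t) (\<lambda>i. Y i t) (\<lambda>i. Z i t) N) (\<lambda>t. coef3 (\<lambda>i. X' i t) (\<lambda>i. Y' i t) (\<lambda>i. Z' i t) N)"
proof -
  have "asy (\<lambda>t. \<Sum>s\<in>idx3 N. X (fst s) t * Y (fst (snd s)) t * Z (snd (snd s)) t)
     (\<lambda>t. \<Sum>s\<in>idx3 N. X' (fst s) t * Y' (fst (snd s)) t * Z' (snd (snd s)) t)"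
    by (rule asy_sum[OF finite_idx3], intro asy_mult assms) (auto dest: idx3D)
  then show ?thesis by (simp add: coef3_idx3 case_prod_unfold)
qed

lemma periodic_nat:
  assumes "\<And>t. 0 \<le> t \<Longrightarrow> f (t + \<tau>) = f t" "0 \<le> (t::real)" "0 \<le> \<tau>"
  shows "f (t + real n * \<tau>) = f t"
proof (induction n)
  case (Suc n)
  have "f ((t + real n * \<tau>) + \<tau>) = f (t + real n * \<tau>)" by (rule assms(1)) (use assms in simp)
  then show ?case using Suc by (simp add: algebra_simps)
qed simp

lemma periodic_bounded:
  fixes f :: "real \<Rightarrow> complex"
  assumes \<tau>: "0 < \<tau>" and c: "continuous_on {0..} f" and p: "\<And>t. 0 \<le> t \<Longrightarrow> f (t + \<tau>) = f t"
  shows "\<exists>B. \<forall>t\<ge>0. cmod (f t) \<le> B"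
proof -
  have "continuous_on {0..\<tau>} f" by (rule continuous_on_subset[OF c]) auto
  from compact_imp_bounded[OF compact_continuous_image[OF this compact_Icc]]
  obtain B where B: "\<And>s. s \<in> {0..\<tau>} \<Longrightarrow> cmod (f s) \<le> B" unfolding bounded_iff by blast
  have "cmod (f t) \<le> B" if t: "0 \<le> t" for t
  proof -
    define n where "n = nat \<lfloor>t / \<tau>\<rfloor>"
    have n: "real n = of_int \<lfloor>t / \<tau>\<rfloor>" using t \<tau> by (simp add: n_def)
    have "real n \<le> t / \<tau>" "t / \<tau> < real n + 1" unfolding n by linarith+
    then have s: "0 \<le> t - real n * \<tau>" "t - real n * \<tau> \<le> \<tau>" using \<tau> by (simp_all add: field_simps)
    have "f ((t - real n * \<tau>) + real n * \<tau>) = f (t - real n * \<tau>)"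
      by (rule periodic_nat[where f=f]) (use p s \<tau> in auto)
    then have "f t = f (t - real n * \<tau>)" by simp
    then show ?thesis using B[of "t - real n * \<tau>"] s by simp
  qed
  then show ?thesis by blast
qed

text \<open>This is \<open>ricV\<close> at x = 0 with the boundary values of q and q_x replaced by
  the periodic data and r replaced by P.\<close>

definition perF :: "real \<Rightarrow> complex \<Rightarrow> (nat \<Rightarrow> real \<Rightarrow> complex) \<Rightarrow> (nat \<Rightarrow> real \<Rightarrow> complex)
    \<Rightarrow> (nat \<Rightarrow> real \<Rightarrow> complex) \<Rightarrow> nat \<Rightarrow> real \<Rightarrow> complex" where
  "perF lam k g0 g1 P N t = 2 * k * g0 N t + \<i> * g1 N t
     - 2 * of_real lam * k * coef3 (\<lambda>i. cnj (g0 i t)) (\<lambda>j. P j t) (\<lambda>p. P p t) N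
     + \<i> * of_real lam * coef3 (\<lambda>i. cnj (g1 i t)) (\<lambda>j. P j t) (\<lambda>p. P p t) N
     - 2 * \<i> * of_real lam * coef3 (\<lambda>i. cnj (g0 i t)) (\<lambda>j. g0 j t) (\<lambda>p. P p t) N"

text \<open>At each order this is the formula of \<open>periodic_ode_solution\<close> with
  \<open>\<kappa>\<close> equal to 4ik^2. At resonant k the denominator is 0, and the value 0 that
  division then returns carries no meaning.\<close>

definition per where
  "per lam \<tau> g0 g1 k = rser (\<lambda>P N t. integral {0..\<tau>} (\<lambda>s. exp (4*\<i>*k\<^sup>2 * of_real s) * perF lam k g0 g1 P N (t + s))
     / (exp (4*\<i>*k\<^sup>2 * of_real \<tau>) - 1))"

lemma perF_cong: "(\<And>j. j < N \<Longrightarrow> P j = P' j) \<Longrightarrow> perF lam k g0 g1 P N = perF lam k g0 g1 P' N"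
  by (intro ext) (auto simp: perF_def intro!: coef3_cong arg_cong2[where f="(-)"] arg_cong2[where f="(+)"] arg_cong2[where f="(*)"])

lemma per_unfold:
  "per lam \<tau> g0 g1 k N t = integral {0..\<tau>} (\<lambda>s. exp (4*\<i>*k\<^sup>2 * of_real s) * perF lam k g0 g1 (per lam \<tau> g0 g1 k) N (t + s))
     / (exp (4*\<i>*k\<^sup>2 * of_real \<tau>) - 1)"
proof -
  have "per lam \<tau> g0 g1 k N = (\<lambda>t. integral {0..\<tau>} (\<lambda>s. exp (4*\<i>*k\<^sup>2 * of_real s) * perF lam k g0 g1 (per lam \<tau> g0 g1 k) N (t + s))
     / (exp (4*\<i>*k\<^sup>2 * of_real \<tau>) - 1))"
    unfolding per_def
  proof (rule rser_unfold)
    fix X X' :: "nat \<Rightarrow> real \<Rightarrow> complex" assume "\<And>j. j < N \<Longrightarrow> X j = X' j"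
    then have e: "perF lam k g0 g1 X N = perF lam k g0 g1 X' N" by (rule perF_cong)
    show "(\<lambda>t. integral {0..\<tau>} (\<lambda>s. exp (4*\<i>*k\<^sup>2 * of_real s) * perF lam k g0 g1 X N (t + s)) / (exp (4*\<i>*k\<^sup>2 * of_real \<tau>) - 1))
      = (\<lambda>t. integral {0..\<tau>} (\<lambda>s. exp (4*\<i>*k\<^sup>2 * of_real s) * perF lam k g0 g1 X' N (t + s)) / (exp (4*\<i>*k\<^sup>2 * of_real \<tau>) - 1))"
      by (simp only: e)
  qed
  then show ?thesis by (rule fun_cong)
qed

locale periodic_data =
  fixes lam \<tau> :: real and g0 g1 :: "nat \<Rightarrow> real \<Rightarrow> complex"
  assumes \<tau>: "0 < \<tau>"
    and per0: "\<And>N t. 1 \<le> N \<Longrightarrow> 0 \<le> t \<Longrightarrow> g0 N (t + \<tau>) = g0 N t"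
    and per1: "\<And>N t. 1 \<le> N \<Longrightarrow> 0 \<le> t \<Longrightarrow> g1 N (t + \<tau>) = g1 N t"
    and cont0: "\<And>N. 1 \<le> N \<Longrightarrow> continuous_on {0..} (g0 N)"
    and cont1: "\<And>N. 1 \<le> N \<Longrightarrow> continuous_on {0..} (g1 N)"
begin

abbreviation "P \<equiv> per lam \<tau> g0 g1"

lemma perF_continuous:
  assumes N: "1 \<le> N" and P: "\<And>j. 1 \<le> j \<Longrightarrow> j < N \<Longrightarrow> continuous_on {0..} (X j)"
  shows "continuous_on {0..} (perF lam k g0 g1 X N)"
  unfolding perF_def
  by (intro continuous_on_add continuous_on_diff continuous_on_mult continuous_on_const
      continuous_on_coef3 continuous_on_cnj cont0 cont1 P N)

lemma per_ode:
  assumes E: "exp (4*\<i>*k\<^sup>2 * of_real \<tau>) \<noteq> 1"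
  shows "1 \<le> N \<Longrightarrow> (\<forall>t\<ge>0. P k N (t + \<tau>) = P k N t \<and>
     (P k N has_vector_derivative perF lam k g0 g1 (P k) N t - 4*\<i>*k\<^sup>2 * P k N t) (at t within {0..}))"
proof (induction N rule: less_induct)
  case (less N)
  note N = less.prems
  have IH: "P k j (t + \<tau>) = P k j t"
    "(P k j has_vector_derivative perF lam k g0 g1 (P k) j t - 4*\<i>*k\<^sup>2 * P k j t) (at t within {0..})"
    if "1 \<le> j" "j < N" "0 \<le> t" for j t using less.IH[OF that(2,1)] that(3) by blast+
  have Pc: "continuous_on {0..} (P k j)" if "1 \<le> j" "j < N" for j
    by (rule continuous_on_vector_derivative[OF IH(2)[OF that]]) simp
  have Fp: "perF lam k g0 g1 (P k) N (t + \<tau>) = perF lam k g0 g1 (P k) N t" if t: "0 \<le> t" for t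
  proof -
    have "coef3 (\<lambda>i. cnj (g0 i (t + \<tau>))) (\<lambda>j. P k j (t + \<tau>)) (\<lambda>p. P k p (t + \<tau>)) N
       = coef3 (\<lambda>i. cnj (g0 i t)) (\<lambda>j. P k j t) (\<lambda>p. P k p t) N"
      by (rule coef3_cong) (simp_all add: per0 per1 IH(1) t)
    moreover have "coef3 (\<lambda>i. cnj (g1 i (t + \<tau>))) (\<lambda>j. P k j (t + \<tau>)) (\<lambda>p. P k p (t + \<tau>)) N
       = coef3 (\<lambda>i. cnj (g1 i t)) (\<lambda>j. P k j t) (\<lambda>p. P k p t) N"
      by (rule coef3_cong) (simp_all add: per0 per1 IH(1) t)
    moreover have "coef3 (\<lambda>i. cnj (g0 i (t + \<tau>))) (\<lambda>j. g0 j (t + \<tau>)) (\<lambda>p. P k p (t + \<tau>)) N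
       = coef3 (\<lambda>i. cnj (g0 i t)) (\<lambda>j. g0 j t) (\<lambda>p. P k p t) N"
      by (rule coef3_cong) (simp_all add: per0 per1 IH(1) t)
    ultimately show ?thesis unfolding perF_def by (simp only: per0[OF N t] per1[OF N t])
  qed
  note s = periodic_ode_solution[OF \<tau> perF_continuous[OF N Pc] Fp E per_unfold]
  show ?case using s by blast
qed

lemma per_continuous:
  assumes E: "exp (4*\<i>*k\<^sup>2 * of_real \<tau>) \<noteq> 1" and N: "1 \<le> N"
  shows "continuous_on {0..} (P k N)"
proof (rule continuous_on_vector_derivative)
  show "(P k N has_vector_derivative perF lam k g0 g1 (P k) N t - 4*\<i>*k\<^sup>2 * P k N t) (at t within {0..})"
    if "t \<in> {0..}" for t using per_ode[OF E N] that by simp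
qed

lemma data_bounded: "1 \<le> N \<Longrightarrow> \<exists>B. \<forall>t\<ge>0. cmod (g0 N t) \<le> B" "1 \<le> N \<Longrightarrow> \<exists>B. \<forall>t\<ge>0. cmod (g1 N t) \<le> B"
  by (rule periodic_bounded[OF \<tau> cont0 per0]; assumption) (rule periodic_bounded[OF \<tau> cont1 per1]; assumption)

end

section \<open>Comparison with the periodic solution at x = 0\<close>

locale nls_periodic = nls_hierarchy lam Q + periodic_data lam \<tau> g0 g1
  for lam :: real and Q :: "nat \<Rightarrow> nat \<Rightarrow> nat \<Rightarrow> real \<Rightarrow> real \<Rightarrow> complex" and \<tau> :: real and g0 g1 +
  assumes asy0: "\<And>N. 1 \<le> N \<Longrightarrow> asy (\<lambda>t. Q N 0 0 0 t) (g0 N)"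
    and asy1: "\<And>N. 1 \<le> N \<Longrightarrow> asy (\<lambda>t. Q N 1 0 0 t) (g1 N)"
begin

lemma Re_kappa: "Re (4*\<i>*k\<^sup>2) = - 8 * (Re k * Im k)"
  by (simp add: power2_eq_square)

lemma norm_exp_kappa: "cmod (exp (4*\<i>*k\<^sup>2 * of_real s)) = exp (- 8 * (Re k * Im k) * s)"
proof -
  have "Re (4*\<i>*k\<^sup>2 * of_real s) = Re (4*\<i>*k\<^sup>2) * s" by simp
  then show ?thesis unfolding norm_exp_eq_Re Re_kappa by simp
qed

lemma exp_kappa_ne_1:
  assumes "0 < Re k" "0 < Im k"
  shows "exp (4*\<i>*k\<^sup>2 * of_real \<tau>) \<noteq> 1"
proof
  assume "exp (4*\<i>*k\<^sup>2 * of_real \<tau>) = 1"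
  then have "exp (- 8 * (Re k * Im k) * \<tau>) = 1" using norm_exp_kappa[of k \<tau>] by simp
  then have "Re k * Im k * \<tau> = 0" by simp
  moreover have "0 < Re k * Im k * \<tau>" using assms \<tau> by simp
  ultimately show False by linarith
qed

text \<open>The difference solves the linear equation with forcing \<open>ricV\<close> minus
  \<open>perF\<close>. The forcing contains only the data and lower orders, so it tends to 0 by
  induction, and \<open>damped_ode_decay\<close> applies to the bounded difference.\<close>

lemma ric_asy_per:
  assumes k: "0 < Re k" "0 < Im k"
  shows "1 \<le> N \<Longrightarrow> asy (\<lambda>t. ric k N 0 t) (P k N)"
proof (induction N rule: less_induct)
  case (less N)
  note N = less.prems
  note E = exp_kappa_ne_1[OF k]
  have IH: "asy (\<lambda>t. ric k j 0 t) (P k j)" if "1 \<le> j" "j < N" for j using less.IH that by blast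
  have A: "asy (\<lambda>t. ricV k (ric k) N 0 t) (\<lambda>t. perF lam k g0 g1 (P k) N t)"
    unfolding ricV_def perF_def
    by (intro asy_add asy_diff asy_mult[OF asy_const] asy_coef3 asy_cnj asy0 asy1 IH N)
  have pb: "\<exists>B. \<forall>t\<ge>0. cmod (P k N t) \<le> B"
    by (rule periodic_bounded[OF \<tau> per_continuous[OF E N]]) (use per_ode[OF E N] in blast)
  then obtain B where B: "\<And>t. 0 \<le> t \<Longrightarrow> cmod (P k N t) \<le> B" by blast
  obtain M where M: "\<forall>k t. 0 < Im k \<longrightarrow> 0 \<le> t \<longrightarrow> (\<forall>x\<ge>0. cmod (ric k N x t) \<le> M \<and>
       ((\<lambda>x. ric k N x t) has_vector_derivative ricU (ric k) N x t - 2*\<i>*k * ric k N x t) (at x within {0..}))"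
    using ric_bound[OF N] by (rule exE)
  have M': "cmod (ric k N 0 t) \<le> M" if "0 \<le> t" for t using M k that by blast
  have "((\<lambda>t. ric k N 0 t - P k N t) \<longlongrightarrow> 0) at_top"
  proof (rule damped_ode_decay[where \<kappa>="4*\<i>*k\<^sup>2" and e="\<lambda>t. ricV k (ric k) N 0 t - perF lam k g0 g1 (P k) N t" and M="M + B"])
    show "Re (4*\<i>*k\<^sup>2) < 0" unfolding Re_kappa using k by simp
    show "((\<lambda>t. ricV k (ric k) N 0 t - perF lam k g0 g1 (P k) N t) \<longlongrightarrow> 0) at_top"
      using A by (simp add: asy_def)
    show "cmod (ric k N 0 t - P k N t) \<le> M + B" if "0 \<le> t" for t
      by (rule order_trans[OF norm_triangle_ineq4 add_mono[OF M'[OF that] B[OF that]]])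
    show "((\<lambda>t. ric k N 0 t - P k N t) has_vector_derivative
        ricV k (ric k) N 0 t - perF lam k g0 g1 (P k) N t - 4*\<i>*k\<^sup>2 * (ric k N 0 t - P k N t)) (at t within {0..})"
      if t: "0 \<le> t" for t
    proof -
      have "((\<lambda>t. ric k N 0 t - P k N t) has_vector_derivative
         (ricV k (ric k) N 0 t - 4*\<i>*k\<^sup>2 * ric k N 0 t) - (perF lam k g0 g1 (P k) N t - 4*\<i>*k\<^sup>2 * P k N t)) (at t within {0..})"
        using ric_dt[OF k(2) N] per_ode[OF E N] t by (intro has_vector_derivative_diff) blast+
      then show ?thesis by (simp add: algebra_simps)
    qed
  qed
  then show ?case unfolding asy_def using pb by blast
qed

text \<open>Along t + n tau the value of P does not change while its distance from
  \<open>ric\<close> tends to 0. So P inherits the bound of \<open>ric\<close>, with one M for the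
  whole open quadrant.\<close>

lemma per_bound:
  assumes N: "1 \<le> N"
  shows "\<exists>M. \<forall>k t. 0 < Re k \<longrightarrow> 0 < Im k \<longrightarrow> 0 \<le> t \<longrightarrow> cmod (P k N t) \<le> M"
proof -
  obtain M where M: "\<forall>k t. 0 < Im k \<longrightarrow> 0 \<le> t \<longrightarrow> (\<forall>x\<ge>0. cmod (ric k N x t) \<le> M \<and>
       ((\<lambda>x. ric k N x t) has_vector_derivative ricU (ric k) N x t - 2*\<i>*k * ric k N x t) (at x within {0..}))"
    using ric_bound[OF N] by (rule exE)
  have "cmod (P k N t) \<le> M" if k: "0 < Re k" "0 < Im k" and t: "0 \<le> t" for k t
  proof -
    define u where "u = (\<lambda>n. t + real n * \<tau>)"
    have u0: "0 \<le> u n" for n using t \<tau> by (simp add: u_def)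
    have Pu: "P k N (u n) = P k N t" for n
      unfolding u_def
      by (rule periodic_nat[where f="P k N"]) (use per_ode[OF exp_kappa_ne_1[OF k] N] t \<tau> in auto)
    have "filterlim u at_top sequentially"
      unfolding u_def
      by (rule filterlim_tendsto_add_at_top[OF tendsto_const])
         (rule filterlim_at_top_mult_tendsto_pos[OF tendsto_const \<tau> filterlim_real_sequentially])
    moreover have "((\<lambda>t. ric k N 0 t - P k N t) \<longlongrightarrow> 0) at_top"
      using ric_asy_per[OF k N] by (simp add: asy_def)
    ultimately have "(\<lambda>n. ric k N 0 (u n) - P k N (u n)) \<longlonglongrightarrow> 0"
      by (rule filterlim_compose[rotated])
    then have "(\<lambda>n. M + cmod (ric k N 0 (u n) - P k N (u n))) \<longlonglongrightarrow> M + cmod 0"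
      by (intro tendsto_add tendsto_const tendsto_norm)
    moreover have "cmod (P k N t) \<le> M + cmod (ric k N 0 (u n) - P k N (u n))" for n
    proof -
      have "cmod (ric k N 0 (u n)) \<le> M" using M k u0 by blast
      moreover have "cmod (P k N (u n)) \<le> cmod (ric k N 0 (u n)) + cmod (ric k N 0 (u n) - P k N (u n))"
        using norm_triangle_ineq4[of "ric k N 0 (u n)" "ric k N 0 (u n) - P k N (u n)"] by simp
      ultimately show ?thesis unfolding Pu by linarith
    qed
    ultimately have "cmod (P k N t) \<le> M + cmod 0"
      by (intro tendsto_lowerbound[of _ "M + cmod 0"] always_eventually) auto
    then show ?thesis by simp
  qed
  then show ?thesis by blast
qed

text \<open>Dominated convergence in the integral for P, by induction on N. \<open>per_bound\<close>
  supplies a majorant independent of n, and at the limit point only the denominator has to be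
  nonzero, so k may lie on the boundary of the quadrant.\<close>

lemma per_tendsto:
  assumes K: "K \<longlonglongrightarrow> k" and Kpos: "\<And>n. 0 < Re (K n)" "\<And>n. 0 < Im (K n)"
    and E: "exp (4*\<i>*k\<^sup>2 * of_real \<tau>) \<noteq> 1"
  shows "1 \<le> N \<Longrightarrow> 0 \<le> t \<Longrightarrow> (\<lambda>n. P (K n) N t) \<longlonglongrightarrow> P k N t"
proof (induction N arbitrary: t rule: less_induct)
  case (less N)
  note N = less.prems(1) and t = less.prems(2)
  have IH: "(\<lambda>n. P (K n) j t) \<longlonglongrightarrow> P k j t" if "1 \<le> j" "j < N" "0 \<le> t" for j t
    using less.IH that by blast
  \<comment> \<open>Merges bounds that depend on the order into one nonnegative constant valid for
    all orders up to N.\<close>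
  have choose: "\<exists>B\<ge>0. \<forall>j. 1 \<le> j \<longrightarrow> j \<le> N \<longrightarrow> (\<forall>y. X j y \<longrightarrow> f j y \<le> B)"
    if "\<And>j. 1 \<le> j \<Longrightarrow> \<exists>B. \<forall>y. X j y \<longrightarrow> f j y \<le> B" for X :: "nat \<Rightarrow> 'b \<Rightarrow> bool" and f :: "nat \<Rightarrow> 'b \<Rightarrow> real"
  proof -
    have "\<forall>j. \<exists>B. 1 \<le> j \<longrightarrow> (\<forall>y. X j y \<longrightarrow> f j y \<le> B)" using that by blast
    from choice[OF this] obtain B where B: "\<forall>j. 1 \<le> j \<longrightarrow> (\<forall>y. X j y \<longrightarrow> f j y \<le> B j)" by (rule exE)
    have "B j \<le> (\<Sum>i\<le>N. \<bar>B i\<bar>)" if "j \<le> N" for j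
    proof -
      have "\<bar>B j\<bar> \<le> (\<Sum>i\<le>N. \<bar>B i\<bar>)" by (rule member_le_sum) (use that in auto)
      then show ?thesis by simp
    qed
    then show ?thesis using B by (intro exI[of _ "\<Sum>i\<le>N. \<bar>B i\<bar>"]) (meson order_trans sum_nonneg abs_ge_zero)
  qed
  obtain G0 where G0: "0 \<le> G0" "\<forall>j. 1 \<le> j \<longrightarrow> j \<le> N \<longrightarrow> (\<forall>t. 0 \<le> t \<longrightarrow> cmod (g0 j t) \<le> G0)"
    using choose[of "\<lambda>j t. 0 \<le> t" "\<lambda>j t. cmod (g0 j t)"] data_bounded(1) by blast
  obtain G1 where G1: "0 \<le> G1" "\<forall>j. 1 \<le> j \<longrightarrow> j \<le> N \<longrightarrow> (\<forall>t. 0 \<le> t \<longrightarrow> cmod (g1 j t) \<le> G1)"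
    using choose[of "\<lambda>j t. 0 \<le> t" "\<lambda>j t. cmod (g1 j t)"] data_bounded(2) by blast
  have "\<exists>C. \<forall>y. 0 < Re (fst y) \<and> 0 < Im (fst y) \<and> 0 \<le> snd y \<longrightarrow> cmod (P (fst y) j (snd y)) \<le> C" if "1 \<le> j" for j
    using per_bound[OF that] by fastforce
  from choose[of "\<lambda>j y. 0 < Re (fst y) \<and> 0 < Im (fst y) \<and> 0 \<le> snd y" "\<lambda>j y. cmod (P (fst y) j (snd y))", OF this]
  obtain C where C: "0 \<le> C" "\<forall>j. 1 \<le> j \<longrightarrow> j \<le> N \<longrightarrow>
     (\<forall>y. 0 < Re (fst y) \<and> 0 < Im (fst y) \<and> 0 \<le> snd y \<longrightarrow> cmod (P (fst y) j (snd y)) \<le> C)" by blast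
  have PC: "cmod (P (K n) j t) \<le> C" if "1 \<le> j" "j < N" "0 \<le> t" for n j t
    using C(2)[rule_format, of j "(K n, t)"] that Kpos[of n] by simp
  have "Bseq K" by (rule convergent_imp_Bseq) (use K in \<open>auto simp: convergent_def\<close>)
  then obtain b where b: "0 < b" "\<And>n. cmod (K n) \<le> b" unfolding Bseq_def by blast
  let ?c = "real (card (idx3 N))"
  \<comment> \<open>The five summands follow the five terms of \<open>perF\<close>; b bounds the
    sequence K, and \<open>G0\<close>, \<open>G1\<close>, C bound the data and P.\<close>
  define D where "D = 2*b*G0 + G1 + 2*\<bar>lam\<bar>*b*(?c*(G0*C*C)) + \<bar>lam\<bar>*(?c*(G1*C*C)) + 2*\<bar>lam\<bar>*(?c*(G0*G0*C))"
  have D: "cmod (perF lam (K n) g0 g1 (P (K n)) N s) \<le> D" if s: "0 \<le> s" for n s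
  proof -
    have c1: "cmod (coef3 (\<lambda>i. cnj (g0 i s)) (\<lambda>j. P (K n) j s) (\<lambda>p. P (K n) p s) N) \<le> ?c * (G0*C*C)"
      by (rule norm_coef3_le) (use G0 G1 C(1) PC s in auto)
    have c2: "cmod (coef3 (\<lambda>i. cnj (g1 i s)) (\<lambda>j. P (K n) j s) (\<lambda>p. P (K n) p s) N) \<le> ?c * (G1*C*C)"
      by (rule norm_coef3_le) (use G0 G1 C(1) PC s in auto)
    have c3: "cmod (coef3 (\<lambda>i. cnj (g0 i s)) (\<lambda>j. g0 j s) (\<lambda>p. P (K n) p s) N) \<le> ?c * (G0*G0*C)"
      by (rule norm_coef3_le) (use G0 G1 C(1) PC s in auto)
    have t1: "cmod (2 * K n * g0 N s) \<le> 2*b*G0"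
      unfolding norm_mult norm_numeral by (intro mult_mono b order.refl) (use G0 b(1) s N in auto)
    have t2: "cmod (\<i> * g1 N s) \<le> G1" using G1 s N by (simp add: norm_mult)
    have t3: "cmod (2 * of_real lam * K n * coef3 (\<lambda>i. cnj (g0 i s)) (\<lambda>j. P (K n) j s) (\<lambda>p. P (K n) p s) N) \<le> 2*\<bar>lam\<bar>*b*(?c*(G0*C*C))"
      unfolding norm_mult norm_numeral norm_of_real by (intro mult_mono b c1 order.refl) (use b(1) in auto)
    have t4: "cmod (\<i> * of_real lam * coef3 (\<lambda>i. cnj (g1 i s)) (\<lambda>j. P (K n) j s) (\<lambda>p. P (K n) p s) N) \<le> \<bar>lam\<bar>*(?c*(G1*C*C))"
      unfolding norm_mult norm_ii norm_of_real mult_1 by (intro mult_mono c2 order.refl) auto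
    have t5: "cmod (2 * \<i> * of_real lam * coef3 (\<lambda>i. cnj (g0 i s)) (\<lambda>j. g0 j s) (\<lambda>p. P (K n) p s) N) \<le> 2*\<bar>lam\<bar>*(?c*(G0*G0*C))"
      unfolding norm_mult norm_numeral norm_ii norm_of_real mult_1_right by (intro mult_mono c3 order.refl) auto
    show ?thesis
      unfolding perF_def D_def
      by (intro norm_triangle_le norm_triangle_le_diff add_mono t1 t2 t3 t4 t5)
  qed
  have D0: "0 \<le> D" using D[of 0 0] norm_ge_zero order_trans by blast
  have Pc: "continuous_on {0..} (P k' j)" if "exp (4*\<i>*k'\<^sup>2 * of_real \<tau>) \<noteq> 1" "1 \<le> j" for k' j
    by (rule per_continuous[OF that])
  have Fi: "(\<lambda>s. exp (4*\<i>*(K n)\<^sup>2 * of_real s) * perF lam (K n) g0 g1 (P (K n)) N (t + s)) integrable_on {0..\<tau>}" for n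
  proof (rule integrable_continuous_real, rule continuous_on_mult[OF continuous_exp_linear])
    have "continuous_on {0..} (perF lam (K n) g0 g1 (P (K n)) N)"
      by (rule perF_continuous[OF N Pc[OF exp_kappa_ne_1[OF Kpos]]])
    then show "continuous_on {0..\<tau>} (\<lambda>s. perF lam (K n) g0 g1 (P (K n)) N (t + s))"
      by (rule continuous_on_compose2) (use t in \<open>auto intro!: continuous_intros\<close>)
  qed
  have "(\<lambda>n. integral {0..\<tau>} (\<lambda>s. exp (4*\<i>*(K n)\<^sup>2 * of_real s) * perF lam (K n) g0 g1 (P (K n)) N (t + s)))
     \<longlonglongrightarrow> integral {0..\<tau>} (\<lambda>s. exp (4*\<i>*k\<^sup>2 * of_real s) * perF lam k g0 g1 (P k) N (t + s))"
  proof (rule dominated_convergence(2)[where h="\<lambda>s. D"])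
    fix n s assume s: "s \<in> {0..\<tau>}"
    have "cmod (exp (4*\<i>*(K n)\<^sup>2 * of_real s)) \<le> 1"
      unfolding norm_exp_kappa using Kpos[of n] s by (simp add: mult_nonneg_nonneg)
    then have "cmod (exp (4*\<i>*(K n)\<^sup>2 * of_real s)) * cmod (perF lam (K n) g0 g1 (P (K n)) N (t + s)) \<le> 1 * D"
      by (intro mult_mono D) (use s t in auto)
    then show "norm (exp (4*\<i>*(K n)\<^sup>2 * of_real s) * perF lam (K n) g0 g1 (P (K n)) N (t + s)) \<le> D"
      by (simp add: norm_mult)
  next
    fix s assume s: "s \<in> {0..\<tau>}"
    have ts: "0 \<le> t + s" using s t by simp
    have co: "(\<lambda>n. coef3 (X n) (Y n) (Z n) N) \<longlonglongrightarrow> coef3 X' Y' Z' N"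
      if "\<And>i. 1 \<le> i \<Longrightarrow> i < N \<Longrightarrow> (\<lambda>n. X n i) \<longlonglongrightarrow> X' i" "\<And>i. 1 \<le> i \<Longrightarrow> i < N \<Longrightarrow> (\<lambda>n. Y n i) \<longlonglongrightarrow> Y' i"
        "\<And>i. 1 \<le> i \<Longrightarrow> i < N \<Longrightarrow> (\<lambda>n. Z n i) \<longlonglongrightarrow> Z' i" for X Y Z X' Y' Z'
      unfolding coef3_idx3 case_prod_unfold
      by (intro tendsto_sum tendsto_mult that) (auto dest: idx3D)
    show "(\<lambda>n. exp (4*\<i>*(K n)\<^sup>2 * of_real s) * perF lam (K n) g0 g1 (P (K n)) N (t + s))
       \<longlonglongrightarrow> exp (4*\<i>*k\<^sup>2 * of_real s) * perF lam k g0 g1 (P k) N (t + s)"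
      unfolding perF_def
      by (intro tendsto_mult tendsto_add tendsto_diff tendsto_exp tendsto_power tendsto_const K co IH ts)
  qed (use Fi in auto)
  moreover have "(\<lambda>n. exp (4*\<i>*(K n)\<^sup>2 * of_real \<tau>) - 1) \<longlonglongrightarrow> exp (4*\<i>*k\<^sup>2 * of_real \<tau>) - 1"
    by (intro tendsto_mult tendsto_diff tendsto_exp tendsto_power tendsto_const K)
  ultimately show ?case
    unfolding per_unfold[of _ _ _ _ _ N] by (rule tendsto_divide) (use E in simp)
qed

lemma per_bound_closure:
  assumes N: "1 \<le> N"
  shows "\<exists>M. \<forall>k t. 0 \<le> Re k \<longrightarrow> 0 \<le> Im k \<longrightarrow> exp (4*\<i>*k\<^sup>2 * of_real \<tau>) \<noteq> 1 \<longrightarrow> 0 \<le> t \<longrightarrow> cmod (P k N t) \<le> M"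
proof -
  from per_bound[OF N] obtain M where M: "\<forall>k t. 0 < Re k \<longrightarrow> 0 < Im k \<longrightarrow> 0 \<le> t \<longrightarrow> cmod (P k N t) \<le> M" by (rule exE)
  have "cmod (P k N t) \<le> M"
    if k: "0 \<le> Re k" "0 \<le> Im k" and E: "exp (4*\<i>*k\<^sup>2 * of_real \<tau>) \<noteq> 1" and t: "0 \<le> t" for k t
  proof -
    \<comment> \<open>The direction 1 + i points from every boundary point into the open
      quadrant.\<close>
    define K where "K = (\<lambda>n. k + of_real (inverse (real (Suc n))) * (1 + \<i>))"
    have "K \<longlonglongrightarrow> k + of_real 0 * (1 + \<i>)"
      unfolding K_def by (intro tendsto_add tendsto_mult tendsto_of_real LIMSEQ_inverse_real_of_nat tendsto_const)
    then have K: "K \<longlonglongrightarrow> k" by simp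
    have Kp: "0 < Re (K n)" "0 < Im (K n)" for n
      using k by (simp_all add: K_def add_nonneg_pos del: of_nat_Suc)
    show ?thesis
    proof (rule LIMSEQ_le_const2[OF tendsto_norm[OF per_tendsto[OF K Kp E N t]]])
      show "\<exists>n0. \<forall>n\<ge>n0. cmod (P (K n) N t) \<le> M" using M Kp t by blast
    qed
  qed
  then show ?thesis by blast
qed

end

section \<open>Fourier series\<close>

lemma has_vector_derivative_quotient:
  fixes f :: "real \<Rightarrow> complex"
  assumes "(f has_vector_derivative f') (at a within S)"
  shows "((\<lambda>t. (f t - f a) / of_real (t - a)) \<longlongrightarrow> f') (at a within S)"
proof (rule LIM_zero_cancel)
  have "((\<lambda>t. (1 / norm (t - a)) *\<^sub>R (f t - (f a + (t - a) *\<^sub>R f'))) \<longlongrightarrow> 0) (at a within S)"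
    using assms unfolding has_vector_derivative_def has_derivative_within by blast
  then show "((\<lambda>t. (f t - f a) / of_real (t - a) - f') \<longlongrightarrow> 0) (at a within S)"
  proof (rule tendsto_0_le[where K=1])
    show "\<forall>\<^sub>F t in at a within S. norm ((f t - f a) / of_real (t - a) - f')
        \<le> norm ((1 / norm (t - a)) *\<^sub>R (f t - (f a + (t - a) *\<^sub>R f'))) * 1"
      unfolding eventually_at_filter
    proof (rule always_eventually, intro allI impI)
      fix t assume t: "t \<noteq> a"
      then have z: "of_real (t - a) \<noteq> (0::complex)" by simp
      have "(f t - f a) / of_real (t - a) - f' = (f t - f a - f' * of_real (t - a)) / of_real (t - a)"
        unfolding diff_divide_distrib[of "f t - f a"] nonzero_mult_div_cancel_right[OF z] ..
      then have "norm ((f t - f a) / of_real (t - a) - f') = norm (f t - f a - f' * of_real (t - a)) / \<bar>t - a\<bar>"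
        by (simp only: norm_divide norm_of_real)
      moreover have "f t - f a - f' * of_real (t - a) = f t - (f a + (t - a) *\<^sub>R f')"
        by (simp add: scaleR_conv_of_real diff_diff_eq mult.commute)
      moreover have "norm ((1 / norm (t - a)) *\<^sub>R Y) = norm Y / \<bar>t - a\<bar>" for Y :: complex
        by simp
      ultimately show "norm ((f t - f a) / of_real (t - a) - f')
        \<le> norm ((1 / norm (t - a)) *\<^sub>R (f t - (f a + (t - a) *\<^sub>R f'))) * 1"
        by (simp only: mult_1_right order.refl)
    qed
  qed
qed

section \<open>Bessel's inequality and pointwise convergence\<close>

locale trig =
  fixes \<omega> :: real
  assumes om: "0 < \<omega>"
begin

definition "period = 2 * pi / \<omega>"

definition e :: "int \<Rightarrow> real \<Rightarrow> complex" where
  "e n t = exp (\<i> * of_int n * of_real \<omega> * of_real t)"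

abbreviation "fc \<equiv> fourier_coeff \<omega>"

lemma period_pos: "0 < period"
  using om by (simp add: period_def)

lemma e_add: "e m t * e n t = e (m + n) t"
  by (simp add: e_def distrib_left distrib_right flip: exp_add)

lemma e_shift: "e n (s + t) = e n s * e n t"
  by (simp add: e_def distrib_left flip: exp_add)

lemma e_0: "e 0 t = 1" by (simp add: e_def)

lemma e_at_0: "e n 0 = 1" by (simp add: e_def)

lemma e_period: "e n period = 1"
proof -
  have "\<omega> * period = 2 * pi" using om by (simp add: period_def)
  then have "of_int n * \<omega> * period = of_int (2 * n) * pi" by (simp add: mult.assoc)
  then have "\<exists>m::int. of_int n * \<omega> * period = of_int (2 * m) * pi" by blast
  then show ?thesis unfolding e_def exp_eq_1 by simp
qed

lemma cnj_e: "cnj (e n t) = e (- n) t"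
  by (simp add: e_def exp_cnj)

lemma norm_e: "cmod (e n t) = 1"
  by (simp add: e_def norm_exp_eq_Re)

lemma e_deriv: "(e n has_vector_derivative (\<i> * of_int n * of_real \<omega>) * e n t) (at t within S)"
  unfolding e_def[abs_def] by (rule exp_linear_has_vector_derivative)

lemma e_continuous: "continuous_on S (e n)"
  unfolding e_def[abs_def] by (rule continuous_exp_linear)

lemma fc_eq:
  assumes "continuous_on {0..period} f"
  shows "fc f n = integral {0..period} (\<lambda>t. f t * e (- n) t) / of_real period"
proof -
  have "continuous_on {0..period} (\<lambda>t. f t * e (- n) t)"
    by (intro continuous_on_mult assms e_continuous)
  from set_borel_integral_eq_integral(2)[OF borel_integrable_atLeastAtMost'[OF this]]
  show ?thesis by (simp add: fourier_coeff_def period_def e_def)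
qed

lemma integral_e: "integral {0..period} (e n) = (if n = 0 then of_real period else 0)"
proof (cases "n = 0")
  case True
  then have "e n = (\<lambda>t. 1)" by (auto simp: e_def)
  then show ?thesis using True period_pos by (simp add: scaleR_conv_of_real)
next
  case False
  let ?c = "\<i> * of_int n * of_real \<omega>"
  have c: "?c \<noteq> 0" using False om by simp
  have "((\<lambda>t. ?c * e n t) has_integral e n period - e n 0) {0..period}"
    by (rule fundamental_theorem_of_calculus) (use period_pos e_deriv in auto)
  from integral_unique[OF this] have "?c * integral {0..period} (e n) = 0"
    unfolding integral_mult_right by (simp only: e_period e_at_0 diff_self)
  then show ?thesis using c False by simp
qed

lemma e_orth: "integral {0..period} (\<lambda>t. e m t * e (- n) t) = (if m = n then of_real period else 0)"
  unfolding e_add integral_e by auto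

lemma continuous_integrable:
  fixes f :: "real \<Rightarrow> complex"
  shows "continuous_on {0..period} f \<Longrightarrow> f integrable_on {0..period}"
  by (rule integrable_continuous_real)

text \<open>S is the orthogonal projection of h onto the span of the chosen exponentials. Since h -
  S is orthogonal to S, the products of h with S and of S with S both equal the period times the sum
  of squares; expanding the nonnegative square of h - S gives the bound.\<close>

lemma bessel:
  fixes h :: "real \<Rightarrow> complex"
  assumes h: "continuous_on {0..period} h" and A: "finite A"
  shows "(\<Sum>n\<in>A. (cmod (fc h n))\<^sup>2) \<le> integral {0..period} (\<lambda>t. (cmod (h t))\<^sup>2) / period"
proof -
  let ?I = "integral {0..period}"
  let ?T = "of_real period :: complex"
  define S where "S = (\<lambda>t. \<Sum>n\<in>A. fc h n * e n t)"
  have Sc: "continuous_on {0..period} S"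
    unfolding S_def by (intro continuous_on_sum continuous_on_mult continuous_on_const e_continuous)
  note ci = continuous_integrable continuous_on_mult continuous_on_diff continuous_on_cnj continuous_on_const h Sc e_continuous
  have cS: "cnj (S t) = (\<Sum>n\<in>A. cnj (fc h n) * e (- n) t)" for t
    by (simp add: S_def cnj_e)
  have T0: "?T \<noteq> 0" using period_pos by simp
  have Ih: "?I (\<lambda>t. h t * e (- n) t) = ?T * fc h n" for n
    using T0 by (simp add: fc_eq[OF h])
  have IS: "?I (\<lambda>t. S t * e (- n) t) = ?T * fc h n" if n: "n \<in> A" for n
  proof -
    have "?I (\<lambda>t. S t * e (- n) t) = ?I (\<lambda>t. \<Sum>m\<in>A. fc h m * (e m t * e (- n) t))"
      by (simp only: S_def sum_distrib_right mult.assoc)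
    also have "\<dots> = (\<Sum>m\<in>A. ?I (\<lambda>t. fc h m * (e m t * e (- n) t)))"
      by (rule integral_sum[OF A]) (intro ci)
    also have "\<dots> = (\<Sum>m\<in>A. fc h m * (if m = n then ?T else 0))"
      by (simp only: integral_mult_right e_orth)
    also have "\<dots> = (\<Sum>m\<in>A. if m = n then fc h m * ?T else 0)"
      by (rule sum.cong) auto
    finally show ?thesis using A n by (simp add: sum.delta)
  qed
  have D: "?I (\<lambda>t. (h t - S t) * e (- n) t) = 0" if n: "n \<in> A" for n
  proof -
    have "?I (\<lambda>t. (h t - S t) * e (- n) t) = ?I (\<lambda>t. h t * e (- n) t) - ?I (\<lambda>t. S t * e (- n) t)"
      unfolding left_diff_distrib by (rule integral_diff) (intro ci)+
    then show ?thesis using Ih IS[OF n] by simp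
  qed
  have DS: "?I (\<lambda>t. (h t - S t) * cnj (S t)) = 0"
  proof -
    have "?I (\<lambda>t. (h t - S t) * cnj (S t)) = ?I (\<lambda>t. \<Sum>n\<in>A. cnj (fc h n) * ((h t - S t) * e (- n) t))"
      by (rule integral_cong) (simp only: cS sum_distrib_left mult_ac)
    also have "\<dots> = (\<Sum>n\<in>A. ?I (\<lambda>t. cnj (fc h n) * ((h t - S t) * e (- n) t)))"
      by (rule integral_sum[OF A]) (intro ci)
    also have "\<dots> = 0" by (simp only: integral_mult_right) (rule sum.neutral, simp add: D)
    finally show ?thesis .
  qed
  have Ihh: "?I (\<lambda>t. h t * cnj (S t)) = ?T * of_real (\<Sum>n\<in>A. (cmod (fc h n))\<^sup>2)"
  proof -
    have "?I (\<lambda>t. h t * cnj (S t)) = ?I (\<lambda>t. \<Sum>n\<in>A. cnj (fc h n) * (h t * e (- n) t))"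
      by (rule integral_cong) (simp only: cS sum_distrib_left mult_ac)
    also have "\<dots> = (\<Sum>n\<in>A. ?I (\<lambda>t. cnj (fc h n) * (h t * e (- n) t)))"
      by (rule integral_sum[OF A]) (intro ci)
    also have "\<dots> = (\<Sum>n\<in>A. cnj (fc h n) * (?T * fc h n))" by (simp only: integral_mult_right Ih)
    also have "\<dots> = ?T * (\<Sum>n\<in>A. of_real ((cmod (fc h n))\<^sup>2))"
      unfolding sum_distrib_left
    proof (rule sum.cong)
      fix n
      have "of_real ((cmod (fc h n))\<^sup>2) = fc h n * cnj (fc h n)" by (rule complex_norm_square)
      then show "cnj (fc h n) * (?T * fc h n) = ?T * of_real ((cmod (fc h n))\<^sup>2)" by (simp only: mult_ac)
    qed simp
    finally show ?thesis by simp
  qed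
  define R where "R = (\<lambda>t. (cmod (h t))\<^sup>2 - 2 * Re (h t * cnj (S t)) + (cmod (S t))\<^sup>2)"
  have SS: "?I (\<lambda>t. S t * cnj (S t)) = ?T * of_real (\<Sum>n\<in>A. (cmod (fc h n))\<^sup>2)"
  proof -
    have "?I (\<lambda>t. (h t - S t) * cnj (S t)) = ?I (\<lambda>t. h t * cnj (S t)) - ?I (\<lambda>t. S t * cnj (S t))"
      unfolding left_diff_distrib by (rule integral_diff) (intro ci)+
    then show ?thesis using DS Ihh by simp
  qed
  have Re_I: "?I (\<lambda>t. Re (f t)) = Re (?I f)" if "continuous_on {0..period} f" for f
    using integral_linear[OF continuous_integrable[OF that] bounded_linear_Re] by (simp add: o_def)
  have i1: "(\<lambda>t. (cmod (h t))\<^sup>2) integrable_on {0..period}"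
    by (intro integrable_continuous_real continuous_on_power continuous_on_norm h)
  have i2: "(\<lambda>t. 2 * Re (h t * cnj (S t))) integrable_on {0..period}"
    by (intro integrable_continuous_real continuous_on_mult continuous_on_const continuous_on_Re continuous_on_cnj h Sc)
  have i3: "(\<lambda>t. Re (S t * cnj (S t))) integrable_on {0..period}"
    by (intro integrable_continuous_real continuous_on_mult continuous_on_const continuous_on_Re continuous_on_cnj h Sc)
  have "0 \<le> ?I (\<lambda>t. (cmod (h t))\<^sup>2 - 2 * Re (h t * cnj (S t)) + Re (S t * cnj (S t)))"
  proof (rule integral_nonneg)
    show "(\<lambda>t. (cmod (h t))\<^sup>2 - 2 * Re (h t * cnj (S t)) + Re (S t * cnj (S t))) integrable_on {0..period}"
      by (intro integrable_add integrable_diff i1 i2 i3)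
    fix t
    have "(cmod (h t))\<^sup>2 - 2 * Re (h t * cnj (S t)) + Re (S t * cnj (S t)) = (cmod (h t - S t))\<^sup>2"
      by (simp only: cmod_power2) (simp add: power2_eq_square algebra_simps)
    then show "0 \<le> (cmod (h t))\<^sup>2 - 2 * Re (h t * cnj (S t)) + Re (S t * cnj (S t))" by simp
  qed
  also have "\<dots> = ?I (\<lambda>t. (cmod (h t))\<^sup>2) - ?I (\<lambda>t. 2 * Re (h t * cnj (S t))) + ?I (\<lambda>t. Re (S t * cnj (S t)))"
    by (simp only: integral_add[OF integrable_diff[OF i1 i2] i3] integral_diff[OF i1 i2])
  also have "?I (\<lambda>t. 2 * Re (h t * cnj (S t))) = 2 * Re (?I (\<lambda>t. h t * cnj (S t)))"
    by (simp only: integral_mult_right) (simp only: Re_I[OF continuous_on_mult[OF h continuous_on_cnj[OF Sc]]])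
  also have "?I (\<lambda>t. Re (S t * cnj (S t))) = Re (?I (\<lambda>t. S t * cnj (S t)))"
    by (rule Re_I[OF continuous_on_mult[OF Sc continuous_on_cnj[OF Sc]]])
  finally have "0 \<le> ?I (\<lambda>t. (cmod (h t))\<^sup>2) - period * (\<Sum>n\<in>A. (cmod (fc h n))\<^sup>2)"
    unfolding Ihh SS by simp
  then show ?thesis using period_pos by (simp add: pos_le_divide_eq mult.commute)
qed

text \<open>The Riemann-Lebesgue lemma along a sequence of distinct indices: by Bessel the squares
  of the coefficients are summable, and injectivity ensures that none is counted twice.\<close>

lemma fc_tendsto_0:
  assumes h: "continuous_on {0..period} h" and inj: "inj (\<sigma> :: nat \<Rightarrow> int)"
  shows "(\<lambda>n. fc h (\<sigma> n)) \<longlonglongrightarrow> 0"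
proof -
  have "(\<Sum>n<m. (cmod (fc h (\<sigma> n)))\<^sup>2) \<le> integral {0..period} (\<lambda>t. (cmod (h t))\<^sup>2) / period" for m
  proof -
    have "(\<Sum>n<m. (cmod (fc h (\<sigma> n)))\<^sup>2) = (\<Sum>n\<in>\<sigma> ` {..<m}. (cmod (fc h n))\<^sup>2)"
      by (subst sum.reindex[OF inj_on_subset[OF inj]]) auto
    then show ?thesis using bessel[OF h, of "\<sigma> ` {..<m}"] by simp
  qed
  then have "summable (\<lambda>n. (cmod (fc h (\<sigma> n)))\<^sup>2)" by (intro summableI_nonneg_bounded) auto
  then have "(\<lambda>n. (cmod (fc h (\<sigma> n)))\<^sup>2) \<longlonglongrightarrow> 0" by (rule summable_LIMSEQ_zero)
  from tendsto_real_sqrt[OF this] show ?thesis by (simp add: tendsto_norm_zero_iff)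
qed

lemma fc_deriv:
  assumes d: "\<And>t. t \<in> {0..period} \<Longrightarrow> (f has_vector_derivative f' t) (at t within {0..period})"
    and f': "continuous_on {0..period} f'" and p: "f period = f 0"
  shows "fc f' n = \<i> * of_int n * of_real \<omega> * fc f n"
proof -
  have f: "continuous_on {0..period} f" by (rule continuous_on_vector_derivative[OF d])
  let ?c = "\<i> * of_int n * of_real \<omega>"
  have "((\<lambda>t. f t * ((\<i> * of_int (- n) * of_real \<omega>) * e (- n) t) + f' t * e (- n) t) has_integral
      f period * e (- n) period - f 0 * e (- n) 0) {0..period}"
    by (rule fundamental_theorem_of_calculus, use period_pos in simp,
        intro has_vector_derivative_mult d e_deriv)
  then have 0: "integral {0..period} (\<lambda>t. f t * ((\<i> * of_int (- n) * of_real \<omega>) * e (- n) t) + f' t * e (- n) t) = 0"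
    by (simp add: e_period e_at_0 p integral_unique)
  have "(\<lambda>t. f' t * e (- n) t) = (\<lambda>t. (f t * ((\<i> * of_int (- n) * of_real \<omega>) * e (- n) t) + f' t * e (- n) t) + ?c * (f t * e (- n) t))"
    by (rule ext) (simp add: algebra_simps)
  then have "integral {0..period} (\<lambda>t. f' t * e (- n) t)
     = integral {0..period} (\<lambda>t. (f t * ((\<i> * of_int (- n) * of_real \<omega>) * e (- n) t) + f' t * e (- n) t) + ?c * (f t * e (- n) t))"
    by (rule arg_cong)
  also have "\<dots> = integral {0..period} (\<lambda>t. f t * ((\<i> * of_int (- n) * of_real \<omega>) * e (- n) t) + f' t * e (- n) t)
     + integral {0..period} (\<lambda>t. ?c * (f t * e (- n) t))"
    by (rule integral_add; intro continuous_integrable continuous_on_add continuous_on_mult continuous_on_const f f' e_continuous)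
  also have "\<dots> = ?c * integral {0..period} (\<lambda>t. f t * e (- n) t)" by (simp only: 0 integral_mult_right add_0_left)
  finally show ?thesis unfolding fc_eq[OF f] fc_eq[OF f'] by (simp only: times_divide_eq_right)
qed

lemma inverse_square_summable_int: "(\<lambda>n::int. inverse ((of_int n)\<^sup>2 :: real)) summable_on UNIV"
proof -
  have s: "summable (\<lambda>n. inverse ((of_nat n)\<^sup>2 :: real))" by (rule inverse_power_summable) simp
  have 1: "(\<lambda>n::int. inverse ((of_int n)\<^sup>2 :: real)) summable_on range int"
    by (subst summable_on_reindex) (use s in \<open>auto simp: o_def intro!: norm_summable_imp_summable_on\<close>)
  have inj: "inj (\<lambda>n. - int n)" by (auto simp: inj_def)
  have 2: "(\<lambda>n::int. inverse ((of_int n)\<^sup>2 :: real)) summable_on range (\<lambda>n. - int n)"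
    by (subst summable_on_reindex[OF inj]) (use s in \<open>auto simp: o_def intro!: norm_summable_imp_summable_on\<close>)
  have "range int \<union> range (\<lambda>n. - int n) = UNIV"
  proof -
    have "n \<in> range int \<union> range (\<lambda>n. - int n)" for n :: int
      by (cases n rule: int_cases2) auto
    then show ?thesis by blast
  qed
  with summable_on_union[OF 1 2] show ?thesis by simp
qed

text \<open>For n not 0 the coefficient is that of \<open>f'\<close> divided by a number of modulus
  \<open>\<bar>n\<bar> * \<omega>\<close>. A product is at most the sum of the squares of its
  factors, and both are summable: the first by Bessel for \<open>f'\<close>, the second like 1/n^2.
  The index 0 is a single term, added at the end.\<close>

lemma fc_abs_summable:
  assumes d: "\<And>t. t \<in> {0..period} \<Longrightarrow> (f has_vector_derivative f' t) (at t within {0..period})"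
    and f': "continuous_on {0..period} f'" and p: "f period = f 0"
  shows "(\<lambda>n. cmod (fc f n)) summable_on UNIV"
proof -
  have s1: "(\<lambda>n. (cmod (fc f' n))\<^sup>2) summable_on UNIV"
    by (rule nonneg_bounded_partial_sums_imp_summable_on, simp,
        rule eventually_finite_subsets_at_top_weakI, rule bessel[OF f'])
  have s2: "(\<lambda>n::int. (1 / \<omega>\<^sup>2) * inverse ((of_int n)\<^sup>2 :: real)) summable_on UNIV"
    by (rule summable_on_cmult_right[OF inverse_square_summable_int])
  have "(\<lambda>n. cmod (fc f n)) summable_on (UNIV - {0})"
  proof (rule summable_on_comparison_test)
    show "(\<lambda>n::int. (cmod (fc f' n))\<^sup>2 + (1 / \<omega>\<^sup>2) * inverse ((of_int n)\<^sup>2 :: real)) summable_on (UNIV - {0})"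
      by (rule summable_on_subset[OF summable_on_add[OF s1 s2]]) auto
    fix n :: int assume "n \<in> UNIV - {0}"
    then have n: "n \<noteq> 0" by simp
    define r where "r = 1 / (\<bar>of_int n\<bar> * \<omega>)"
    have D: "fc f' n = \<i> * of_int n * of_real \<omega> * fc f n" by (rule fc_deriv[OF d f' p])
    have "cmod (fc f' n) = cmod (\<i> * of_int n * of_real \<omega> * fc f n)" by (simp only: D)
    also have "\<dots> = \<bar>of_int n\<bar> * \<omega> * cmod (fc f n)" using om by (simp add: norm_mult)
    finally have "cmod (fc f' n) = \<bar>of_int n\<bar> * \<omega> * cmod (fc f n)" .
    then have "cmod (fc f n) = cmod (fc f' n) * r" using n om by (simp add: r_def)
    also have "\<dots> \<le> (cmod (fc f' n))\<^sup>2 + r\<^sup>2"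
    proof -
      have "2 * cmod (fc f' n) * r \<le> (cmod (fc f' n))\<^sup>2 + r\<^sup>2" by (rule sum_squares_bound)
      moreover have "0 \<le> cmod (fc f' n) * r" using om by (simp add: r_def)
      ultimately show ?thesis by linarith
    qed
    also have "r\<^sup>2 = (1 / \<omega>\<^sup>2) * inverse ((of_int n)\<^sup>2)"
      by (simp add: r_def power_divide power_mult_distrib inverse_eq_divide)
    finally show "cmod (fc f n) \<le> (cmod (fc f' n))\<^sup>2 + (1 / \<omega>\<^sup>2) * inverse ((of_int n)\<^sup>2)" .
  qed simp
  then have "(\<lambda>n. cmod (fc f n)) summable_on insert 0 (UNIV - {0})" by (simp only: summable_on_insert_iff)
  then show ?thesis by (simp add: insert_Diff_if)
qed

lemma filterlim_symmetric_intervals: "filterlim (\<lambda>K. {- int K..int K}) (finite_subsets_at_top UNIV) sequentially"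
  unfolding filterlim_finite_subsets_at_top
proof (intro allI impI)
  fix X :: "int set" assume "finite X \<and> X \<subseteq> UNIV"
  then have X: "finite X" by simp
  define K0 where "K0 = (\<Sum>x\<in>X. nat \<bar>x\<bar>)"
  have "X \<subseteq> {- int K..int K}" if "K0 \<le> K" for K
  proof
    fix x assume "x \<in> X"
    then have "nat \<bar>x\<bar> \<le> K0" unfolding K0_def by (intro member_le_sum) (use X in auto)
    then show "x \<in> {- int K..int K}" using that by auto
  qed
  then show "\<forall>\<^sub>F K in sequentially. finite {- int K..int K} \<and> X \<subseteq> {- int K..int K} \<and> {- int K..int K} \<subseteq> UNIV"
    unfolding eventually_sequentially by blast
qed

text \<open>Chernoff's argument: dividing \<open>f - f 0\<close> by \<open>e\<^sup>i\<^sup>\<omega>\<^sup>t - 1\<close> leaves a continuous function, whose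
  Fourier coefficients make the partial sums of the series of \<open>f\<close> at \<open>0\<close> telescope.\<close>
lemma fourier_series_at_0:
  assumes d: "\<And>t. t \<in> {0..period} \<Longrightarrow> (f has_vector_derivative f' t) (at t within {0..period})"
    and f': "continuous_on {0..period} f'" and p: "f period = f 0"
  shows "(fc f has_sum f 0) UNIV"
proof -
  have f: "continuous_on {0..period} f" by (rule continuous_on_vector_derivative[OF d])
  \<comment> \<open>At both ends of the period numerator and denominator of the quotient vanish; the
    value assigned there is the limit, a quotient of derivatives.\<close>
  define g where "g = (\<lambda>t. if t = 0 then f' 0 / (\<i> * of_real \<omega>) else if t = period then f' period / (\<i> * of_real \<omega>)
     else (f t - f 0) / (e 1 t - 1))"
  have e1: "e 1 t \<noteq> 1" if "0 < t" "t < period" for t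
  proof
    assume "e 1 t = 1"
    then obtain n :: int where n: "\<omega> * t = of_int (2 * n) * pi"
      unfolding e_def exp_eq_1 by auto
    have "0 < \<omega> * t" "\<omega> * t < 2 * pi" using that om by (simp_all add: period_def pos_less_divide_eq mult.commute)
    then have "0 < of_int (2 * n) * pi" "of_int (2 * n) * pi < 2 * pi" using n by simp_all
    then have "0 < n" "n < 1" by (simp_all add: zero_less_mult_iff)
    then show False by simp
  qed
  have lim: "((\<lambda>t. (f t - f 0) / (e 1 t - 1)) \<longlongrightarrow> f' a / (\<i> * of_real \<omega>)) (at a within {0..period})"
    if a: "a = 0 \<or> a = period" for a
  proof -
    have aI: "a \<in> {0..period}" using a period_pos by auto
    have fa: "f a = f 0" and ea: "e 1 a = 1" using a p e_at_0 e_period by auto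
    have q1: "((\<lambda>t. (f t - f a) / of_real (t - a)) \<longlongrightarrow> f' a) (at a within {0..period})"
      by (rule has_vector_derivative_quotient[OF d[OF aI]])
    have q2: "((\<lambda>t. (e 1 t - e 1 a) / of_real (t - a)) \<longlongrightarrow> \<i> * of_real \<omega>) (at a within {0..period})"
      using has_vector_derivative_quotient[OF e_deriv[of 1 a "{0..period}"]] by (simp add: ea)
    have "((\<lambda>t. ((f t - f a) / of_real (t - a)) / ((e 1 t - e 1 a) / of_real (t - a))) \<longlongrightarrow> f' a / (\<i> * of_real \<omega>)) (at a within {0..period})"
      by (rule tendsto_divide[OF q1 q2]) (use om in simp)
    moreover have "\<forall>\<^sub>F t in at a within {0..period}. ((f t - f a) / of_real (t - a)) / ((e 1 t - e 1 a) / of_real (t - a)) = (f t - f 0) / (e 1 t - 1)"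
      unfolding eventually_at_filter by (rule always_eventually) (auto simp: fa ea)
    ultimately show ?thesis by (rule Lim_transform_eventually)
  qed
  have gc: "continuous_on {0..period} g"
    unfolding continuous_on_def
  proof
    fix a assume a: "a \<in> {0..period}"
    have g_ev: "(g \<longlongrightarrow> L) (at a within {0..period})"
      if "((\<lambda>t. (f t - f 0) / (e 1 t - 1)) \<longlongrightarrow> L) (at a within {0..period})" for L
    proof (rule Lim_transform_eventually[OF that])
      have "\<forall>\<^sub>F t in at a within {0..period}. t \<noteq> 0" "\<forall>\<^sub>F t in at a within {0..period}. t \<noteq> period"
        by (rule eventually_neq_at_within)+
      then show "\<forall>\<^sub>F t in at a within {0..period}. (f t - f 0) / (e 1 t - 1) = g t"
        by eventually_elim (simp add: g_def)
    qed
    show "(g \<longlongrightarrow> g a) (at a within {0..period})"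
    proof (cases "a = 0 \<or> a = period")
      case True
      have "g a = f' a / (\<i> * of_real \<omega>)" using True by (auto simp: g_def)
      then show ?thesis using g_ev[OF lim[OF True]] by simp
    next
      case False
      have "((\<lambda>t. (f t - f 0) / (e 1 t - 1)) \<longlongrightarrow> (f a - f 0) / (e 1 a - 1)) (at a within {0..period})"
      proof (intro tendsto_divide tendsto_diff tendsto_const)
        show "(f \<longlongrightarrow> f a) (at a within {0..period})" using f a by (simp add: continuous_on_def)
        show "(e 1 \<longlongrightarrow> e 1 a) (at a within {0..period})"
          using e_continuous[of "{0..period}" 1] a by (simp add: continuous_on_def)
        show "e 1 a - 1 \<noteq> 0" using e1[of a] False a by auto
      qed
      moreover have "g a = (f a - f 0) / (e 1 a - 1)" using False by (simp add: g_def)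
      ultimately show ?thesis using g_ev by simp
    qed
  qed
  have fg: "f t = f 0 + (e 1 t * g t - g t)" if t: "t \<in> {0..period}" for t
  proof (cases "t = 0 \<or> t = period")
    case True
    then have "f t = f 0" "e 1 t = 1" using p e_at_0 e_period by auto
    then show ?thesis by simp
  next
    case False
    then have "e 1 t - 1 \<noteq> 0" using e1[of t] t by auto
    moreover have "g t = (f t - f 0) / (e 1 t - 1)" using False by (simp add: g_def)
    ultimately have "(e 1 t - 1) * g t = f t - f 0" by simp
    then show ?thesis by (simp add: algebra_simps)
  qed
  \<comment> \<open>Multiplication by \<open>e 1\<close> shifts the index of a Fourier coefficient
    by one, so f - f 0 = (e 1 - 1) g becomes a difference of neighbouring coefficients of g.\<close>
  have tele: "fc f n = f 0 * (if n = 0 then 1 else 0) + (fc g (n - 1) - fc g n)" for n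
  proof -
    have c: "continuous_on {0..period} (\<lambda>t. f 0 * e (- n) t)" "continuous_on {0..period} (\<lambda>t. g t * e (- (n - 1)) t)"
      "continuous_on {0..period} (\<lambda>t. g t * e (- n) t)"
      by (intro continuous_on_mult continuous_on_const gc e_continuous)+
    note i = c[THEN continuous_integrable]
    have "integral {0..period} (\<lambda>t. f t * e (- n) t)
       = integral {0..period} (\<lambda>t. f 0 * e (- n) t + (g t * e (- (n - 1)) t - g t * e (- n) t))"
    proof (rule integral_cong)
      fix t assume t: "t \<in> {0..period}"
      have "e 1 t * e (- n) t = e (- (n - 1)) t" by (simp add: e_add)
      moreover have "(f 0 + (e 1 t * g t - g t)) * e (- n) t = f 0 * e (- n) t + (g t * (e 1 t * e (- n) t) - g t * e (- n) t)"
      proof -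
        have "(x + (a * y - y)) * b = x * b + (y * (a * b) - y * b)" for a b x y :: complex
          by (simp add: algebra_simps)
        then show ?thesis .
      qed
      ultimately have "(f 0 + (e 1 t * g t - g t)) * e (- n) t = f 0 * e (- n) t + (g t * e (- (n - 1)) t - g t * e (- n) t)"
        by (simp only:)
      then show "f t * e (- n) t = f 0 * e (- n) t + (g t * e (- (n - 1)) t - g t * e (- n) t)"
        by (subst fg[OF t])
    qed
    also have "\<dots> = integral {0..period} (\<lambda>t. f 0 * e (- n) t) + (integral {0..period} (\<lambda>t. g t * e (- (n - 1)) t) - integral {0..period} (\<lambda>t. g t * e (- n) t))"
      by (simp only: integral_add[OF i(1) integrable_diff[OF i(2,3)]] integral_diff[OF i(2,3)])
    also have "integral {0..period} (\<lambda>t. f 0 * e (- n) t) = f 0 * (if n = 0 then of_real period else 0)"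
      by (simp only: integral_mult_right integral_e) simp
    finally show ?thesis using period_pos
      by (simp add: fc_eq[OF f] fc_eq[OF gc] add_divide_distrib diff_divide_distrib)
  qed
  have part: "(\<Sum>n\<in>{- int K..int K}. fc f n) = f 0 + (fc g (- int K - 1) - fc g (int K))" for K
  proof (induction K)
    case 0
    then show ?case by (simp add: tele)
  next
    case (Suc K)
    have "{- int (Suc K)..int (Suc K)} = insert (int (Suc K)) (insert (- int (Suc K)) {- int K..int K})" by auto
    then have "(\<Sum>n\<in>{- int (Suc K)..int (Suc K)}. fc f n) = fc f (int (Suc K)) + (fc f (- int (Suc K)) + (\<Sum>n\<in>{- int K..int K}. fc f n))"
      by simp
    also have "\<dots> = f 0 + (fc g (- int (Suc K) - 1) - fc g (int (Suc K)))"
      unfolding Suc by (simp add: tele algebra_simps) (rule arg_cong[where f="fc g"], simp)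
    finally show ?case .
  qed
  have "(\<lambda>K. f 0 + (fc g (- int K - 1) - fc g (int K))) \<longlonglongrightarrow> f 0 + (0 - 0)"
    by (intro tendsto_add tendsto_const tendsto_diff fc_tendsto_0[OF gc, where \<sigma>="\<lambda>K. - int K - 1"] fc_tendsto_0[OF gc])
       (auto simp: inj_def)
  then have l1: "(\<lambda>K. sum (fc f) {- int K..int K}) \<longlonglongrightarrow> f 0" by (simp add: part)
  \<comment> \<open>Convergence of symmetric partial sums would not give \<open>has_sum\<close>.
    Absolute summability provides an unconditional sum, and the symmetric sums then identify its
    value.\<close>
  have "fc f summable_on UNIV"
    by (rule abs_summable_summable[OF fc_abs_summable[OF d f' p]])
  then obtain S where S: "(fc f has_sum S) UNIV" by (auto simp: summable_on_def)
  then have "(\<lambda>K. sum (fc f) {- int K..int K}) \<longlonglongrightarrow> S"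
    unfolding has_sum_def by (rule filterlim_compose[OF _ filterlim_symmetric_intervals])
  then have "S = f 0" by (rule LIMSEQ_unique[OF _ l1])
  then show ?thesis using S by simp
qed

end

section \<open>Fourier coefficients of translates and triple products\<close>

context trig
begin

lemma fc_shift:
  assumes f: "continuous_on {0..} f" and p: "\<And>t. 0 \<le> t \<Longrightarrow> f (t + period) = f t"
    and a: "0 \<le> a" "a \<le> period"
  shows "fc (\<lambda>t. f (t + a)) n = e n a * fc f n"
proof -
  define h where "h = (\<lambda>t. f t * e (- n) t)"
  have hc: "continuous_on {x..y} h" if "0 \<le> x" for x y
    unfolding h_def by (intro continuous_on_mult e_continuous continuous_on_subset[OF f]) (use that in auto)
  have hi: "h integrable_on {x..y}" if "0 \<le> x" for x y
    by (rule integrable_continuous_real[OF hc[OF that]])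
  have hp: "h (t + period) = h t" if "0 \<le> t" for t
    by (simp add: h_def p[OF that] e_shift e_period)
  have "integral {0..period} (\<lambda>t. f (t + a) * e (- n) t) = integral {0..period} (\<lambda>t. e n a * (h \<circ> (\<lambda>t. t + a)) t)"
  proof (rule integral_cong)
    fix t
    have "e n a * e (- n) a = 1" by (simp add: e_add e_0)
    then show "f (t + a) * e (- n) t = e n a * (h \<circ> (\<lambda>t. t + a)) t"
      by (simp add: h_def e_shift mult_ac)
  qed
  also have "\<dots> = e n a * integral {0..period} (h \<circ> (\<lambda>t. t + a))" by (rule integral_mult_right)
  also have "integral {0..period} (h \<circ> (\<lambda>t. t + a)) = integral {0 + a..period + a} h"
    by (rule integral_shift[OF hc]) (use a in simp)
  also have "\<dots> = integral {a..period} h + integral {period..period + a} h"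
    using Henstock_Kurzweil_Integration.integral_combine[of a period "period + a" h] a hi[of a] by simp
  also have "integral {period..period + a} h = integral {0..a} h"
  proof -
    have "integral {0..a} (h \<circ> (\<lambda>t. t + period)) = integral {0 + period..a + period} h"
      by (rule integral_shift[OF hc]) (use period_pos in simp)
    moreover have "integral {0..a} (h \<circ> (\<lambda>t. t + period)) = integral {0..a} h"
      by (rule integral_cong) (simp add: hp)
    ultimately show ?thesis by (simp add: add.commute)
  qed
  also have "integral {a..period} h + integral {0..a} h = integral {0..period} h"
    using Henstock_Kurzweil_Integration.integral_combine[of 0 a period h] a hi[of 0] by (simp add: add.commute)
  finally have *: "integral {0..period} (\<lambda>t. f (t + a) * e (- n) t) = e n a * integral {0..period} h" .
  have c1: "continuous_on {0..period} (\<lambda>t. f (t + a))"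
    by (rule continuous_on_compose2[OF f]) (use a in \<open>auto intro!: continuous_intros\<close>)
  have c2: "continuous_on {0..period} f" by (rule continuous_on_subset[OF f]) auto
  show ?thesis using * by (simp add: fc_eq[OF c1] fc_eq[OF c2] h_def)
qed

text \<open>Translating f by a multiplies its coefficients by \<open>e n a\<close>, so the series at
  a is the series of the translate at 0.\<close>

lemma fourier_series:
  assumes d: "\<And>t. 0 \<le> t \<Longrightarrow> (f has_vector_derivative f' t) (at t within {0..})"
    and f': "continuous_on {0..} f'" and p: "\<And>t. 0 \<le> t \<Longrightarrow> f (t + period) = f t"
    and a: "a \<in> {0..period}"
  shows "((\<lambda>n. fc f n * e n a) has_sum f a) UNIV" and "(\<lambda>n. cmod (fc f n)) summable_on UNIV"
proof -
  have f: "continuous_on {0..} f" by (rule continuous_on_vector_derivative[OF d]) simp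
  have a0: "0 \<le> a" "a \<le> period" using a by auto
  have sh: "((\<lambda>t. f (t + a)) has_vector_derivative f' (t + a)) (at t within {0..period})" if t: "t \<in> {0..period}" and a: "0 \<le> a" for t a
  proof -
    have 1: "((\<lambda>t. t + a) has_vector_derivative 1) (at t within {0..period})"
      unfolding has_real_derivative_iff_has_vector_derivative[symmetric]
      by (auto intro!: derivative_eq_intros)
    have 2: "(f has_vector_derivative f' (t + a)) (at (t + a) within (\<lambda>t. t + a) ` {0..period})"
      by (rule has_vector_derivative_within_subset[OF d]) (use t a in auto)
    from vector_diff_chain_within[OF 1 2] show ?thesis by (simp add: o_def)
  qed
  have c': "continuous_on {0..period} (\<lambda>t. f' (t + a))" if "0 \<le> a" for a
    by (rule continuous_on_compose2[OF f']) (use that in \<open>auto intro!: continuous_intros\<close>)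
  have "(fc (\<lambda>t. f (t + a)) has_sum f (0 + a)) UNIV"
    by (rule fourier_series_at_0[OF sh[OF _ a0(1)] c'[OF a0(1)]]) (use p[OF a0(1)] in \<open>simp_all add: add.commute\<close>)
  then show "((\<lambda>n. fc f n * e n a) has_sum f a) UNIV"
  proof -
    have "fc (\<lambda>t. f (t + a)) n = e n a * fc f n" for n by (rule fc_shift[OF f p a0])
    then have "fc (\<lambda>t. f (t + a)) = (\<lambda>n. fc f n * e n a)"
      by (intro ext) (simp only: mult.commute)
    with \<open>(fc (\<lambda>t. f (t + a)) has_sum f (0 + a)) UNIV\<close> show ?thesis by (simp only: add_0_left)
  qed
  show "(\<lambda>n. cmod (fc f n)) summable_on UNIV"
    by (rule fc_abs_summable[OF sh[OF _ order.refl, unfolded add_0_right] c'[OF order.refl, unfolded add_0_right]])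
       (use p[of 0] in simp_all)
qed

text \<open>Absolute summability is required of Y and Z only; X is merely continuous, as is all that
  is known of g_1N. The double series for YZ converges uniformly, so it may be integrated term by
  term against the conjugate of X, and each term produces one Fourier coefficient of X.\<close>

lemma fc_product:
  assumes X: "continuous_on {0..period} X" and Y: "continuous_on {0..period} Y" and Z: "continuous_on {0..period} Z"
    and Ys: "\<And>t. t \<in> {0..period} \<Longrightarrow> ((\<lambda>m. y m * e m t) has_sum Y t) UNIV" and ys: "(\<lambda>m. cmod (y m)) summable_on UNIV"
    and Zs: "\<And>t. t \<in> {0..period} \<Longrightarrow> ((\<lambda>m. z m * e m t) has_sum Z t) UNIV" and zs: "(\<lambda>m. cmod (z m)) summable_on UNIV"
  shows "((\<lambda>(l, m). cnj (fc X l) * y m * z (n + l - m)) has_sum fc (\<lambda>t. cnj (X t) * Y t * Z t) n) UNIV"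
proof -
  have "compact (X ` {0..period})" by (rule compact_continuous_image[OF X compact_Icc])
  then have "bounded (X ` {0..period})" by (rule compact_imp_bounded)
  then obtain B where B: "0 < B" "\<And>t. t \<in> {0..period} \<Longrightarrow> cmod (X t) \<le> B"
    unfolding bounded_pos by auto
  have yz: "(\<lambda>s. cmod (y (fst s)) * cmod (z (snd s))) summable_on UNIV"
  proof -
    have "(\<lambda>s. norm (y (fst s) * z (snd s))) summable_on (Sigma UNIV (\<lambda>_. UNIV))"
      unfolding Infinite_Sum.abs_summable_on_Sigma_iff
    proof (intro conjI ballI)
      show "(\<lambda>p. norm (y (fst (m, p)) * z (snd (m, p)))) summable_on UNIV" for m
        using summable_on_cmult_right[OF zs, of "cmod (y m)"] by (simp add: norm_mult)
      have "(\<lambda>m. cmod (y m) * infsum (\<lambda>p. cmod (z p)) UNIV) summable_on UNIV"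
        by (rule summable_on_cmult_left[OF ys])
      moreover have "norm (infsum (\<lambda>p. norm (y (fst (m, p)) * z (snd (m, p)))) UNIV)
          = cmod (y m) * infsum (\<lambda>p. cmod (z p)) UNIV" for m
      proof -
        have "0 \<le> infsum (\<lambda>p. cmod (z p)) UNIV" by (rule infsum_nonneg) simp
        then show ?thesis by (simp add: norm_mult infsum_cmult_right')
      qed
      ultimately show "(\<lambda>m. norm (infsum (\<lambda>p. norm (y (fst (m, p)) * z (snd (m, p)))) UNIV)) summable_on UNIV"
        by (simp only:)
    qed
    then show ?thesis by (simp only: UNIV_Times_UNIV norm_mult)
  qed
  define F where "F = (\<lambda>s t. cnj (X t) * e (- n) t * ((y (fst s) * e (fst s) t) * (z (snd s) * e (snd s) t)))"
  define G where "G = (\<lambda>t. cnj (X t) * e (- n) t * (Y t * Z t))"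
  have YZ: "((\<lambda>s. (y (fst s) * e (fst s) t) * (z (snd s) * e (snd s) t)) has_sum Y t * Z t) UNIV" if t: "t \<in> {0..period}" for t
  proof -
    have "((\<lambda>s. (y (fst s) * e (fst s) t) * (z (snd s) * e (snd s) t)) has_sum Y t * Z t) (Sigma UNIV (\<lambda>_. UNIV))"
    proof (rule has_sum_SigmaI)
      show "((\<lambda>p. (y (fst (m, p)) * e (fst (m, p)) t) * (z (snd (m, p)) * e (snd (m, p)) t)) has_sum (y m * e m t) * Z t) UNIV" for m
        using has_sum_cmult_right[OF Zs[OF t], of "y m * e m t"] by simp
      show "((\<lambda>m. (y m * e m t) * Z t) has_sum Y t * Z t) UNIV"
        by (rule has_sum_cmult_left[OF Ys[OF t]])
      have "(\<lambda>s. norm ((y (fst s) * e (fst s) t) * (z (snd s) * e (snd s) t))) summable_on UNIV"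
        using yz by (simp add: norm_mult norm_e)
      from abs_summable_summable[OF this]
      show "(\<lambda>s. (y (fst s) * e (fst s) t) * (z (snd s) * e (snd s) t)) summable_on (Sigma UNIV (\<lambda>_. UNIV))"
        by (simp add: UNIV_Times_UNIV)
    qed
    then show ?thesis by (simp add: UNIV_Times_UNIV)
  qed
  have ul: "uniform_limit {0..period} (\<lambda>S t. \<Sum>s\<in>S. F s t) G (finite_subsets_at_top UNIV)"
  proof (rule Weierstrass_m_test_general'[where M="\<lambda>s. B * (cmod (y (fst s)) * cmod (z (snd s)))"])
    show "norm (F s t) \<le> B * (cmod (y (fst s)) * cmod (z (snd s)))" if "t \<in> {0..period}" for s t
      unfolding F_def norm_mult norm_e complex_mod_cnj mult_1_right
      by (rule mult_right_mono[OF B(2)[OF that]]) simp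
    show "((\<lambda>s. F s t) has_sum G t) UNIV" if "t \<in> {0..period}" for t
      unfolding F_def G_def by (rule has_sum_cmult_right[OF YZ[OF that]])
    show "(\<lambda>s. B * (cmod (y (fst s)) * cmod (z (snd s)))) summable_on UNIV"
      by (rule summable_on_cmult_right[OF yz])
  qed
  have Fc: "continuous_on {0..period} (F s)" for s
    unfolding F_def by (intro continuous_on_mult continuous_on_cnj continuous_on_const X e_continuous)
  have "\<exists>I J. (\<forall>S. ((\<lambda>t. \<Sum>s\<in>S. F s t) has_integral I S) {0..period}) \<and>
     (G has_integral J) {0..period} \<and> (I \<longlongrightarrow> J) (finite_subsets_at_top UNIV)"
  proof (rule uniform_limit_integral[OF ul])
    show "continuous_on {0..period} (\<lambda>t. \<Sum>s\<in>S. F s t)" for S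
      by (rule continuous_on_sum[OF Fc])
    show "finite_subsets_at_top UNIV \<noteq> (bot :: (int \<times> int) set filter)" by simp
    fix I J assume IJ: "\<And>S. ((\<lambda>t. \<Sum>s\<in>S. F s t) has_integral I S) {0..period}"
      "(G has_integral J) {0..period}" "(I \<longlongrightarrow> J) (finite_subsets_at_top UNIV)"
    show "\<exists>I J. (\<forall>S. ((\<lambda>t. \<Sum>s\<in>S. F s t) has_integral I S) {0..period}) \<and>
     (G has_integral J) {0..period} \<and> (I \<longlongrightarrow> J) (finite_subsets_at_top UNIV)"
      by (rule exI[of _ I], rule exI[of _ J]) (intro conjI allI IJ)
  qed
  then obtain I where "\<exists>J. (\<forall>S. ((\<lambda>t. \<Sum>s\<in>S. F s t) has_integral I S) {0..period}) \<and>
     (G has_integral J) {0..period} \<and> (I \<longlongrightarrow> J) (finite_subsets_at_top UNIV)" by (rule exE)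
  then obtain J where IJ: "(\<forall>S. ((\<lambda>t. \<Sum>s\<in>S. F s t) has_integral I S) {0..period}) \<and>
     (G has_integral J) {0..period} \<and> (I \<longlongrightarrow> J) (finite_subsets_at_top UNIV)" by (rule exE)
  note I = IJ[THEN conjunct1, THEN spec] and J = IJ[THEN conjunct2, THEN conjunct1]
    and lim = IJ[THEN conjunct2, THEN conjunct2]
  have T0: "of_real period \<noteq> (0::complex)" using period_pos by simp
  have int_F: "integral {0..period} (F s) = of_real period * (cnj (fc X (fst s + snd s - n)) * y (fst s) * z (snd s))" for s
  proof -
    have "integral {0..period} (F s) = integral {0..period} (\<lambda>t. (y (fst s) * z (snd s)) * cnj (X t * e (- (fst s + snd s - n)) t))"
    proof (rule integral_cong)
      fix t
      have "cnj (e (- (fst s + snd s - n)) t) = e (- n) t * (e (fst s) t * e (snd s) t)"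
        by (simp add: cnj_e e_add algebra_simps)
      then show "F s t = (y (fst s) * z (snd s)) * cnj (X t * e (- (fst s + snd s - n)) t)"
        by (simp add: F_def mult_ac)
    qed
    also have "\<dots> = (y (fst s) * z (snd s)) * integral {0..period} (\<lambda>t. cnj (X t * e (- (fst s + snd s - n)) t))"
      by (rule integral_mult_right)
    also have "integral {0..period} (\<lambda>t. cnj (X t * e (- (fst s + snd s - n)) t)) = cnj (integral {0..period} (\<lambda>t. X t * e (- (fst s + snd s - n)) t))"
      by (rule integral_cnj[symmetric])
    also have "integral {0..period} (\<lambda>t. X t * e (- (fst s + snd s - n)) t) = of_real period * fc X (fst s + snd s - n)"
      using T0 by (simp add: fc_eq[OF X])
    finally show ?thesis by (simp add: mult_ac)
  qed
  have IS: "I S = of_real period * (\<Sum>s\<in>S. cnj (fc X (fst s + snd s - n)) * y (fst s) * z (snd s))" if S: "finite S" for S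
  proof -
    have "((\<lambda>t. \<Sum>s\<in>S. F s t) has_integral (\<Sum>s\<in>S. integral {0..period} (F s))) {0..period}"
      by (rule has_integral_sum[OF S]) (intro integrable_integral continuous_integrable Fc)
    from has_integral_unique[OF I this] show ?thesis by (simp only: int_F sum_distrib_left)
  qed
  have "((\<lambda>S. I S / of_real period) \<longlongrightarrow> J / of_real period) (finite_subsets_at_top UNIV)"
    by (rule tendsto_divide[OF lim tendsto_const T0])
  moreover have "\<forall>\<^sub>F S in finite_subsets_at_top UNIV. I S / of_real period = (\<Sum>s\<in>S. cnj (fc X (fst s + snd s - n)) * y (fst s) * z (snd s))"
    by (rule eventually_finite_subsets_at_top_weakI) (use period_pos in \<open>simp add: IS\<close>)
  ultimately have hs: "((\<lambda>s. cnj (fc X (fst s + snd s - n)) * y (fst s) * z (snd s)) has_sum J / of_real period) UNIV"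
    unfolding has_sum_def by (rule Lim_transform_eventually)
  have "J / of_real period = fc (\<lambda>t. cnj (X t) * Y t * Z t) n"
  proof -
    have c: "continuous_on {0..period} (\<lambda>t. cnj (X t) * Y t * Z t)"
      by (intro continuous_on_mult continuous_on_cnj X Y Z)
    have "integral {0..period} (\<lambda>t. cnj (X t) * Y t * Z t * e (- n) t) = J"
      using integral_unique[OF J] by (simp add: G_def mult_ac)
    then show ?thesis by (simp add: fc_eq[OF c])
  qed
  moreover
  \<comment> \<open>Passes from the indices (m, p) of Y and Z to (l, m), where l = m + p - n is the
    index of X, that is p = n + l - m.\<close>
  have bij: "bij_betw (\<lambda>(l, m). (m, n + l - m)) (UNIV :: (int \<times> int) set) UNIV"
    by (rule bij_betw_byWitness[where f'="\<lambda>(m, p). (m + p - n, m)"]) auto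
  have "((\<lambda>q. (\<lambda>s. cnj (fc X (fst s + snd s - n)) * y (fst s) * z (snd s)) ((\<lambda>(l, m). (m, n + l - m)) q))
     has_sum J / of_real period) UNIV"
    by (rule has_sum_reindex_bij_betw[OF bij, THEN iffD2, OF hs])
  ultimately show ?thesis by (simp add: case_prod_unfold)
qed

text \<open>As \<open>infsum\<close> is 0 on families that are not summable, the value of
  \<open>tri\<close> has to be justified: \<open>fc_product\<close> gives a genuine
  \<open>has_sum\<close> for each triple of orders, and there are finitely many of these.\<close>

lemma fc_coef3:
  assumes X: "\<And>i. 1 \<le> i \<Longrightarrow> i < N \<Longrightarrow> continuous_on {0..period} (X i)"
    and Y: "\<And>i. 1 \<le> i \<Longrightarrow> i < N \<Longrightarrow> continuous_on {0..period} (Y i)"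
    and Z: "\<And>i. 1 \<le> i \<Longrightarrow> i < N \<Longrightarrow> continuous_on {0..period} (Z i)"
    and Ys: "\<And>i t. 1 \<le> i \<Longrightarrow> i < N \<Longrightarrow> t \<in> {0..period} \<Longrightarrow> ((\<lambda>m. y i m * e m t) has_sum Y i t) UNIV"
    and ys: "\<And>i. 1 \<le> i \<Longrightarrow> i < N \<Longrightarrow> (\<lambda>m. cmod (y i m)) summable_on UNIV"
    and Zs: "\<And>i t. 1 \<le> i \<Longrightarrow> i < N \<Longrightarrow> t \<in> {0..period} \<Longrightarrow> ((\<lambda>m. z i m * e m t) has_sum Z i t) UNIV"
    and zs: "\<And>i. 1 \<le> i \<Longrightarrow> i < N \<Longrightarrow> (\<lambda>m. cmod (z i m)) summable_on UNIV"
    and x: "\<And>i l. 1 \<le> i \<Longrightarrow> i < N \<Longrightarrow> x i l = fc (X i) l"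
  shows "fc (\<lambda>t. coef3 (\<lambda>i. cnj (X i t)) (\<lambda>i. Y i t) (\<lambda>i. Z i t) N) n = tri (\<lambda>i l. cnj (x i l)) y z n N"
proof -
  let ?f = "\<lambda>s t. cnj (X (fst s) t) * Y (fst (snd s)) t * Z (snd (snd s)) t"
  let ?g = "\<lambda>s (l, m). cnj (x (fst s) l) * y (fst (snd s)) m * z (snd (snd s)) (n + l - m)"
  have s: "1 \<le> fst s \<and> fst s < N \<and> 1 \<le> fst (snd s) \<and> fst (snd s) < N \<and> 1 \<le> snd (snd s) \<and> snd (snd s) < N" if "s \<in> idx3 N" for s
    using that idx3D by (cases s) auto
  have fc_s: "continuous_on {0..period} (?f s)" if "s \<in> idx3 N" for s
    by (intro continuous_on_mult continuous_on_cnj X Y Z) (use s[OF that] in auto)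
  have hs: "(?g s has_sum fc (?f s) n) UNIV" if "s \<in> idx3 N" for s
  proof -
    have "((\<lambda>(l, m). cnj (fc (X (fst s)) l) * y (fst (snd s)) m * z (snd (snd s)) (n + l - m)) has_sum fc (?f s) n) UNIV"
      by (rule fc_product[where X="X (fst s)" and Y="Y (fst (snd s))" and Z="Z (snd (snd s))"])
         (rule X Y Z Ys ys Zs zs; use s[OF that] in auto)+
    then show ?thesis using s[OF that] by (simp add: x)
  qed
  have sum: "((\<lambda>q. \<Sum>s\<in>A. ?g s q) has_sum (\<Sum>s\<in>A. fc (?f s) n)) UNIV" if "finite A" "A \<subseteq> idx3 N" for A
    using that
  proof (induction A rule: finite_induct)
    case (insert s A)
    then show ?case using has_sum_add[OF hs[of s]] by simp
  qed simp
  have "(\<Sum>s\<in>idx3 N. fc (?f s) n) = fc (\<lambda>t. \<Sum>s\<in>idx3 N. ?f s t) n"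
  proof -
    have c: "continuous_on {0..period} (\<lambda>t. \<Sum>s\<in>idx3 N. ?f s t)" by (rule continuous_on_sum[OF fc_s])
    have "integral {0..period} (\<lambda>t. (\<Sum>s\<in>idx3 N. ?f s t) * e (- n) t) = (\<Sum>s\<in>idx3 N. integral {0..period} (\<lambda>t. ?f s t * e (- n) t))"
      unfolding sum_distrib_right
      by (rule integral_sum[OF finite_idx3]) (intro continuous_integrable continuous_on_mult[OF fc_s e_continuous])
    then show ?thesis by (simp add: fc_eq[OF c] fc_eq[OF fc_s] sum_divide_distrib)
  qed
  moreover have "infsum (\<lambda>q. \<Sum>s\<in>idx3 N. ?g s q) UNIV = (\<Sum>s\<in>idx3 N. fc (?f s) n)"
    by (rule infsumI[OF sum[OF finite_idx3 order.refl]])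
  moreover have "tri (\<lambda>i l. cnj (x i l)) y z n N = infsum (\<lambda>q. \<Sum>s\<in>idx3 N. ?g s q) UNIV"
    by (simp add: tri_def coef3_idx3 case_prod_unfold)
  ultimately show ?thesis by (simp add: coef3_idx3 case_prod_unfold)
qed

end

section \<open>Fourier coefficients of the periodic solutions\<close>

lemma tendsto_0_schwartz_Rplus:
  assumes "\<And>k. \<exists>C. \<forall>x\<ge>0. norm (of_real (x ^ k) * f x :: complex) \<le> C"
  shows "(f \<longlongrightarrow> 0) at_top"
proof -
  obtain C where C: "\<And>x. 0 \<le> x \<Longrightarrow> norm (of_real (x ^ 1) * f x) \<le> C" using assms by blast
  have "((\<lambda>x::real. C / x) \<longlongrightarrow> 0) at_top"
    by (rule real_tendsto_divide_at_top[OF tendsto_const filterlim_ident])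
  moreover have "\<forall>\<^sub>F x in at_top. norm (f x) \<le> C / x"
    using eventually_gt_at_top[of 0]
  proof eventually_elim
    case (elim x)
    then show ?case using C[of x] by (simp add: norm_mult pos_le_divide_eq mult.commute)
  qed
  ultimately show ?thesis by (rule Lim_null_comparison[rotated])
qed

lemma tendsto_0_bigo_powr:
  fixes f :: "real \<Rightarrow> complex"
  assumes "f \<in> O[at_top](\<lambda>t. of_real (t powr (-3/2)))"
  shows "(f \<longlongrightarrow> 0) at_top"
proof -
  obtain c where c: "\<forall>\<^sub>F t in at_top. norm (f t) \<le> c * norm (of_real (t powr (-3/2)) :: complex)"
    using assms by (rule landau_o.bigE)
  have "((\<lambda>t::real. t powr (-3/2)) \<longlongrightarrow> 0) at_top"
    by (rule tendsto_neg_powr[OF _ filterlim_ident]) simp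
  then have "((\<lambda>t. c * t powr (-3/2)) \<longlongrightarrow> 0) at_top" by (rule tendsto_mult_right_zero)
  then show ?thesis by (rule Lim_null_comparison[rotated]) (use c in simp)
qed

text \<open>\<open>g\<close> is the uniform limit of the translates of \<open>q\<close> by multiples of the period.\<close>
lemma continuous_on_asymptotic_periodic:
  fixes q g :: "real \<Rightarrow> complex"
  assumes \<tau>: "0 < \<tau>" and q: "continuous_on {0..} q" and g: "\<And>t. 0 \<le> t \<Longrightarrow> g (t + \<tau>) = g t"
    and lim: "((\<lambda>t. q t - g t) \<longlongrightarrow> 0) at_top"
  shows "continuous_on {0..} g"
proof (rule uniform_limit_theorem[where F=sequentially and f="\<lambda>n t. q (t + real n * \<tau>)"])
  show "\<forall>\<^sub>F n in sequentially. continuous_on {0..} (\<lambda>t. q (t + real n * \<tau>))"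
  proof (rule always_eventually, rule allI)
    fix n show "continuous_on {0..} (\<lambda>t. q (t + real n * \<tau>))"
      by (rule continuous_on_compose2[OF q]) (use \<tau> in \<open>auto intro!: continuous_intros\<close>)
  qed
  show "uniform_limit {0..} (\<lambda>n t. q (t + real n * \<tau>)) g sequentially"
  proof (rule uniform_limitI)
    fix \<epsilon> :: real assume "0 < \<epsilon>"
    from tendstoD[OF lim this] obtain T where T: "\<And>t. T \<le> t \<Longrightarrow> dist (q t - g t) 0 < \<epsilon>"
      unfolding eventually_at_top_linorder by blast
    obtain n0 :: nat where n0: "T / \<tau> \<le> real n0" using real_arch_simple by blast
    have "dist (q (t + real n * \<tau>)) (g t) < \<epsilon>" if n: "n0 \<le> n" and t: "t \<in> {0..}" for n t
    proof -
      have "T \<le> real n0 * \<tau>" using n0 \<tau> by (simp add: pos_divide_le_eq)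
      also have "\<dots> \<le> real n * \<tau>" using n \<tau> by simp
      also have "\<dots> \<le> t + real n * \<tau>" using t by simp
      finally have "dist (q (t + real n * \<tau>) - g (t + real n * \<tau>)) 0 < \<epsilon>" by (rule T)
      moreover have "g (t + real n * \<tau>) = g t"
        by (rule periodic_nat[where f=g]) (use g t \<tau> in auto)
      ultimately show ?thesis by (simp add: dist_norm)
    qed
    then show "\<forall>\<^sub>F n in sequentially. \<forall>t\<in>{0..}. dist (q (t + real n * \<tau>)) (g t) < \<epsilon>"
      unfolding eventually_sequentially by blast
  qed
qed simp

section \<open>The boundary of the quadrant and its resonant points\<close>

lemma frontier_D10:
  assumes "k \<in> frontier D10"
  shows "0 \<le> Re k" "0 \<le> Im k" "Re k = 0 \<or> Im k = 0"
proof -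
  have op: "open D10" unfolding D10_def
    by (intro open_Collect_conj open_halfspace_Re_gt open_halfspace_Im_gt)
  have cl: "closed {k. 0 \<le> Re k \<and> 0 \<le> Im k}"
    by (intro closed_Collect_conj closed_halfspace_Re_ge closed_halfspace_Im_ge)
  have "closure D10 \<subseteq> {k. 0 \<le> Re k \<and> 0 \<le> Im k}"
    by (rule closure_minimal[OF _ cl]) (auto simp: D10_def)
  then have k: "0 \<le> Re k \<and> 0 \<le> Im k" using assms by (auto simp: frontier_def)
  then show "0 \<le> Re k" "0 \<le> Im k" by blast+
  have "k \<notin> D10" using assms op by (simp add: frontier_def interior_open)
  then show "Re k = 0 \<or> Im k = 0" using k unfolding D10_def by auto
qed

text \<open>On the axes k^2 is real and equals the difference of the two squares, so
  \<open>root\<close> is the equation 4k^2 + m omega = 0; the sign of m decides on which axis k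
  lies.\<close>

lemma axis_root_eq_k1:
  assumes om: "0 < \<omega>" and k: "0 \<le> Re k" "0 \<le> Im k" "Re k = 0 \<or> Im k = 0"
    and root: "4 * ((Re k)\<^sup>2 - (Im k)\<^sup>2) = - of_int m * \<omega>"
  shows "k = k1 \<omega> m"
proof (cases "0 \<le> m")
  case True
  then have m0: "0 \<le> of_int m * \<omega>" using om by simp
  have Re0: "Re k = 0"
  proof (rule ccontr)
    assume "Re k \<noteq> 0"
    then have "Im k = 0" and pos: "0 < (Re k)\<^sup>2" using k by auto
    then have "4 * (Re k)\<^sup>2 = - of_int m * \<omega>" using root by simp
    then show False using m0 pos by linarith
  qed
  then have "(2 * Im k)\<^sup>2 = of_int m * \<omega>" using root by (simp add: power_mult_distrib)
  then have "sqrt (of_int m * \<omega>) = 2 * Im k" using k by (intro real_sqrt_unique) auto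
  then show ?thesis using True Re0 by (simp add: k1_def complex_eq_iff)
next
  case False
  then have m0: "0 < - of_int m * \<omega>" using om by (simp add: mult_neg_pos)
  have Im0: "Im k = 0"
  proof (rule ccontr)
    assume "Im k \<noteq> 0"
    then have "Re k = 0" and pos: "0 < (Im k)\<^sup>2" using k by auto
    then have "- 4 * (Im k)\<^sup>2 = - of_int m * \<omega>" using root by simp
    then show False using m0 pos by linarith
  qed
  then have "(2 * Re k)\<^sup>2 = - of_int m * \<omega>" using root by (simp add: power_mult_distrib)
  then have "sqrt (- of_int m * \<omega>) = 2 * Re k" using k by (intro real_sqrt_unique) auto
  then show ?thesis using False Im0 by (simp add: k1_def complex_eq_iff)
qed

lemma k1_root:
  assumes "0 < \<omega>"
  shows "4 * \<i> * (k1 \<omega> n)\<^sup>2 + \<i> * of_int n * of_real \<omega> = 0"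
proof (cases "0 \<le> n")
  case True
  have "(of_real (sqrt (of_int n * \<omega>)))\<^sup>2 = (of_int n * of_real \<omega> :: complex)"
    using True assms by (simp flip: of_real_power)
  then show ?thesis using True by (simp add: k1_def power_mult_distrib power_divide)
next
  case False
  have "(of_real (sqrt (- of_int n * \<omega>)))\<^sup>2 = (- (of_int n * of_real \<omega>) :: complex)"
    using False assms by (simp add: mult_nonpos_nonneg flip: of_real_power)
  then show ?thesis using False by (simp add: k1_def power_divide)
qed

context trig
begin

lemma fc_add:
  assumes "continuous_on {0..period} f" "continuous_on {0..period} g"
  shows "fc (\<lambda>t. f t + g t) n = fc f n + fc g n"
proof -
  have "integral {0..period} (\<lambda>t. (f t + g t) * e (- n) t) = integral {0..period} (\<lambda>t. f t * e (- n) t) + integral {0..period} (\<lambda>t. g t * e (- n) t)"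
    unfolding distrib_right
    by (rule integral_add; intro continuous_integrable continuous_on_mult assms e_continuous)
  then show ?thesis
    by (simp add: fc_eq[OF assms(1)] fc_eq[OF assms(2)] fc_eq[OF continuous_on_add[OF assms]] add_divide_distrib)
qed

lemma fc_cmult:
  assumes "continuous_on {0..period} f"
  shows "fc (\<lambda>t. c * f t) n = c * fc f n"
proof -
  have "integral {0..period} (\<lambda>t. c * f t * e (- n) t) = c * integral {0..period} (\<lambda>t. f t * e (- n) t)"
    unfolding mult.assoc by (rule integral_mult_right)
  then show ?thesis
    by (simp add: fc_eq[OF assms] fc_eq[OF continuous_on_mult[OF continuous_on_const assms]])
qed

lemma fc_diff:
  assumes "continuous_on {0..period} f" "continuous_on {0..period} g"
  shows "fc (\<lambda>t. f t - g t) n = fc f n - fc g n"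
  using fc_add[OF assms(1) continuous_on_mult[OF continuous_on_const[of _ "-1"] assms(2)]] fc_cmult[OF assms(2), of "-1"]
  by simp

lemma norm_fc_le:
  assumes f: "continuous_on {0..period} f" and M: "\<And>t. t \<in> {0..period} \<Longrightarrow> cmod (f t) \<le> M"
  shows "cmod (fc f n) \<le> M"
proof -
  have "norm (integral {0..period} (\<lambda>t. f t * e (- n) t)) \<le> M * (period - 0)"
    by (rule integral_bound)
       (use period_pos M in \<open>auto intro!: continuous_on_mult f e_continuous simp: norm_mult norm_e\<close>)
  then show ?thesis using period_pos by (simp add: fc_eq[OF f] norm_divide pos_divide_le_eq)
qed

end

text \<open>Continuous differentiability is demanded of g_0N alone. It follows from the Schwartz
  property of its remainder, whereas the decay rate of the remainder of g_1N carries no information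
  on derivatives.\<close>

locale nls_fourier = trig \<omega> + nls_periodic lam Q "2 * pi / \<omega>" g0 g1
  for \<omega> lam :: real and Q :: "nat \<Rightarrow> nat \<Rightarrow> nat \<Rightarrow> real \<Rightarrow> real \<Rightarrow> complex" and g0 g1 +
  assumes smooth0: "\<And>N. 1 \<le> N \<Longrightarrow> \<exists>g'. continuous_on {0..} g' \<and>
     (\<forall>t\<ge>0. (g0 N has_vector_derivative g' t) (at t within {0..}))"
begin

lemma g0_series:
  assumes N: "1 \<le> N"
  shows "t \<in> {0..period} \<Longrightarrow> ((\<lambda>n. fc (g0 N) n * e n t) has_sum g0 N t) UNIV"
    and "(\<lambda>n. cmod (fc (g0 N) n)) summable_on UNIV"
proof -
  obtain g' where g': "continuous_on {0..} g'" "\<And>t. 0 \<le> t \<Longrightarrow> (g0 N has_vector_derivative g' t) (at t within {0..})"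
    using smooth0[OF N] by blast
  have p: "g0 N (t + period) = g0 N t" if "0 \<le> t" for t
    using per0[OF N that] by (simp add: period_def)
  show "t \<in> {0..period} \<Longrightarrow> ((\<lambda>n. fc (g0 N) n * e n t) has_sum g0 N t) UNIV"
    by (rule fourier_series(1)[OF g'(2,1) p])
  show "(\<lambda>n. cmod (fc (g0 N) n)) summable_on UNIV"
    by (rule fourier_series(2)[OF g'(2,1) p, of 0]) (use period_pos in auto)
qed

context
  fixes k :: complex
  assumes E: "exp (4*\<i>*k\<^sup>2 * of_real (2 * pi / \<omega>)) \<noteq> 1"
begin

lemma P_deriv:
  "1 \<le> N \<Longrightarrow> 0 \<le> t \<Longrightarrow>
    (P k N has_vector_derivative perF lam k g0 g1 (P k) N t - 4*\<i>*k\<^sup>2 * P k N t) (at t within {0..})"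
  using per_ode[OF E] by blast

lemma P_periodic: "1 \<le> N \<Longrightarrow> 0 \<le> t \<Longrightarrow> P k N (t + period) = P k N t"
  using per_ode[OF E] by (simp add: period_def)

lemma P_deriv_continuous:
  assumes N: "1 \<le> N"
  shows "continuous_on {0..} (\<lambda>t. perF lam k g0 g1 (P k) N t - 4*\<i>*k\<^sup>2 * P k N t)"
  by (intro continuous_on_diff continuous_on_mult continuous_on_const perF_continuous per_continuous[OF E] N)

lemma P_series:
  assumes N: "1 \<le> N"
  shows "t \<in> {0..period} \<Longrightarrow> ((\<lambda>n. fc (P k N) n * e n t) has_sum P k N t) UNIV"
    and "(\<lambda>n. cmod (fc (P k N) n)) summable_on UNIV"
proof -
  show "t \<in> {0..period} \<Longrightarrow> ((\<lambda>n. fc (P k N) n * e n t) has_sum P k N t) UNIV"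
    by (rule fourier_series(1)[OF P_deriv[OF N] P_deriv_continuous[OF N] P_periodic[OF N]])
  show "(\<lambda>n. cmod (fc (P k N) n)) summable_on UNIV"
    by (rule fourier_series(2)[OF P_deriv[OF N] P_deriv_continuous[OF N] P_periodic[OF N], of 0]) (use period_pos in auto)
qed

text \<open>In each cubic term of \<open>perF\<close> the conjugated factor comes from the data, and
  the other two are P or g_0N, which have absolutely summable coefficients. Besides its linear term
  g_1N occurs only conjugated, in the place where \<open>fc_product\<close> asks for continuity
  only.\<close>

lemma fourier_relation:
  assumes N: "1 \<le> N"
  defines "d \<equiv> \<lambda>i m. fc (P k i) m" and "a \<equiv> \<lambda>i m. fc (g0 i) m" and "c \<equiv> \<lambda>i m. fc (g1 i) m"
  shows "(4 * \<i> * k\<^sup>2 + \<i> * of_int n * of_real \<omega>) * d N n =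
     - 2 * of_real lam * k * tri (\<lambda>i l. cnj (a i l)) d d n N
           + \<i> * of_real lam * tri (\<lambda>i l. cnj (c i l)) d d n N
           - 2 * \<i> * of_real lam * tri (\<lambda>i l. cnj (a i l)) a d n N
           + 2 * k * a N n + \<i> * c N n"
proof -
  have sub: "continuous_on {0..period} f" if "continuous_on {0..} f" for f :: "real \<Rightarrow> complex"
    by (rule continuous_on_subset[OF that]) auto
  have cP: "continuous_on {0..period} (P k i)" if "1 \<le> i" for i by (rule sub[OF per_continuous[OF E that]])
  have c0: "continuous_on {0..period} (g0 i)" if "1 \<le> i" for i by (rule sub[OF cont0[OF that]])
  have c1: "continuous_on {0..period} (g1 i)" if "1 \<le> i" for i by (rule sub[OF cont1[OF that]])
  let ?A = "\<lambda>t. coef3 (\<lambda>i. cnj (g0 i t)) (\<lambda>j. P k j t) (\<lambda>p. P k p t) N"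
  let ?B = "\<lambda>t. coef3 (\<lambda>i. cnj (g1 i t)) (\<lambda>j. P k j t) (\<lambda>p. P k p t) N"
  let ?C = "\<lambda>t. coef3 (\<lambda>i. cnj (g0 i t)) (\<lambda>j. g0 j t) (\<lambda>p. P k p t) N"
  have fA: "fc ?A n = tri (\<lambda>i l. cnj (a i l)) d d n N"
    by (rule fc_coef3) (auto simp: a_def d_def intro: c0 cP P_series)
  have fB: "fc ?B n = tri (\<lambda>i l. cnj (c i l)) d d n N"
    by (rule fc_coef3) (auto simp: c_def d_def intro: c1 cP P_series)
  have fC: "fc ?C n = tri (\<lambda>i l. cnj (a i l)) a d n N"
    by (rule fc_coef3) (auto simp: a_def d_def intro: c0 cP P_series g0_series)
  have cA: "continuous_on {0..period} ?A" and cB: "continuous_on {0..period} ?B" and cC: "continuous_on {0..period} ?C"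
    by (intro continuous_on_coef3 continuous_on_cnj c0 c1 cP; assumption)+
  have t1: "continuous_on {0..period} (\<lambda>t. 2 * k * g0 N t)" and t2: "continuous_on {0..period} (\<lambda>t. \<i> * g1 N t)"
    and t3: "continuous_on {0..period} (\<lambda>t. 2 * of_real lam * k * ?A t)"
    and t4: "continuous_on {0..period} (\<lambda>t. \<i> * of_real lam * ?B t)"
    and t5: "continuous_on {0..period} (\<lambda>t. 2 * \<i> * of_real lam * ?C t)"
    by (intro continuous_on_mult continuous_on_const c0[OF N] c1[OF N] cA cB cC)+
  have cF: "continuous_on {0..period} (perF lam k g0 g1 (P k) N)"
    by (rule sub[OF perF_continuous[OF N per_continuous[OF E]]])
  have "perF lam k g0 g1 (P k) N = (\<lambda>t. 2 * k * g0 N t + \<i> * g1 N t - 2 * of_real lam * k * ?A t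
      + \<i> * of_real lam * ?B t - 2 * \<i> * of_real lam * ?C t)"
    by (rule ext) (rule perF_def)
  then have "fc (perF lam k g0 g1 (P k) N) n = fc (\<lambda>t. 2 * k * g0 N t + \<i> * g1 N t - 2 * of_real lam * k * ?A t
      + \<i> * of_real lam * ?B t - 2 * \<i> * of_real lam * ?C t) n" by (simp only:)
  also have "\<dots> = 2 * k * a N n + \<i> * c N n - 2 * of_real lam * k * fc ?A n
      + \<i> * of_real lam * fc ?B n - 2 * \<i> * of_real lam * fc ?C n"
    by (simp only: fc_diff[OF continuous_on_add[OF continuous_on_diff[OF continuous_on_add[OF t1 t2] t3] t4] t5]
        fc_add[OF continuous_on_diff[OF continuous_on_add[OF t1 t2] t3] t4] fc_diff[OF continuous_on_add[OF t1 t2] t3]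
        fc_add[OF t1 t2] fc_cmult[OF c0[OF N]] fc_cmult[OF c1[OF N]] fc_cmult[OF cA] fc_cmult[OF cB] fc_cmult[OF cC] a_def c_def)
  finally have fF: "fc (perF lam k g0 g1 (P k) N) n = 2 * k * a N n + \<i> * c N n
     - 2 * of_real lam * k * tri (\<lambda>i l. cnj (a i l)) d d n N
     + \<i> * of_real lam * tri (\<lambda>i l. cnj (c i l)) d d n N
     - 2 * \<i> * of_real lam * tri (\<lambda>i l. cnj (a i l)) a d n N" unfolding fA fB fC .
  have "fc (\<lambda>t. perF lam k g0 g1 (P k) N t - 4*\<i>*k\<^sup>2 * P k N t) n = \<i> * of_int n * of_real \<omega> * fc (P k N) n"
  proof (rule fc_deriv)
    show "(P k N has_vector_derivative perF lam k g0 g1 (P k) N t - 4*\<i>*k\<^sup>2 * P k N t) (at t within {0..period})"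
      if "t \<in> {0..period}" for t
      by (rule has_vector_derivative_within_subset[OF P_deriv[OF N]]) (use that in auto)
    show "P k N period = P k N 0" using P_periodic[OF N, of 0] by simp
  qed (rule sub[OF P_deriv_continuous[OF N]])
  moreover have "fc (\<lambda>t. perF lam k g0 g1 (P k) N t - 4*\<i>*k\<^sup>2 * P k N t) n
      = fc (perF lam k g0 g1 (P k) N) n - 4*\<i>*k\<^sup>2 * fc (P k N) n"
    by (simp only: fc_diff[OF cF continuous_on_mult[OF continuous_on_const cP[OF N]]] fc_cmult[OF cP[OF N]])
  ultimately have "(4 * \<i> * k\<^sup>2 + \<i> * of_int n * of_real \<omega>) * d N n = fc (perF lam k g0 g1 (P k) N) n"
    by (simp add: d_def algebra_simps)
  then show ?thesis unfolding fF by simp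
qed

end

text \<open>On the axes 4ik^2 is imaginary, so its exponential over a period is 1 only if 4k^2 is an
  integer multiple of omega, that is at a point of \<open>range (k1 \<omega>)\<close>. One exclusion
  thus serves both the periodic solution and the denominator of d.\<close>

lemma frontier_nonresonant:
  assumes k: "k \<in> frontier D10 - range (k1 \<omega>)"
  shows "exp (4*\<i>*k\<^sup>2 * of_real (2 * pi / \<omega>)) \<noteq> 1"
    and "4 * \<i> * k\<^sup>2 + \<i> * of_int n * of_real \<omega> \<noteq> 0"
proof -
  have fr: "0 \<le> Re k" "0 \<le> Im k" "Re k = 0 \<or> Im k = 0" using frontier_D10 k by blast+
  have no_root: False if "4 * ((Re k)\<^sup>2 - (Im k)\<^sup>2) = - of_int m * \<omega>" for m
    using axis_root_eq_k1[OF om fr that] k by blast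
  show "exp (4*\<i>*k\<^sup>2 * of_real (2 * pi / \<omega>)) \<noteq> 1"
  proof
    assume "exp (4*\<i>*k\<^sup>2 * of_real (2 * pi / \<omega>)) = 1"
    then obtain m :: int where m: "Im (4*\<i>*k\<^sup>2 * of_real (2 * pi / \<omega>)) = of_int (2 * m) * pi"
      unfolding exp_eq_1 by blast
    have "Im (4*\<i>*k\<^sup>2 * of_real (2 * pi / \<omega>)) = Im (4*\<i>*k\<^sup>2) * (2 * pi / \<omega>)" by simp
    also have "Im (4*\<i>*k\<^sup>2) = 4 * ((Re k)\<^sup>2 - (Im k)\<^sup>2)" by (simp add: power2_eq_square)
    finally have f: "Im (4*\<i>*k\<^sup>2 * of_real (2 * pi / \<omega>)) = 4 * ((Re k)\<^sup>2 - (Im k)\<^sup>2) * (2 * pi / \<omega>)" .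
    have "4 * ((Re k)\<^sup>2 - (Im k)\<^sup>2) * (2 * pi / \<omega>) = of_int (2 * m) * pi" by (rule trans[OF f[symmetric] m])
    then have "4 * ((Re k)\<^sup>2 - (Im k)\<^sup>2) * (2 * pi / \<omega>) = (of_int m * \<omega>) * (2 * pi / \<omega>)" using om by simp
    then have "4 * ((Re k)\<^sup>2 - (Im k)\<^sup>2) = of_int m * \<omega>"
      by (rule mult_right_cancel[THEN iffD1, rotated]) (use om in simp)
    \<comment> \<open>The exponent 2 pi i m corresponds to 4k^2 = m omega, hence to k_1(-m).\<close>
    then show False using no_root[of "- m"] by simp
  qed
  show "4 * \<i> * k\<^sup>2 + \<i> * of_int n * of_real \<omega> \<noteq> 0"
  proof
    assume 0: "4 * \<i> * k\<^sup>2 + \<i> * of_int n * of_real \<omega> = 0"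
    have "Im (4 * \<i> * k\<^sup>2 + \<i> * of_int n * of_real \<omega>) = 4 * ((Re k)\<^sup>2 - (Im k)\<^sup>2) + of_int n * \<omega>"
      by (simp add: power2_eq_square)
    then have "4 * ((Re k)\<^sup>2 - (Im k)\<^sup>2) = - of_int n * \<omega>" unfolding 0 by simp
    then show False by (rule no_root)
  qed
qed

text \<open>M does not depend on k, so the bound stays effective as k approaches an excluded
  point.\<close>

lemma P_coeff_bound:
  assumes N: "1 \<le> N"
  shows "\<exists>M. \<forall>k\<in>frontier D10 - range (k1 \<omega>). \<forall>n. cmod (fc (P k N) n) \<le> M"
proof -
  from per_bound_closure[OF N] obtain M where M: "\<forall>k t. 0 \<le> Re k \<longrightarrow> 0 \<le> Im k \<longrightarrow>
     exp (4*\<i>*k\<^sup>2 * of_real (2 * pi / \<omega>)) \<noteq> 1 \<longrightarrow> 0 \<le> t \<longrightarrow> cmod (P k N t) \<le> M" by (rule exE)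
  have "cmod (fc (P k N) n) \<le> M" if k: "k \<in> frontier D10 - range (k1 \<omega>)" for k n
  proof (rule norm_fc_le)
    have E: "exp (4*\<i>*k\<^sup>2 * of_real (2 * pi / \<omega>)) \<noteq> 1" by (rule frontier_nonresonant(1)[OF k])
    have "0 \<le> Re k" "0 \<le> Im k" using frontier_D10 k by blast+
    then show "cmod (P k N t) \<le> M" if "t \<in> {0..period}" for t using M E that by simp
    show "continuous_on {0..period} (P k N)"
      by (rule continuous_on_subset[OF per_continuous[OF E N]]) auto
  qed
  then show ?thesis by blast
qed

end

text \<open>Evaluation at k_1(n) is read as a limit along the boundary of the quadrant, because the
  denominator of d_n vanishes there. The sums contain every d_m, so all resonant points are removed;
  they form a discrete set, hence k_1(n) is still approached by admissible k and the limit
  determines the coefficient.\<close>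

theorem theorem2p1:
  fixes lam \<omega> :: real
    and g0 g1 :: "nat \<Rightarrow> real \<Rightarrow> complex"
    and a c :: "nat \<Rightarrow> int \<Rightarrow> complex"
    and Q :: "nat \<Rightarrow> nat \<Rightarrow> nat \<Rightarrow> real \<Rightarrow> real \<Rightarrow> complex"
  assumes lam: "lam = 1 \<or> lam = -1"
    and om: "0 < \<omega>"
    and per0: "\<And>N t. 1 \<le> N \<Longrightarrow> g0 N (t + 2 * pi / \<omega>) = g0 N t"
    and per1: "\<And>N t. 1 \<le> N \<Longrightarrow> g1 N (t + 2 * pi / \<omega>) = g1 N t"
    and int0: "\<And>N. 1 \<le> N \<Longrightarrow> set_integrable lborel {0..2 * pi / \<omega>} (g0 N)"
    and int1: "\<And>N. 1 \<le> N \<Longrightarrow> set_integrable lborel {0..2 * pi / \<omega>} (g1 N)"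
    and fa: "\<And>N n. 1 \<le> N \<Longrightarrow> a N n = fourier_coeff \<omega> (g0 N) n"
    and fc: "\<And>N n. 1 \<le> N \<Longrightarrow> c N n = fourier_coeff \<omega> (g1 N) n"
    and sol: "pert_sol lam Q"
    and hA: "\<And>N. 1 \<le> N \<Longrightarrow> schwartz_Rplus (\<lambda>t. Q N 0 0 0 t - g0 N t)"
    and hB: "\<And>N. 1 \<le> N \<Longrightarrow>
               (\<lambda>t. Q N 1 0 0 t - g1 N t) \<in> O[at_top](\<lambda>t. of_real (t powr (-3/2)))"
    and hC: "\<And>N. 1 \<le> N \<Longrightarrow> \<exists>M. \<forall>t\<ge>0.
               set_integrable lborel {0..} (\<lambda>x. Q N 0 0 x t) \<and>
               (LINT x:{0..}|lborel. norm (Q N 0 0 x t)) \<le> M"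
  shows "\<exists>d :: nat \<Rightarrow> int \<Rightarrow> complex \<Rightarrow> complex.
     (\<forall>N\<ge>1. \<forall>n. \<forall>k \<in> frontier D10 - range (k1 \<omega>).
        d N n k =
          (- 2 * of_real lam * k * tri (\<lambda>i l. cnj (a i l)) (\<lambda>i m. d i m k) (\<lambda>i m. d i m k) n N
           + \<i> * of_real lam * tri (\<lambda>i l. cnj (c i l)) (\<lambda>i m. d i m k) (\<lambda>i m. d i m k) n N
           - 2 * \<i> * of_real lam * tri (\<lambda>i l. cnj (a i l)) a (\<lambda>i m. d i m k) n N
           + 2 * k * a N n + \<i> * c N n)
          / (4 * \<i> * k\<^sup>2 + \<i> * of_int n * of_real \<omega>)) \<and>
     (\<forall>N\<ge>1. \<forall>n.
        ((\<lambda>k. - 2 * \<i> * of_real lam * k * tri (\<lambda>i l. cnj (a i l)) (\<lambda>i m. d i m k) (\<lambda>i m. d i m k) n N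
              - of_real lam * tri (\<lambda>i l. cnj (c i l)) (\<lambda>i m. d i m k) (\<lambda>i m. d i m k) n N
              + 2 * of_real lam * tri (\<lambda>i l. cnj (a i l)) a (\<lambda>i m. d i m k) n N
              + 2 * \<i> * k * a N n)
          \<longlongrightarrow> c N n) (at (k1 \<omega> n) within (frontier D10 - range (k1 \<omega>))))"
proof -
  let ?S = "frontier D10 - range (k1 \<omega>)"
  have \<tau>: "0 < 2 * pi / \<omega>" using om by simp
  interpret nls_hierarchy lam Q
    by unfold_locales (fact sol, fact hC)
  have F_ex: "\<exists>F. (\<forall>t\<ge>0. F 0 t = Q N 0 0 0 t - g0 N t) \<and>
      (\<forall>j. \<forall>t\<ge>0. (F j has_vector_derivative F (Suc j) t) (at t within {0..})) \<and>
      (\<forall>j k. \<exists>C. \<forall>t\<ge>0. norm (of_real (t ^ k) * F j t) \<le> C)" if "1 \<le> N" for N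
    using hA[OF that] unfolding schwartz_Rplus_def .
  \<comment> \<open>g_0N is the smooth boundary value of q_N minus the smooth remainder
    \<open>F 0\<close>.\<close>
  have smooth: "\<exists>g'. continuous_on {0..} g' \<and> (\<forall>t\<ge>0. (g0 N has_vector_derivative g' t) (at t within {0..}))"
    if N: "1 \<le> N" for N
  proof -
    from F_ex[OF N] obtain F where F: "(\<forall>t\<ge>0. F 0 t = Q N 0 0 0 t - g0 N t) \<and>
      (\<forall>j. \<forall>t\<ge>0. (F j has_vector_derivative F (Suc j) t) (at t within {0..})) \<and>
      (\<forall>j k. \<exists>C. \<forall>t\<ge>0. norm (of_real (t ^ k) * F j t) \<le> C)" by (rule exE)
    have F0: "g0 N t = Q N 0 0 0 t - F 0 t" if "t \<in> {0..}" for t using F that by simp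
    have Fd: "(F j has_vector_derivative F (Suc j) t) (at t within {0..})" if "0 \<le> t" for j t
      using F that by blast
    have Fc: "continuous_on {0..} (F j)" for j
      by (rule continuous_on_vector_derivative[OF Fd]) simp
    have "(g0 N has_vector_derivative Q N 0 1 0 t - F 1 t) (at t within {0..})" if t: "0 \<le> t" for t
    proof (rule has_vector_derivative_transform[OF _ F0])
      show "((\<lambda>t. Q N 0 0 0 t - F 0 t) has_vector_derivative Q N 0 1 0 t - F 1 t) (at t within {0..})"
        using has_vector_derivative_diff[OF Q_dt[OF N order.refl t, of 0 0] Fd[OF t, of 0]] by simp
    qed (use t in simp)
    moreover have "continuous_on {0..} (\<lambda>t. Q N 0 1 0 t - F 1 t)"
      by (intro continuous_on_diff Fc qcont_t[OF Q_qcont[OF N]] order.refl)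
    ultimately show ?thesis by blast
  qed
  have g0c: "continuous_on {0..} (g0 N)" if N: "1 \<le> N" for N
  proof -
    from smooth[OF N] obtain g' where "\<forall>t\<ge>0. (g0 N has_vector_derivative g' t) (at t within {0..})" by blast
    then show ?thesis by (intro continuous_on_vector_derivative[of _ _ g']) auto
  qed
  have lim0: "((\<lambda>t. Q N 0 0 0 t - g0 N t) \<longlongrightarrow> 0) at_top" if N: "1 \<le> N" for N
  proof (rule tendsto_0_schwartz_Rplus)
    fix k
    from F_ex[OF N] obtain F where F: "(\<forall>t\<ge>0. F 0 t = Q N 0 0 0 t - g0 N t) \<and>
      (\<forall>j. \<forall>t\<ge>0. (F j has_vector_derivative F (Suc j) t) (at t within {0..})) \<and>
      (\<forall>j k. \<exists>C. \<forall>t\<ge>0. norm (of_real (t ^ k) * F j t) \<le> C)" by (rule exE)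
    then obtain C where "\<forall>t\<ge>0. norm (of_real (t ^ k) * F 0 t) \<le> C" by blast
    then show "\<exists>C. \<forall>t\<ge>0. norm (of_real (t ^ k) * (Q N 0 0 0 t - g0 N t)) \<le> C" using F by auto
  qed
  have lim1: "((\<lambda>t. Q N 1 0 0 t - g1 N t) \<longlongrightarrow> 0) at_top" if N: "1 \<le> N" for N
    by (rule tendsto_0_bigo_powr[OF hB[OF N]])
  have g1c: "continuous_on {0..} (g1 N)" if N: "1 \<le> N" for N
    by (rule continuous_on_asymptotic_periodic[OF \<tau> qcont_t[OF Q_qcont[OF N] order.refl] per1[OF N] lim1[OF N]])
  interpret nls_fourier \<omega> lam Q g0 g1
  proof unfold_locales
    show "\<exists>g'. continuous_on {0..} g' \<and> (\<forall>t\<ge>0. (g0 N has_vector_derivative g' t) (at t within {0..}))"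
      if "1 \<le> N" for N by (rule smooth[OF that])
    show "asy (\<lambda>t. Q N 0 0 0 t) (g0 N)" if N: "1 \<le> N" for N
      unfolding asy_def by (intro conjI lim0[OF N] periodic_bounded[OF \<tau> g0c[OF N] per0[OF N]])
    show "asy (\<lambda>t. Q N 1 0 0 t) (g1 N)" if N: "1 \<le> N" for N
      unfolding asy_def by (intro conjI lim1[OF N] periodic_bounded[OF \<tau> g1c[OF N] per1[OF N]])
  qed (use om \<tau> per0 per1 g0c g1c in auto)
  define d where "d = (\<lambda>N n k. fourier_coeff \<omega> (P k N) n)"
  \<comment> \<open>The families a and c agree with the Fourier coefficients only from order 1 on;
    \<open>coef3\<close> reads no other orders.\<close>
  have tri_a: "tri (\<lambda>i l. cnj (a i l)) X Y n N = tri (\<lambda>i l. cnj (fourier_coeff \<omega> (g0 i) l)) X Y n N" for X Y n N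
    unfolding tri_def by (intro infsum_cong) (auto intro!: coef3_cong simp: fa)
  have tri_c: "tri (\<lambda>i l. cnj (c i l)) X Y n N = tri (\<lambda>i l. cnj (fourier_coeff \<omega> (g1 i) l)) X Y n N" for X Y n N
    unfolding tri_def by (intro infsum_cong) (auto intro!: coef3_cong simp: fc)
  have tri_a2: "tri X a Y n N = tri X (\<lambda>i l. fourier_coeff \<omega> (g0 i) l) Y n N" for X Y n N
    unfolding tri_def by (intro infsum_cong) (auto intro!: coef3_cong simp: fa)
  let ?V = "\<lambda>N n k. - 2 * of_real lam * k * tri (\<lambda>i l. cnj (a i l)) (\<lambda>i m. d i m k) (\<lambda>i m. d i m k) n N
           + \<i> * of_real lam * tri (\<lambda>i l. cnj (c i l)) (\<lambda>i m. d i m k) (\<lambda>i m. d i m k) n N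
           - 2 * \<i> * of_real lam * tri (\<lambda>i l. cnj (a i l)) a (\<lambda>i m. d i m k) n N
           + 2 * k * a N n + \<i> * c N n"
  have rel: "(4 * \<i> * k\<^sup>2 + \<i> * of_int n * of_real \<omega>) * d N n k = ?V N n k" if N: "1 \<le> N" and k: "k \<in> ?S" for N n k
    using fourier_relation[OF frontier_nonresonant(1)[OF k] N, of n]
    unfolding tri_a tri_c tri_a2 fa[OF N] fc[OF N] d_def .
  show ?thesis
  proof (intro exI[of _ d] conjI allI impI ballI)
    fix N :: nat and n :: int and k assume N: "1 \<le> N" and k: "k \<in> ?S"
    show "d N n k = ?V N n k / (4 * \<i> * k\<^sup>2 + \<i> * of_int n * of_real \<omega>)"
      unfolding rel[OF N k, symmetric]
      by (rule nonzero_mult_div_cancel_left[OF frontier_nonresonant(2)[OF k], symmetric])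
  next
    fix N :: nat and n :: int assume N: "1 \<le> N"
    let ?f = "\<lambda>k. - 2 * \<i> * of_real lam * k * tri (\<lambda>i l. cnj (a i l)) (\<lambda>i m. d i m k) (\<lambda>i m. d i m k) n N
              - of_real lam * tri (\<lambda>i l. cnj (c i l)) (\<lambda>i m. d i m k) (\<lambda>i m. d i m k) n N
              + 2 * of_real lam * tri (\<lambda>i l. cnj (a i l)) a (\<lambda>i m. d i m k) n N
              + 2 * \<i> * k * a N n"
    \<comment> \<open>Multiplying the numerator of d by i turns it, term by term, into the formula
      for c with c itself subtracted, since i times \<open>\<i> * c N n\<close> is
      \<open>- c N n\<close>.\<close>
    have f: "?f k - c N n = \<i> * ((4 * \<i> * k\<^sup>2 + \<i> * of_int n * of_real \<omega>) * d N n k)" if k: "k \<in> ?S" for k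
      unfolding rel[OF N k] by (simp add: algebra_simps)
    from P_coeff_bound[OF N] obtain M where M: "\<forall>k\<in>?S. \<forall>n. cmod (fourier_coeff \<omega> (P k N) n) \<le> M" by (rule exE)
    have "((\<lambda>k. 4 * \<i> * k\<^sup>2 + \<i> * of_int n * of_real \<omega>) \<longlongrightarrow>
        4 * \<i> * (k1 \<omega> n)\<^sup>2 + \<i> * of_int n * of_real \<omega>) (at (k1 \<omega> n) within ?S)"
      by (intro tendsto_intros)
    then have z: "((\<lambda>k. 4 * \<i> * k\<^sup>2 + \<i> * of_int n * of_real \<omega>) \<longlongrightarrow> 0) (at (k1 \<omega> n) within ?S)"
      by (simp only: k1_root[OF om])
    have "((\<lambda>k. ?f k - c N n) \<longlongrightarrow> 0) (at (k1 \<omega> n) within ?S)"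
    proof (rule tendsto_0_le[OF z, where K=M])
      show "\<forall>\<^sub>F k in at (k1 \<omega> n) within ?S. norm (?f k - c N n) \<le> norm (4 * \<i> * k\<^sup>2 + \<i> * of_int n * of_real \<omega>) * M"
        unfolding eventually_at_filter
      proof (rule always_eventually, intro allI impI)
        fix k assume k: "k \<in> ?S"
        have "cmod (d N n k) \<le> M" using M k unfolding d_def by blast
        then show "norm (?f k - c N n) \<le> norm (4 * \<i> * k\<^sup>2 + \<i> * of_int n * of_real \<omega>) * M"
          unfolding f[OF k] norm_mult norm_ii mult_1 by (rule mult_left_mono[OF _ norm_ge_zero])
      qed
    qed
    then show "(?f \<longlongrightarrow> c N n) (at (k1 \<omega> n) within ?S)" by (rule LIM_zero_cancel)
  qed
qed

end
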